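(* Assume that for all $1\le j\le i$, $\mathbb{E}(X_{ij}\mid\mathcal{F}_{ij}^{1})=0$ a.s. Assume also that for some non-decreasing function $h:[0,\infty)\to[1,\infty)$ such that $x^{-1}h(x)$ is non-increasing and $\sum_{n\ge1}(nh(n))^{-1}<\infty$, there exists a positive constant $C$ such that $\sup_{i,j}\mathbb{E}\big(X_{ij}^{2}h(|X_{ij}|)\big)\le C$, and that $$\lim_{a\to\infty}\limsup_{n\to\infty}\frac{1}{n^{2}}\sum_{1\le j\le i\le n}\big|\mathbb{E}(X_{ij}^{2}-\sigma_{ij}^{2}\mid\mathcal{F}_{ij}^{a})\big|=0\quad\text{a.s.}$$ If in addition $$\frac{1}{n^{2}}\sum_{1\le j\le i\le n}|\sigma_{ij}^{2}-1|\to0\quad\text{as }n\to\infty,$$ then $$\mathbf{F}^{\mathbb{X}_{n}}\Rightarrow G\quad\text{a.s.},$$ where $G$ is the distribution function of the standard semicircle law.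
   Context: $(X_{ij})_{(i,j)\in\mathbb{Z}^{2}}$ are real-valued random variables on a probability space $(\Omega,\mathcal{F},\mathbb{P})$ with $\mathbb{E}(X_{ij})=0$ and $\mathbb{E}(X_{ij}^{2})=\sigma_{ij}^{2}<\infty$. $\mathbf{X}_{n}$ is the symmetric $n\times n$ matrix with $(\mathbf{X}_{n})_{ij}=X_{ij}$ for $i\ge j$ and $(\mathbf{X}_{n})_{ij}=X_{ji}$ for $i<j$; $\mathbb{X}_{n}=n^{-1/2}\mathbf{X}_{n}$. For a symmetric $n\times n$ matrix $A$ with eigenvalues $\lambda_1\le\dots\le\lambda_n$, $\mathbf{F}^{A}(t)=\frac1n\sum_{k=1}^{n}I(\lambda_{k}\le t)$. The Lévy distance is $d(F,G)=\inf\{\varepsilon>0: F(x-\varepsilon)-\varepsilon\le G(x)\le F(x+\varepsilon)+\varepsilon\ \text{for all }x\}$. "$\mathbf{F}_n\Rightarrow\mathbf{F}$ a.s." means $\mathbb{P}(\lim_{n\to\infty}d(\mathbf{F}_n,\mathbf{F})=0)=1$. Lexicographic order on $\mathbb{Z}^{2}$: $(u,v)\le_{\mathrm{lex}}(i,j)$ means $u<i$, or $u=i$ and $v\le j$. For a non-negative integer $a$, let $B_{ij}^{a}=\{(u,v)\in\mathbb{Z}^{2}:\max(|u-i|,|v-j|)\ge a,\ (u,v)\le_{\mathrm{lex}}(i,j)\}$, and for $i\ge j$ let $\mathcal{F}_{ij}^{a}=\sigma(X_{uv}:(u,v)\in B_{ij}^{a}\text{ and }v\le u)$ (the trivial $\sigma$-algebra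 if $B_{ij}^a=\emptyset$). The standard semicircle law has density $g(x)=\frac{1}{2\pi}\sqrt{4-x^{2}}\,I(|x|\le2)$ and distribution function $G(x)=\int_{-\infty}^{x}g(u)\,du$. *)

theory Defs
  imports
    "HOL-Probability.Probability"
    "HOL-Computational_Algebra.Computational_Algebra"
    "Jordan_Normal_Form.Char_Poly"
begin

(* Row and column indices of the library matrices start at 0, hence the shift. *)
definition sym_matrix :: "(int \<Rightarrow> int \<Rightarrow> 'a \<Rightarrow> real) \<Rightarrow> nat \<Rightarrow> 'a \<Rightarrow> real mat" where
  "sym_matrix X n \<omega> = mat n n (\<lambda>(r, c).
     let i = int r + 1; j = int c + 1 in if j \<le> i then X i j \<omega> else X j i \<omega>)"

definition normalized_matrix :: "(int \<Rightarrow> int \<Rightarrow> 'a \<Rightarrow> real) \<Rightarrow> nat \<Rightarrow> 'a \<Rightarrow> real mat" where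
  "normalized_matrix X n \<omega> = (1 / sqrt (real n)) \<cdot>\<^sub>m sym_matrix X n \<omega>"

(* For a symmetric real matrix all roots of the characteristic polynomial are real, so
   proots (char_poly A) is the multiset of all n eigenvalues, counted with multiplicity. *)
definition spectral_cdf :: "real mat \<Rightarrow> real \<Rightarrow> real" where
  "spectral_cdf A t =
     real (size {# l \<in># proots (char_poly A). l \<le> t #}) / real (dim_row A)"

definition levy_dist :: "(real \<Rightarrow> real) \<Rightarrow> (real \<Rightarrow> real) \<Rightarrow> real" where
  "levy_dist F G =
     Inf {\<epsilon>. \<epsilon> > 0 \<and> (\<forall>x. F (x - \<epsilon>) - \<epsilon> \<le> G x \<and> G x \<le> F (x + \<epsilon>) + \<epsilon>)}"

definition lex_le :: "int \<times> int \<Rightarrow> int \<times> int \<Rightarrow> bool" where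
  "lex_le p q \<longleftrightarrow> fst p < fst q \<or> (fst p = fst q \<and> snd p \<le> snd q)"

definition past_indices :: "nat \<Rightarrow> int \<Rightarrow> int \<Rightarrow> (int \<times> int) set" where
  "past_indices a i j =
     {(u, v). max \<bar>u - i\<bar> \<bar>v - j\<bar> \<ge> int a \<and> lex_le (u, v) (i, j)}"

definition past_algebra ::
  "'a measure \<Rightarrow> (int \<Rightarrow> int \<Rightarrow> 'a \<Rightarrow> real) \<Rightarrow> nat \<Rightarrow> int \<Rightarrow> int \<Rightarrow> 'a measure" where
  "past_algebra M X a i j = sigma (space M)
     {X u v -` S \<inter> space M | u v S.
        (u, v) \<in> past_indices a i j \<and> v \<le> u \<and> S \<in> sets borel}"

definition semicircle_density :: "real \<Rightarrow> real" where
  "semicircle_density x = 1 / (2 * pi) * sqrt (4 - x\<^sup>2) * indicator {x. \<bar>x\<bar> \<le> 2} x"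

definition semicircle_cdf :: "real \<Rightarrow> real" where
  "semicircle_cdf x = (LINT u:{..x}|lborel. semicircle_density u)"

end

theory Submission
  imports Defs
begin

text \<open>
  Let g_n(z) be the mean of 1 / (\<lambda> - z) over the eigenvalues \<lambda> of the normalised matrix, that is,
  the normalised trace of its resolvent. The theorem reduces to the almost sure convergence of
  g_n(z) to s(z) = -1/w, where z = w + 1/w and |w| > 1, for each z in the upper half plane
  (levy_convergence). Indeed the imaginary part of g_n on the line Im z = \<eta> is the density of the
  empirical law smoothed by a Cauchy kernel of width \<eta>, and Im s / \<pi> tends to the semicircle
  density at the real axis.
  
  The trace is computed by adding the rows of the lower triangle one after the other, an operation
  that respects the filtration. Let R be the resolvent of the minor formed by the first i rows and
  b the next row, scaled by n^(-1/2). By the Schur complement the trace changes by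
  -(1 + b^T R^2 b) / (z + b^T R b). If the two quadratic forms are replaced by the normalised traces
  of R^2 and R, this is an Euler step of size 1/n for the equation
  dg/dt = -(1 + dg/dz) / (z + g) with g = 0 at t = 0. Its characteristics are z(t) = w + t/w, and
  z + g is constant along them, so g = -1/w at time 1. The error along a characteristic satisfies a
  discrete Gronwall inequality (resolvent_dynamics). Hence only the mean over the rows of the
  absolute difference between quadratic forms and traces matters.
  
  That difference is small for the following reasons. After truncation at a level \<tau> that is a tiny
  power of n, and after recentring given the past, the off-diagonal part of b^T R b is a martingale
  transform in the column index (off_diagonal_fluctuation). The diagonal part compares X_ij^2 with 1.
  The hypothesis speaks of conditioning on the lagged past of (i,j), and these algebras are not
  nested. Conditioning on the rows up to i - a together with row i up to column j - a is
  nested in j; replacing R by the minor that is a rows older costs O(a), since a row changes the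
  diagonal of R by O(1) in the l^1 norm (diagonal_fluctuation). The conditional variances for the two
  kinds of conditioning differ by row sums that are orthogonal beyond lag a
  (conditional_variance_fluctuation).
  
  All error terms have expectation at most a constant times \<tau>^2 / sqrt n + 1 / h(\<tau>). Along a
  geometric sequence of sizes n these bounds are summable; for 1 / h(\<tau>) this is Cauchy condensation
  applied to the series of 1 / (n h(n)). So the convergence is almost sure along geometric sequences
  (subsequence_convergence). Between two consecutive members the trace moves little, because one row
  changes it by at most 1 / Im z (trace_X_interpolation), and the ratio of the sequence can be taken
  arbitrarily close to 1.
\<close>

section \<open>Resolvents of principal minors\<close>

text \<open>
  The recursion adds one row and column and updates the inverse of A - z by the Schur complement
  formula, a rank one correction v v^T / S with v = (R b, -1). Entries outside the minor are 0.
  Compared with an inverse defined as such, the recursion makes the measurability of the entries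
  with respect to the rows used so far evident, and it is the very step that the proof analyses.
\<close>

primrec resolvent :: "(nat \<Rightarrow> nat \<Rightarrow> real) \<Rightarrow> complex \<Rightarrow> nat \<Rightarrow> nat \<Rightarrow> nat \<Rightarrow> complex" where
  "resolvent A z 0 = (\<lambda>j k. 0)"
| "resolvent A z (Suc m) =
    (let R = resolvent A z m;
         u = (\<lambda>j. \<Sum>k<m. R j k * of_real (A k m));
         v = (\<lambda>j. u j - (if j = m then 1 else 0));
         S = of_real (A m m) - z - (\<Sum>j<m. of_real (A j m) * u j)
     in (\<lambda>j k. R j k + v j * v k / S))"

definition col_image :: "(nat \<Rightarrow> nat \<Rightarrow> real) \<Rightarrow> complex \<Rightarrow> nat \<Rightarrow> nat \<Rightarrow> complex" where
  "col_image A z m j = (\<Sum>k<m. resolvent A z m j k * of_real (A k m))"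

definition step_vec :: "(nat \<Rightarrow> nat \<Rightarrow> real) \<Rightarrow> complex \<Rightarrow> nat \<Rightarrow> nat \<Rightarrow> complex" where
  "step_vec A z m j = col_image A z m j - (if j = m then 1 else 0)"

definition schur_compl :: "(nat \<Rightarrow> nat \<Rightarrow> real) \<Rightarrow> complex \<Rightarrow> nat \<Rightarrow> complex" where
  "schur_compl A z m = of_real (A m m) - z - (\<Sum>j<m. of_real (A j m) * col_image A z m j)"

lemma resolvent_Suc:
  "resolvent A z (Suc m) j k =
     resolvent A z m j k + step_vec A z m j * step_vec A z m k / schur_compl A z m"
  by (simp add: Let_def step_vec_def col_image_def schur_compl_def)

declare resolvent.simps(2) [simp del]

lemma resolvent_sym: "resolvent A z m j k = resolvent A z m k j"
  by (induction m) (simp_all add: resolvent_Suc mult.commute)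

lemma resolvent_outside: "m \<le> j \<or> m \<le> k \<Longrightarrow> resolvent A z m j k = 0"
proof (induction m arbitrary: j k)
  case (Suc m)
  have "col_image A z m l = 0" if "m \<le> l" for l
    using Suc.IH that by (simp add: col_image_def)
  then show ?case using Suc by (auto simp: resolvent_Suc step_vec_def)
qed simp

lemma col_image_outside: "m \<le> j \<Longrightarrow> col_image A z m j = 0"
  by (simp add: col_image_def resolvent_outside)

lemma step_vec_simps:
  "j < m \<Longrightarrow> step_vec A z m j = col_image A z m j"
  "step_vec A z m m = -1"
  "m < j \<Longrightarrow> step_vec A z m j = 0"
  by (auto simp: step_vec_def col_image_outside)

definition symmetric_entries :: "(nat \<Rightarrow> nat \<Rightarrow> real) \<Rightarrow> bool" where
  "symmetric_entries A \<longleftrightarrow> (\<forall>j k. A j k = A k j)"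

lemma symmetric_entriesD: "symmetric_entries A \<Longrightarrow> A j k = A k j"
  by (simp add: symmetric_entries_def)

text \<open>
  Since A is real and symmetric, the form of A at y is real, so only the term with z has an imaginary
  part. This identity is the source of all bounds below: it replaces the spectral theorem.
\<close>

lemma Im_quadratic_form:
  assumes "symmetric_entries A"
    and eq: "\<And>j. j < m \<Longrightarrow> (\<Sum>l<m. of_real (A j l) * y l) - z * y j = x j"
  shows "Im (\<Sum>j<m. cnj (x j) * y j) = Im z * (\<Sum>j<m. (cmod (y j))\<^sup>2)"
proof -
  define Q where "Q = (\<Sum>j<m. \<Sum>l<m. of_real (A j l) * cnj (y l) * y j)"
  have "cnj Q = (\<Sum>j<m. \<Sum>l<m. of_real (A j l) * y l * cnj (y j))"
    by (simp add: Q_def)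
  also have "\<dots> = (\<Sum>l<m. \<Sum>j<m. of_real (A j l) * y l * cnj (y j))"
    by (rule sum.swap)
  also have "\<dots> = Q"
    unfolding Q_def by (intro sum.cong refl) (simp add: symmetric_entriesD[OF assms(1)] ac_simps)
  finally have Q0: "Im Q = 0"
    by (metis complex_cnj_cancel_iff complex_In_mult_cnj_zero Reals_cnj_iff complex_is_Real_iff)
  have "(\<Sum>j<m. cnj (x j) * y j) =
      (\<Sum>j<m. (\<Sum>l<m. of_real (A j l) * cnj (y l) * y j) - cnj z * (cnj (y j) * y j))"
  proof (intro sum.cong refl)
    fix j assume "j \<in> {..<m}"
    then have "x j = (\<Sum>l<m. of_real (A j l) * y l) - z * y j" using eq by simp
    then have "cnj (x j) = (\<Sum>l<m. of_real (A j l) * cnj (y l)) - cnj z * cnj (y j)" by simp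
    then show "cnj (x j) * y j =
        (\<Sum>l<m. of_real (A j l) * cnj (y l) * y j) - cnj z * (cnj (y j) * y j)"
      by (simp add: left_diff_distrib sum_distrib_right mult.assoc)
  qed
  also have "\<dots> = Q - cnj z * of_real (\<Sum>j<m. (cmod (y j))\<^sup>2)"
    by (simp add: Q_def sum_subtractf sum_distrib_left complex_norm_square mult.commute
        del: of_real_power)
  finally show ?thesis using Q0 by simp
qed

text \<open>
  This and the next lemma take the defining equation of the inverse at size m as a hypothesis, because
  they are used inside the induction that proves it: the step needs the Schur complement to be nonzero.
\<close>

lemma resolvent_equation_if_prev:
  assumes "symmetric_entries A"
    and IH: "\<And>j k. j < m \<Longrightarrow> k < m \<Longrightarrow>
      (\<Sum>l<m. of_real (A j l) * resolvent A z m l k) - z * resolvent A z m j k = (if j = k then 1 else 0)"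
    and "j < m"
  shows "(\<Sum>l<m. of_real (A j l) * (\<Sum>k<m. resolvent A z m l k * x k)) - z * (\<Sum>k<m. resolvent A z m j k * x k)
    = x j"
proof -
  have "(\<Sum>l<m. of_real (A j l) * (\<Sum>k<m. resolvent A z m l k * x k)) - z * (\<Sum>k<m. resolvent A z m j k * x k)
    = (\<Sum>l<m. \<Sum>k<m. of_real (A j l) * resolvent A z m l k * x k) - (\<Sum>k<m. z * resolvent A z m j k * x k)"
    by (simp add: sum_distrib_left mult.assoc)
  also have "(\<Sum>l<m. \<Sum>k<m. of_real (A j l) * resolvent A z m l k * x k)
     = (\<Sum>k<m. (\<Sum>l<m. of_real (A j l) * resolvent A z m l k) * x k)"
    by (subst sum.swap) (simp add: sum_distrib_right)
  also have "\<dots> - (\<Sum>k<m. z * resolvent A z m j k * x k)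
     = (\<Sum>k<m. ((\<Sum>l<m. of_real (A j l) * resolvent A z m l k) - z * resolvent A z m j k) * x k)"
    by (simp add: sum_subtractf left_diff_distrib)
  also have "\<dots> = (\<Sum>k<m. if k = j then x j else 0)"
    using assms by (intro sum.cong) auto
  finally show ?thesis using assms(3) by simp
qed

lemma schur_Im_if_prev:
  assumes "symmetric_entries A"
    and IH: "\<And>j k. j < m \<Longrightarrow> k < m \<Longrightarrow>
      (\<Sum>l<m. of_real (A j l) * resolvent A z m l k) - z * resolvent A z m j k = (if j = k then 1 else 0)"
  shows "Im (schur_compl A z m) = - Im z * (1 + (\<Sum>j<m. (cmod (col_image A z m j))\<^sup>2))"
proof -
  have "Im (\<Sum>j<m. cnj (of_real (A j m)) * col_image A z m j)
      = Im z * (\<Sum>j<m. (cmod (col_image A z m j))\<^sup>2)"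
    by (rule Im_quadratic_form[OF assms(1)])
       (unfold col_image_def, rule resolvent_equation_if_prev[OF assms])
  then show ?thesis by (simp add: schur_compl_def algebra_simps)
qed

text \<open>
  The correction vector v satisfies (A - z) v = -S e_m, which is what makes the rank one update correct.
\<close>

lemma resolvent_equation:
  assumes A: "symmetric_entries A" and z: "Im z > 0"
  shows "j < m \<Longrightarrow> k < m \<Longrightarrow>
    (\<Sum>l<m. of_real (A j l) * resolvent A z m l k) - z * resolvent A z m j k = (if j = k then 1 else 0)"
proof (induction m arbitrary: j k)
  case (Suc m)
  define S where "S = schur_compl A z m"
  define v where "v = step_vec A z m"
  have "Im S = - Im z * (1 + (\<Sum>j<m. (cmod (col_image A z m j))\<^sup>2))"
    unfolding S_def by (rule schur_Im_if_prev[OF A Suc.IH])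
  moreover have "(\<Sum>j<m. (cmod (col_image A z m j))\<^sup>2) \<ge> 0" by (simp add: sum_nonneg)
  ultimately have "Im S < 0" using z by (simp add: mult_pos_pos add_pos_nonneg)
  then have S0: "S \<noteq> 0" by auto
  have v_eq: "(\<Sum>l<Suc m. of_real (A j l) * v l) - z * v j = (if j = m then - S else 0)"
    if "j < Suc m" for j
  proof (cases "j = m")
    case True
    have "(\<Sum>l<m. of_real (A m l) * col_image A z m l) = (\<Sum>l<m. of_real (A l m) * col_image A z m l)"
      by (intro sum.cong refl) (metis symmetric_entriesD[OF A])
    then show ?thesis using True
      by (simp add: v_def S_def schur_compl_def step_vec_simps)
  next
    case False
    then have j: "j < m" using that by simp
    have "(\<Sum>l<m. of_real (A j l) * col_image A z m l) - z * col_image A z m j = of_real (A j m)"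
      unfolding col_image_def by (rule resolvent_equation_if_prev[OF A Suc.IH j])
    then show ?thesis using j False by (simp add: v_def step_vec_simps algebra_simps)
  qed
  have R_eq: "(\<Sum>l<Suc m. of_real (A j l) * resolvent A z m l k) - z * resolvent A z m j k
      = (if j = m then step_vec A z m k + (if k = m then 1 else 0) else if j = k then 1 else 0)"
    if "j < Suc m" "k < Suc m" for j k
  proof (cases "j = m")
    case True
    have "(\<Sum>l<m. of_real (A m l) * resolvent A z m l k) = col_image A z m k"
      unfolding col_image_def
      by (intro sum.cong refl) (metis symmetric_entriesD[OF A] resolvent_sym mult.commute)
    then show ?thesis using True by (simp add: resolvent_outside step_vec_def)
  next
    case False
    then show ?thesis using that Suc.IH[of j k]
      by (cases "k = m") (auto simp: resolvent_outside)
  qed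
  have "(\<Sum>l<Suc m. of_real (A j l) * resolvent A z (Suc m) l k) - z * resolvent A z (Suc m) j k
    = ((\<Sum>l<Suc m. of_real (A j l) * resolvent A z m l k) - z * resolvent A z m j k)
      + ((\<Sum>l<Suc m. of_real (A j l) * v l) - z * v j) * (v k / S)"
    by (simp add: resolvent_Suc v_def S_def algebra_simps sum.distrib sum_distrib_left del: sum.lessThan_Suc)
  also have "\<dots> = (if j = k then 1 else 0)"
    unfolding R_eq[OF Suc.prems] v_eq[OF Suc.prems(1)]
    using Suc.prems S0 by (auto simp: v_def step_vec_simps)
  finally show ?case .
qed simp

lemma resolvent_equation_vec:
  assumes "symmetric_entries A" "Im z > 0" "j < m"
  shows "(\<Sum>l<m. of_real (A j l) * (\<Sum>k<m. resolvent A z m l k * x k)) - z * (\<Sum>k<m. resolvent A z m j k * x k)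
    = x j"
  by (rule resolvent_equation_if_prev[OF assms(1) resolvent_equation[OF assms(1,2)] assms(3)])

lemma schur_Im:
  assumes "symmetric_entries A" "Im z > 0"
  shows "Im (schur_compl A z m) = - Im z * (1 + (\<Sum>j<m. (cmod (col_image A z m j))\<^sup>2))"
  by (rule schur_Im_if_prev[OF assms(1) resolvent_equation[OF assms]])

lemma step_vec_norm:
  "(\<Sum>j<Suc m. (cmod (step_vec A z m j))\<^sup>2) = 1 + (\<Sum>j<m. (cmod (col_image A z m j))\<^sup>2)"
  by (simp add: step_vec_simps)

text \<open>
  The imaginary part of the Schur complement is -Im z |v|^2. Therefore the correction v v^T / S has
  norm at most 1 / Im z however large the new row is.
\<close>

lemma schur_norm_ge:
  assumes "symmetric_entries A" "Im z > 0"
  shows "cmod (schur_compl A z m) \<ge> Im z * (\<Sum>j<Suc m. (cmod (step_vec A z m j))\<^sup>2)"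
  using abs_Im_le_cmod[of "schur_compl A z m"] assms(2)
  unfolding schur_Im[OF assms] step_vec_norm
  by (simp add: abs_mult sum_nonneg)

lemma schur_norm_ge':
  assumes "symmetric_entries A" "Im z > 0"
  shows "cmod (schur_compl A z m) \<ge> Im z" 
proof -
  have "Im z * 1 \<le> Im z * (\<Sum>j<Suc m. (cmod (step_vec A z m j))\<^sup>2)"
    unfolding step_vec_norm using assms(2) by (intro mult_left_mono) (auto simp: sum_nonneg)
  then show ?thesis using schur_norm_ge[OF assms, of m] by simp
qed

section \<open>Norm bounds and perturbation of resolvents\<close>

lemma norm_sum_mult_le_L2:
  fixes f g :: "'i \<Rightarrow> complex"
  shows "cmod (\<Sum>i\<in>I. f i * g i) \<le> sqrt (\<Sum>i\<in>I. (cmod (f i))\<^sup>2) * sqrt (\<Sum>i\<in>I. (cmod (g i))\<^sup>2)"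
proof -
  have "cmod (\<Sum>i\<in>I. f i * g i) \<le> (\<Sum>i\<in>I. \<bar>cmod (f i)\<bar> * \<bar>cmod (g i)\<bar>)"
    by (rule order_trans[OF norm_sum]) (simp add: norm_mult)
  also have "\<dots> \<le> L2_set (\<lambda>i. cmod (f i)) I * L2_set (\<lambda>i. cmod (g i)) I"
    by (rule L2_set_mult_ineq)
  finally show ?thesis by (simp add: L2_set_def)
qed

text \<open>
  With y = R x, the identity for the imaginary part gives Im z |y|^2 = Im <x, y>, at most |x| |y|.
\<close>

lemma resolvent_apply_norm:
  assumes "symmetric_entries A" "Im z > 0"
  shows "(\<Sum>j<m. (cmod (\<Sum>k<m. resolvent A z m j k * x k))\<^sup>2) \<le> (\<Sum>k<m. (cmod (x k))\<^sup>2) / (Im z)\<^sup>2"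
proof -
  define y where "y j = (\<Sum>k<m. resolvent A z m j k * x k)" for j
  define Y where "Y = (\<Sum>j<m. (cmod (y j))\<^sup>2)"
  define X where "X = (\<Sum>j<m. (cmod (x j))\<^sup>2)"
  have nn: "X \<ge> 0" "Y \<ge> 0" by (auto simp: X_def Y_def sum_nonneg)
  have "Im z * Y = Im (\<Sum>j<m. cnj (x j) * y j)"
    unfolding Y_def
    by (rule Im_quadratic_form[OF assms(1), symmetric])
      (unfold y_def, rule resolvent_equation_vec[OF assms])
  also have "\<dots> \<le> cmod (\<Sum>j<m. cnj (x j) * y j)" using abs_Im_le_cmod abs_le_D1 by blast
  also have "\<dots> \<le> sqrt X * sqrt Y"
    using norm_sum_mult_le_L2[of "\<lambda>j. cnj (x j)" y "{..<m}"] by (simp add: X_def Y_def)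
  finally have *: "Im z * Y \<le> sqrt X * sqrt Y" .
  have "Im z * sqrt Y \<le> sqrt X"
  proof (cases "Y = 0")
    case False
    then have "sqrt Y > 0" using nn by simp
    moreover have "Im z * sqrt Y * sqrt Y \<le> sqrt X * sqrt Y" using * nn by (simp add: mult.assoc)
    ultimately show ?thesis by (rule mult_right_le_imp_le[rotated])
  qed (use nn in simp)
  then have "(Im z * sqrt Y)\<^sup>2 \<le> (sqrt X)\<^sup>2"
    using assms(2) nn by (intro power_mono) auto
  then have "(Im z)\<^sup>2 * Y \<le> X" using nn by (simp add: power_mult_distrib)
  then have "Y \<le> X / (Im z)\<^sup>2" using assms(2) by (simp add: field_simps)
  then show ?thesis by (simp only: y_def X_def Y_def)
qed

lemma sum_mult_delta:
  fixes f :: "nat \<Rightarrow> complex"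
  assumes "k < m"
  shows "(\<Sum>l<m. f l * (if l = k then 1 else 0)) = f k"
proof -
  have "(\<Sum>l<m. f l * (if l = k then 1 else 0)) = (\<Sum>l<m. if l = k then f l else 0)"
    by (intro sum.cong) auto
  then show ?thesis using assms by simp
qed

lemma resolvent_col_norm:
  assumes "symmetric_entries A" "Im z > 0"
  shows "(\<Sum>j<m. (cmod (resolvent A z m j k))\<^sup>2) \<le> 1 / (Im z)\<^sup>2"
proof (cases "k < m")
  case True
  have *: "(\<Sum>l<m. resolvent A z m j l * (if l = k then 1 else 0)) = resolvent A z m j k" for j
    using True by (rule sum_mult_delta)
  have **: "(\<Sum>l<m. (cmod (if l = k then 1 else 0))\<^sup>2) = 1"
  proof -
    have "(\<Sum>l<m. (cmod (if l = k then 1 else 0))\<^sup>2) = (\<Sum>l<m. if l = k then 1 else 0)"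
      by (intro sum.cong) auto
    then show ?thesis using True by simp
  qed
  show ?thesis using resolvent_apply_norm[OF assms, of m "\<lambda>l. if l = k then 1 else 0"]
    unfolding * ** .
qed (simp add: resolvent_outside)

lemma resolvent_entry_norm:
  assumes "symmetric_entries A" "Im z > 0"
  shows "cmod (resolvent A z m j k) \<le> 1 / Im z"
proof (cases "j < m")
  case True
  have "(cmod (resolvent A z m j k))\<^sup>2 \<le> (\<Sum>j<m. (cmod (resolvent A z m j k))\<^sup>2)"
    using True by (intro member_le_sum) auto
  also have "\<dots> \<le> (1 / Im z)\<^sup>2" using resolvent_col_norm[OF assms] by (simp add: power_divide)
  finally show ?thesis by (rule power2_le_imp_le) (use assms(2) in simp)
qed (use assms in \<open>simp add: resolvent_outside\<close>)

definition prod_upto :: "nat \<Rightarrow> (nat \<Rightarrow> nat \<Rightarrow> complex) \<Rightarrow> (nat \<Rightarrow> nat \<Rightarrow> complex) \<Rightarrow> nat \<Rightarrow> nat \<Rightarrow> complex" where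
  "prod_upto m P Q j k = (\<Sum>l<m. P j l * Q l k)"

definition trace_upto :: "nat \<Rightarrow> (nat \<Rightarrow> nat \<Rightarrow> complex) \<Rightarrow> complex" where
  "trace_upto m P = (\<Sum>j<m. P j j)"

lemma resolvent_prod_col_norm:
  assumes "symmetric_entries A" "Im z > 0" "symmetric_entries B" "Im z' > 0"
  shows "(\<Sum>j<m. (cmod (prod_upto m (resolvent A z m) (resolvent B z' m) j k))\<^sup>2) \<le> 1 / (Im z * Im z')\<^sup>2"
proof -
  have "(\<Sum>j<m. (cmod (prod_upto m (resolvent A z m) (resolvent B z' m) j k))\<^sup>2)
      \<le> (\<Sum>j<m. (cmod (resolvent B z' m j k))\<^sup>2) / (Im z)\<^sup>2"
    unfolding prod_upto_def by (rule resolvent_apply_norm[OF assms(1,2)])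
  also have "\<dots> \<le> (1 / (Im z')\<^sup>2) / (Im z)\<^sup>2"
    using resolvent_col_norm[OF assms(3,4)] by (intro divide_right_mono) auto
  finally show ?thesis by (simp add: power_mult_distrib mult.commute)
qed

lemma resolvent_prod_frobenius:
  assumes "symmetric_entries A" "Im z > 0" "symmetric_entries B" "Im z' > 0"
  shows "(\<Sum>j<m. \<Sum>k<m. (cmod (prod_upto m (resolvent A z m) (resolvent B z' m) j k))\<^sup>2) \<le> real m / (Im z * Im z')\<^sup>2"
proof -
  have "(\<Sum>j<m. \<Sum>k<m. (cmod (prod_upto m (resolvent A z m) (resolvent B z' m) j k))\<^sup>2)
      = (\<Sum>k<m. \<Sum>j<m. (cmod (prod_upto m (resolvent A z m) (resolvent B z' m) j k))\<^sup>2)" by (rule sum.swap)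
  also have "\<dots> \<le> (\<Sum>k<m. 1 / (Im z * Im z')\<^sup>2)"
    by (intro sum_mono resolvent_prod_col_norm assms)
  finally show ?thesis by simp
qed

lemma resolvent_frobenius:
  assumes "symmetric_entries A" "Im z > 0"
  shows "(\<Sum>j<m. \<Sum>k<m. (cmod (resolvent A z m j k))\<^sup>2) \<le> real m / (Im z)\<^sup>2"
proof -
  have "(\<Sum>j<m. \<Sum>k<m. (cmod (resolvent A z m j k))\<^sup>2)
      = (\<Sum>k<m. \<Sum>j<m. (cmod (resolvent A z m j k))\<^sup>2)" by (rule sum.swap)
  also have "\<dots> \<le> (\<Sum>k<m. 1 / (Im z)\<^sup>2)"
    by (intro sum_mono resolvent_col_norm assms)
  finally show ?thesis by simp
qed

lemma trace_upto_prod_upto_le: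
  "cmod (trace_upto m (prod_upto m P Q)) \<le>
    sqrt (\<Sum>j<m. \<Sum>k<m. (cmod (P j k))\<^sup>2) * sqrt (\<Sum>j<m. \<Sum>k<m. (cmod (Q j k))\<^sup>2)"
proof -
  have "trace_upto m (prod_upto m P Q) = (\<Sum>(j,l)\<in>{..<m}\<times>{..<m}. P j l * Q l j)"
    by (simp add: trace_upto_def prod_upto_def sum.cartesian_product)
  also have "cmod \<dots> \<le> sqrt (\<Sum>(j,l)\<in>{..<m}\<times>{..<m}. (cmod (P j l))\<^sup>2)
      * sqrt (\<Sum>(j,l)\<in>{..<m}\<times>{..<m}. (cmod (Q l j))\<^sup>2)"
    using norm_sum_mult_le_L2[of "\<lambda>(j,l). P j l" "\<lambda>(j,l). Q l j" "{..<m}\<times>{..<m}"]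
    by (simp add: case_prod_unfold)
  also have "(\<Sum>(j,l)\<in>{..<m}\<times>{..<m}. (cmod (Q l j))\<^sup>2) = (\<Sum>l<m. \<Sum>j<m. (cmod (Q l j))\<^sup>2)"
    by (subst sum.swap) (simp add: sum.cartesian_product)
  finally show ?thesis by (simp add: sum.cartesian_product)
qed

lemma prod_upto_assoc: "prod_upto m (prod_upto m P Q) T j k = prod_upto m P (prod_upto m Q T) j k"
  unfolding prod_upto_def sum_distrib_left sum_distrib_right
  by (subst sum.swap) (simp add: mult.assoc)

lemma trace_upto_prod_upto_commute: "trace_upto m (prod_upto m P Q) = trace_upto m (prod_upto m Q P)"
  unfolding trace_upto_def prod_upto_def by (subst sum.swap) (simp add: mult.commute)

lemma trace_upto_cong: "(\<And>j. j < m \<Longrightarrow> P j j = Q j j) \<Longrightarrow> trace_upto m P = trace_upto m Q"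
  by (simp add: trace_upto_def)

lemma resolvent_diff:
  assumes A: "symmetric_entries A" "Im z > 0" and B: "symmetric_entries B" "Im z' > 0" and "j < m" "k < m"
  defines "D \<equiv> \<lambda>l p. of_real (B l p - A l p) + (if l = p then z - z' else 0)"
  shows "resolvent A z m j k - resolvent B z' m j k =
    prod_upto m (resolvent A z m) (prod_upto m D (resolvent B z' m)) j k"
proof -
  let ?R = "resolvent A z m" and ?T = "resolvent B z' m"
  have D: "prod_upto m D ?T l k = ((\<Sum>p<m. of_real (B l p) * ?T p k) - z' * ?T l k)
      - ((\<Sum>p<m. of_real (A l p) * ?T p k) - z * ?T l k)" if "l < m" for l
  proof -
    have "prod_upto m D ?T l k = (\<Sum>p<m. of_real (B l p) * ?T p k - of_real (A l p) * ?T p k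
        + (if p = l then (z - z') * ?T l k else 0))"
      unfolding prod_upto_def D_def by (intro sum.cong refl) (auto simp: algebra_simps)
    also have "\<dots> = (\<Sum>p<m. of_real (B l p) * ?T p k) - (\<Sum>p<m. of_real (A l p) * ?T p k)
        + (z - z') * ?T l k" using that by (simp add: sum.distrib sum_subtractf)
    finally show ?thesis by (simp add: algebra_simps)
  qed
  have "prod_upto m ?R (prod_upto m D ?T) j k =
      (\<Sum>l<m. ?R j l * (if l = k then 1 else 0))
      - (\<Sum>l<m. ?R j l * ((\<Sum>p<m. of_real (A l p) * ?T p k) - z * ?T l k))"
    using assms(6) unfolding prod_upto_def[of m ?R "prod_upto m D ?T"]
    by (simp add: D resolvent_equation[OF B] right_diff_distrib sum_subtractf del: sum.delta)
  also have "(\<Sum>l<m. ?R j l * (if l = k then 1 else 0)) = ?R j k"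
    using assms(6) by (rule sum_mult_delta)
  also have "(\<Sum>l<m. ?R j l * ((\<Sum>p<m. of_real (A l p) * ?T p k) - z * ?T l k))
     = (\<Sum>l<m. \<Sum>p<m. ?R j l * of_real (A l p) * ?T p k) - (\<Sum>l<m. z * ?R j l * ?T l k)"
    by (simp add: right_diff_distrib sum_subtractf sum_distrib_left ac_simps)
  also have "(\<Sum>l<m. \<Sum>p<m. ?R j l * of_real (A l p) * ?T p k)
     = (\<Sum>p<m. \<Sum>l<m. ?R j l * of_real (A l p) * ?T p k)" by (rule sum.swap)
  also have "\<dots> = (\<Sum>p<m. (\<Sum>l<m. of_real (A p l) * ?R l j) * ?T p k)"
    unfolding sum_distrib_right
    by (intro sum.cong refl) (metis symmetric_entriesD[OF A(1)] resolvent_sym mult.commute)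
  also have "\<dots> - (\<Sum>l<m. z * ?R j l * ?T l k)
     = (\<Sum>p<m. ((\<Sum>l<m. of_real (A p l) * ?R l j) - z * ?R p j) * ?T p k)"
    by (simp add: left_diff_distrib sum_subtractf resolvent_sym[of A z m j])
  also have "\<dots> = (\<Sum>p<m. ?T p k * (if p = j then 1 else 0))"
    using assms(5) by (intro sum.cong refl) (simp add: resolvent_equation[OF A])
  also have "\<dots> = ?T j k"
    using assms(5) by (rule sum_mult_delta)
  finally show ?thesis by simp
qed

lemma trace_upto_diff: "trace_upto m P - trace_upto m Q = trace_upto m (\<lambda>j k. P j k - Q j k)"
  by (simp add: trace_upto_def sum_subtractf)

text \<open>
  The trace of R_A (B - A) R_B is a Frobenius product of B - A with R_B R_A, and the latter has columns
  of norm at most 1 / (Im z)^2. This serves instead of the Hoffman-Wielandt inequality.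
\<close>

lemma trace_resolvent_perturb:
  assumes A: "symmetric_entries A" and B: "symmetric_entries B" and z: "Im z > 0"
  shows "cmod (trace_upto m (resolvent A z m) - trace_upto m (resolvent B z m)) \<le>
    sqrt (\<Sum>j<m. \<Sum>k<m. (A j k - B j k)\<^sup>2) * sqrt (real m) / (Im z)\<^sup>2"
proof -
  let ?R = "resolvent A z m" and ?T = "resolvent B z m"
  define D where "D = (\<lambda>l p. complex_of_real (B l p - A l p))"
  have "trace_upto m ?R - trace_upto m ?T = trace_upto m (prod_upto m ?R (prod_upto m D ?T))"
  proof -
    have D: "(\<lambda>l p. complex_of_real (B l p - A l p) + (if l = p then z - z else 0)) = D"
      by (intro ext) (simp add: D_def)
    show ?thesis
      unfolding trace_upto_diff using resolvent_diff[OF A z B z, unfolded D] by (intro trace_upto_cong)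
  qed
  also have "\<dots> = trace_upto m (prod_upto m (prod_upto m D ?T) ?R)" by (rule trace_upto_prod_upto_commute)
  also have "\<dots> = trace_upto m (prod_upto m D (prod_upto m ?T ?R))" by (intro trace_upto_cong prod_upto_assoc)
  finally have eq: "trace_upto m ?R - trace_upto m ?T = trace_upto m (prod_upto m D (prod_upto m ?T ?R))" .
  have "cmod (trace_upto m ?R - trace_upto m ?T) \<le> sqrt (\<Sum>j<m. \<Sum>k<m. (cmod (D j k))\<^sup>2) *
      sqrt (\<Sum>j<m. \<Sum>k<m. (cmod (prod_upto m ?T ?R j k))\<^sup>2)"
    unfolding eq by (rule trace_upto_prod_upto_le)
  also have "\<dots> \<le> sqrt (\<Sum>j<m. \<Sum>k<m. (cmod (D j k))\<^sup>2) * sqrt (real m / (Im z * Im z)\<^sup>2)"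
    by (rule mult_left_mono[OF real_sqrt_le_mono[OF resolvent_prod_frobenius[OF B z A z]]])
      (simp add: sum_nonneg)
  also have "sqrt (real m / (Im z * Im z)\<^sup>2) = sqrt (real m) / (Im z)\<^sup>2"
    using z by (simp add: real_sqrt_divide power2_eq_square)
  also have "(\<Sum>j<m. \<Sum>k<m. (cmod (D j k))\<^sup>2) = (\<Sum>j<m. \<Sum>k<m. (A j k - B j k)\<^sup>2)"
    by (simp add: D_def power2_commute del: of_real_diff)
  finally show ?thesis by simp
qed

lemma resolvent_diff_z:
  assumes A: "symmetric_entries A" "Im z > 0" "Im z' > 0" and "j < m" "k < m"
  shows "resolvent A z m j k - resolvent A z' m j k = (z - z') * prod_upto m (resolvent A z m) (resolvent A z' m) j k"
proof -
  have *: "prod_upto m (\<lambda>l p. complex_of_real (A l p - A l p) + (if l = p then z - z' else 0)) (resolvent A z' m) l k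
      = (z - z') * resolvent A z' m l k" if "l < m" for l
  proof -
    have "prod_upto m (\<lambda>l p. complex_of_real (A l p - A l p) + (if l = p then z - z' else 0)) (resolvent A z' m) l k
       = (\<Sum>p<m. if p = l then (z - z') * resolvent A z' m l k else 0)"
      unfolding prod_upto_def by (intro sum.cong) auto
    then show ?thesis using that by simp
  qed
  have "resolvent A z m j k - resolvent A z' m j k = (\<Sum>l<m. resolvent A z m j l * ((z - z') * resolvent A z' m l k))"
    unfolding resolvent_diff[OF A(1,2) A(1,3) assms(4,5)] unfolding prod_upto_def[of m "resolvent A z m"]
    by (intro sum.cong refl arg_cong2[where f = "(*)"] *) simp
  then show ?thesis by (simp add: prod_upto_def sum_distrib_left ac_simps)
qed

lemma trace_resolvent_lipschitz_z:
  assumes A: "symmetric_entries A" "Im z > 0" "Im z' > 0"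
  shows "cmod (trace_upto m (resolvent A z m) - trace_upto m (resolvent A z' m)) \<le> cmod (z - z') * real m / (Im z * Im z')"
proof -
  have "trace_upto m (resolvent A z m) - trace_upto m (resolvent A z' m) = (z - z') * trace_upto m (prod_upto m (resolvent A z m) (resolvent A z' m))"
    by (simp add: trace_upto_def resolvent_diff_z[OF A] sum_distrib_left flip: sum_subtractf)
  moreover have "cmod (trace_upto m (prod_upto m (resolvent A z m) (resolvent A z' m))) \<le> sqrt (real m / (Im z)\<^sup>2) * sqrt (real m / (Im z')\<^sup>2)"
    by (rule order_trans[OF trace_upto_prod_upto_le])
      (rule mult_mono[OF real_sqrt_le_mono[OF resolvent_frobenius[OF A(1,2)]]
        real_sqrt_le_mono[OF resolvent_frobenius[OF A(1,3)]]], simp_all add: sum_nonneg)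
  moreover have "sqrt (real m / (Im z)\<^sup>2) * sqrt (real m / (Im z')\<^sup>2) = real m / (Im z * Im z')"
    using A by (simp add: real_sqrt_divide)
  ultimately show ?thesis by (simp add: norm_mult mult_left_mono flip: times_divide_eq_right)
qed

text \<open>
  The derivative of the trace in z is the trace of R^2; the second order term is bounded uniformly so
  that n steps of length 1/n contribute O(1/n) in total.
\<close>

lemma trace_resolvent_taylor_z:
  assumes A: "symmetric_entries A" "Im z \<ge> \<eta>" "Im z' \<ge> \<eta>" "\<eta> > 0"
  shows "cmod (trace_upto m (resolvent A z m) - trace_upto m (resolvent A z' m) - (z - z') * trace_upto m (prod_upto m (resolvent A z m) (resolvent A z m)))
    \<le> (cmod (z - z'))\<^sup>2 * real m / \<eta>^3"
proof -
  let ?R = "resolvent A z m" and ?T = "resolvent A z' m"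
  have z: "Im z > 0" "Im z' > 0" using A by auto
  have d: "prod_upto m ?R ?T j k = prod_upto m ?R ?R j k - (z - z') * prod_upto m ?R (prod_upto m ?R ?T) j k" if "k < m" for j k
  proof -
    have "prod_upto m ?R ?R j k - prod_upto m ?R ?T j k = (\<Sum>l<m. ?R j l * (?R l k - ?T l k))"
      by (simp add: prod_upto_def right_diff_distrib sum_subtractf)
    also have "\<dots> = (\<Sum>l<m. ?R j l * ((z - z') * prod_upto m ?R ?T l k))"
      using that by (intro sum.cong refl) (simp add: resolvent_diff_z[OF A(1) z])
    finally show ?thesis by (simp add: prod_upto_def[of m ?R "prod_upto m ?R ?T"] sum_distrib_left algebra_simps)
  qed
  have eq: "trace_upto m ?R - trace_upto m ?T = (z - z') * trace_upto m (prod_upto m ?R ?T)"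
    by (simp add: trace_upto_def resolvent_diff_z[OF A(1) z] sum_distrib_left flip: sum_subtractf)
  have eq2: "trace_upto m (prod_upto m ?R ?T) = trace_upto m (prod_upto m ?R ?R) - (z - z') * trace_upto m (prod_upto m ?R (prod_upto m ?R ?T))"
    by (simp add: trace_upto_def d sum_subtractf sum_distrib_left)
  have "trace_upto m ?R - trace_upto m ?T - (z - z') * trace_upto m (prod_upto m ?R ?R)
     = - ((z - z')\<^sup>2 * trace_upto m (prod_upto m ?R (prod_upto m ?R ?T)))"
    unfolding eq eq2 by (simp add: algebra_simps power2_eq_square)
  then have eq3: "cmod (trace_upto m ?R - trace_upto m ?T - (z - z') * trace_upto m (prod_upto m ?R ?R))
     = (cmod (z - z'))\<^sup>2 * cmod (trace_upto m (prod_upto m ?R (prod_upto m ?R ?T)))"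
    by (simp add: norm_mult norm_power)
  have "cmod (trace_upto m (prod_upto m ?R (prod_upto m ?R ?T)))
      \<le> sqrt (real m / (Im z)\<^sup>2) * sqrt (real m / (Im z * Im z')\<^sup>2)"
    by (rule order_trans[OF trace_upto_prod_upto_le])
      (rule mult_mono[OF real_sqrt_le_mono[OF resolvent_frobenius[OF A(1) z(1)]]
        real_sqrt_le_mono[OF resolvent_prod_frobenius[OF A(1) z(1) A(1) z(2)]]], simp_all add: sum_nonneg)
  also have "\<dots> = real m / (Im z * Im z * Im z')"
    using z by (simp add: real_sqrt_divide)
  also have "\<dots> \<le> real m / \<eta>^3"
  proof (rule divide_left_mono)
    show "\<eta>^3 \<le> Im z * Im z * Im z'"
      unfolding power3_eq_cube using A by (intro mult_mono) auto
  qed (use A z in auto)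
  finally show ?thesis unfolding eq3
    by (simp add: mult_left_mono flip: times_divide_eq_right)
qed

lemma resolvent_scale:
  assumes "c \<noteq> 0"
  shows "resolvent (\<lambda>j k. c * A j k) (of_real c * z) m j k = resolvent A z m j k / of_real c"
proof (induction m arbitrary: j k)
  case (Suc m)
  have u: "col_image (\<lambda>j k. c * A j k) (of_real c * z) m = col_image A z m"
    by (rule ext) (use assms in \<open>simp add: col_image_def Suc.IH\<close>)
  have "schur_compl (\<lambda>j k. c * A j k) (of_real c * z) m = of_real c * schur_compl A z m"
    by (simp add: schur_compl_def u right_diff_distrib sum_distrib_left mult.assoc)
  then show ?case
    by (simp only: resolvent_Suc Suc.IH step_vec_def u) (simp add: add_divide_distrib mult.commute)
qed simp

section \<open>The effect of one more row\<close>

lemma col_image_sq_sum: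
  "(\<Sum>j<m. col_image A z m j * col_image A z m j) =
    (\<Sum>j<m. \<Sum>k<m. of_real (A j m * A k m) * prod_upto m (resolvent A z m) (resolvent A z m) j k)"
proof -
  let ?R = "resolvent A z m"
  have "(\<Sum>j<m. col_image A z m j * col_image A z m j) =
    (\<Sum>j<m. \<Sum>k<m. \<Sum>l<m. ?R j k * of_real (A k m) * (?R j l * of_real (A l m)))"
    by (simp add: col_image_def sum_product)
  also have "\<dots> = (\<Sum>k<m. \<Sum>j<m. \<Sum>l<m. ?R j k * of_real (A k m) * (?R j l * of_real (A l m)))"
    by (rule sum.swap)
  also have "\<dots> = (\<Sum>k<m. \<Sum>l<m. \<Sum>j<m. ?R j k * of_real (A k m) * (?R j l * of_real (A l m)))"
    by (intro sum.cong refl sum.swap)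
  also have "\<dots> = (\<Sum>k<m. \<Sum>l<m. of_real (A k m * A l m) * prod_upto m ?R ?R k l)"
    unfolding prod_upto_def sum_distrib_left
    by (intro sum.cong refl) (simp add: resolvent_sym[of A z m _ k] mult_ac, metis resolvent_sym)
  finally show ?thesis .
qed

lemma step_vec_sq_sum:
  "(\<Sum>j<Suc m. step_vec A z m j * step_vec A z m j) =
    1 + (\<Sum>j<m. \<Sum>k<m. of_real (A j m * A k m) * prod_upto m (resolvent A z m) (resolvent A z m) j k)"
  by (simp add: step_vec_simps col_image_sq_sum)

lemma trace_upto_resolvent_Suc:
  "trace_upto (Suc m) (resolvent A z (Suc m)) = trace_upto m (resolvent A z m)
    + (\<Sum>j<Suc m. step_vec A z m j * step_vec A z m j) / schur_compl A z m"
proof -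
  have "trace_upto (Suc m) (resolvent A z (Suc m)) = (\<Sum>j<Suc m. resolvent A z m j j)
    + (\<Sum>j<Suc m. step_vec A z m j * step_vec A z m j / schur_compl A z m)"
    unfolding trace_upto_def resolvent_Suc by (rule sum.distrib)
  then show ?thesis by (simp only: trace_upto_def sum_divide_distrib) (simp add: resolvent_outside)
qed

text \<open>
  A new row changes the diagonal by O(1) in the l^1 norm. This is why a minor that is a rows older
  may stand in for the current one, at cost O(a) against a normalisation by n.
\<close>

lemma step_diag_le:
  assumes "symmetric_entries A" "Im z > 0"
  shows "(\<Sum>j<Suc m. cmod (resolvent A z (Suc m) j j - resolvent A z m j j)) \<le> 1 / Im z"
proof -
  let ?S = "schur_compl A z m" and ?V = "\<Sum>j<Suc m. (cmod (step_vec A z m j))\<^sup>2"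
  have S: "cmod ?S > 0" using schur_norm_ge'[OF assms, of m] assms by linarith
  have "(\<Sum>j<Suc m. cmod (resolvent A z (Suc m) j j - resolvent A z m j j)) = ?V / cmod ?S"
    by (simp only: resolvent_Suc add_diff_cancel_left' norm_divide norm_mult sum_divide_distrib power2_eq_square)
  also have "\<dots> \<le> 1 / Im z"
    using schur_norm_ge[OF assms, of m] S assms(2)
    by (simp only: divide_le_eq le_divide_eq) (simp add: field_simps)
  finally show ?thesis .
qed

lemma trace_upto_resolvent_step_le:
  assumes "symmetric_entries A" "Im z > 0"
  shows "cmod (trace_upto (Suc m) (resolvent A z (Suc m)) - trace_upto m (resolvent A z m)) \<le> 1 / Im z"
proof -
  have "trace_upto (Suc m) (resolvent A z (Suc m)) - trace_upto m (resolvent A z m)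
      = (\<Sum>j<Suc m. resolvent A z (Suc m) j j - resolvent A z m j j)"
    by (simp only: trace_upto_def sum_subtractf) (simp add: resolvent_outside)
  then show ?thesis using step_diag_le[OF assms, of m] norm_sum order_trans by metis
qed

lemma trace_upto_resolvent_steps_le:
  assumes "symmetric_entries A" "Im z > 0"
  shows "cmod (trace_upto (m + k) (resolvent A z (m + k)) - trace_upto m (resolvent A z m)) \<le> real k / Im z"
proof (induction k)
  case (Suc k)
  have "cmod (trace_upto (m + Suc k) (resolvent A z (m + Suc k)) - trace_upto m (resolvent A z m)) \<le>
    cmod (trace_upto (Suc (m + k)) (resolvent A z (Suc (m + k))) - trace_upto (m + k) (resolvent A z (m + k)))
    + cmod (trace_upto (m + k) (resolvent A z (m + k)) - trace_upto m (resolvent A z m))"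
    using norm_triangle_ineq[of "trace_upto (Suc (m + k)) (resolvent A z (Suc (m + k))) - trace_upto (m + k) (resolvent A z (m + k))"
      "trace_upto (m + k) (resolvent A z (m + k)) - trace_upto m (resolvent A z m)"] by simp
  also have "\<dots> \<le> 1 / Im z + real k / Im z"
    by (intro add_mono trace_upto_resolvent_step_le assms Suc)
  finally show ?case by (simp add: add_divide_distrib)
qed simp

lemma prod_upto_resolvent_extend: "m \<le> N \<Longrightarrow> prod_upto N (resolvent A z m) (resolvent A z m) j k = prod_upto m (resolvent A z m) (resolvent A z m) j k"
  unfolding prod_upto_def by (rule sum.mono_neutral_right) (auto simp: resolvent_outside)

definition resolvent_sq :: "(nat \<Rightarrow> nat \<Rightarrow> real) \<Rightarrow> complex \<Rightarrow> nat \<Rightarrow> nat \<Rightarrow> nat \<Rightarrow> complex" where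
  "resolvent_sq A z m = prod_upto m (resolvent A z m) (resolvent A z m)"

lemma resolvent_sq_outside: "m \<le> j \<or> m \<le> k \<Longrightarrow> resolvent_sq A z m j k = 0"
  by (auto simp: resolvent_sq_def prod_upto_def resolvent_outside)

lemma resolvent_sq_sym: "resolvent_sq A z m j k = resolvent_sq A z m k j"
  unfolding resolvent_sq_def prod_upto_def
  by (intro sum.cong refl) (metis mult.commute resolvent_sym)

text \<open>
  The analogue for R^2. With S the Schur complement, the correction is
  (R v v^T + v v^T R) / S + v v^T (v^T v) / S^2, and |S| is at least Im z |v|^2.
\<close>

lemma step_diag_sq_le:
  assumes "symmetric_entries A" "Im z > 0"
  shows "(\<Sum>j<Suc m. cmod (resolvent_sq A z (Suc m) j j - resolvent_sq A z m j j)) \<le> 3 / (Im z)\<^sup>2"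
proof -
  let ?S = "schur_compl A z m" and ?v = "step_vec A z m" and ?R = "resolvent A z m"
  let ?V = "\<Sum>j<Suc m. (cmod (?v j))\<^sup>2"
  let ?W = "\<lambda>j. \<Sum>l<m. ?R j l * ?v l"
  have S: "cmod ?S > 0" using schur_norm_ge'[OF assms, of m] assms by linarith
  have V: "?V \<ge> 0" by (simp add: sum_nonneg)
  have VS: "?V / cmod ?S \<le> 1 / Im z"
    using schur_norm_ge[OF assms, of m] S assms(2)
    by (simp only: divide_le_eq le_divide_eq) (simp add: field_simps)
  have vv: "cmod (\<Sum>l<Suc m. ?v l * ?v l) \<le> ?V"
    by (rule order_trans[OF norm_sum]) (simp add: norm_mult power2_eq_square)
  have Wm: "(\<Sum>l<Suc m. ?R j l * ?v l) = ?W j" for j by (simp add: resolvent_outside)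
  have diff: "resolvent_sq A z (Suc m) j j - resolvent_sq A z m j j =
     2 * (?v j * ?W j) / ?S + ?v j * ?v j * (\<Sum>l<Suc m. ?v l * ?v l) / ?S\<^sup>2" for j
  proof -
    have "resolvent_sq A z (Suc m) j j =
      (\<Sum>l<Suc m. ?R j l * ?R l j + 2 * ?v j / ?S * (?R j l * ?v l) + ?v j * ?v j / ?S\<^sup>2 * (?v l * ?v l))"
      unfolding resolvent_sq_def prod_upto_def resolvent_Suc
      by (intro sum.cong refl)
        (simp add: resolvent_sym[of A z m _ j] algebra_simps power2_eq_square)
    also have "\<dots> = prod_upto (Suc m) ?R ?R j j + 2 * ?v j / ?S * (\<Sum>l<Suc m. ?R j l * ?v l)
       + ?v j * ?v j / ?S\<^sup>2 * (\<Sum>l<Suc m. ?v l * ?v l)"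
      by (simp only: sum.distrib sum_distrib_left prod_upto_def)
    also have "prod_upto (Suc m) ?R ?R j j = resolvent_sq A z m j j"
      unfolding resolvent_sq_def by (rule prod_upto_resolvent_extend) simp
    finally show ?thesis by (simp only: Wm) simp
  qed
  have bound: "cmod (resolvent_sq A z (Suc m) j j - resolvent_sq A z m j j) \<le>
      2 / cmod ?S * (cmod (?v j) * cmod (?W j)) + ?V / (cmod ?S)\<^sup>2 * (cmod (?v j))\<^sup>2" for j
  proof -
    have "cmod (resolvent_sq A z (Suc m) j j - resolvent_sq A z m j j) \<le>
      cmod (2 * (?v j * ?W j) / ?S) + cmod (?v j * ?v j * (\<Sum>l<Suc m. ?v l * ?v l) / ?S\<^sup>2)"
      unfolding diff by (rule norm_triangle_ineq)
    moreover have "cmod (2 * (?v j * ?W j) / ?S) = 2 / cmod ?S * (cmod (?v j) * cmod (?W j))"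
      by (simp add: norm_mult norm_divide)
    moreover have "cmod (?v j * ?v j * (\<Sum>l<Suc m. ?v l * ?v l) / ?S\<^sup>2)
       = (cmod (?v j))\<^sup>2 * cmod (\<Sum>l<Suc m. ?v l * ?v l) / (cmod ?S)\<^sup>2"
      by (simp only: norm_mult norm_divide norm_power power2_eq_square)
    moreover have "(cmod (?v j))\<^sup>2 * cmod (\<Sum>l<Suc m. ?v l * ?v l) / (cmod ?S)\<^sup>2
        \<le> ?V / (cmod ?S)\<^sup>2 * (cmod (?v j))\<^sup>2"
      using mult_left_mono[OF vv, of "(cmod (?v j))\<^sup>2"]
      by (simp only: times_divide_eq_left) (intro divide_right_mono, simp_all add: mult.commute)
    ultimately show ?thesis by linarith
  qed
  have W: "(\<Sum>j<Suc m. (cmod (?W j))\<^sup>2) \<le> ?V / (Im z)\<^sup>2"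
  proof -
    have "(\<Sum>j<Suc m. (cmod (?W j))\<^sup>2) = (\<Sum>j<m. (cmod (?W j))\<^sup>2)" by (simp add: resolvent_outside)
    also have "\<dots> \<le> (\<Sum>j<m. (cmod (?v j))\<^sup>2) / (Im z)\<^sup>2" by (rule resolvent_apply_norm[OF assms])
    also have "\<dots> \<le> ?V / (Im z)\<^sup>2" by (intro divide_right_mono) auto
    finally show ?thesis .
  qed
  have vW: "(\<Sum>j<Suc m. cmod (?v j) * cmod (?W j)) \<le> ?V / Im z"
  proof -
    have "(\<Sum>j<Suc m. cmod (?v j) * cmod (?W j)) \<le> sqrt ?V * sqrt (\<Sum>j<Suc m. (cmod (?W j))\<^sup>2)"
      using L2_set_mult_ineq[of "\<lambda>j. cmod (?v j)" "\<lambda>j. cmod (?W j)" "{..<Suc m}"]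
      by (simp only: L2_set_def abs_norm_cancel)
    also have "\<dots> \<le> sqrt ?V * sqrt (?V / (Im z)\<^sup>2)"
      by (intro mult_left_mono real_sqrt_le_mono W real_sqrt_ge_zero V)
    also have "\<dots> = ?V / Im z" using assms(2) V by (simp only: real_sqrt_divide) simp
    finally show ?thesis .
  qed
  have "(\<Sum>j<Suc m. cmod (resolvent_sq A z (Suc m) j j - resolvent_sq A z m j j)) \<le>
      (\<Sum>j<Suc m. 2 / cmod ?S * (cmod (?v j) * cmod (?W j)) + ?V / (cmod ?S)\<^sup>2 * (cmod (?v j))\<^sup>2)"
    by (intro sum_mono bound)
  also have "\<dots> = 2 / cmod ?S * (\<Sum>j<Suc m. cmod (?v j) * cmod (?W j)) + ?V / (cmod ?S)\<^sup>2 * ?V"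
    by (simp only: sum.distrib sum_distrib_left)
  also have "\<dots> \<le> 2 / cmod ?S * (?V / Im z) + ?V / (cmod ?S)\<^sup>2 * ?V"
    using S by (intro add_right_mono mult_left_mono vW) simp
  also have "\<dots> = 2 / Im z * (?V / cmod ?S) + (?V / cmod ?S)\<^sup>2"
    by (simp only: power2_eq_square) (simp add: field_simps)
  also have "\<dots> \<le> 2 / Im z * (1 / Im z) + (1 / Im z)\<^sup>2"
    using assms(2) V S by (intro add_mono mult_left_mono power_mono VS) auto
  also have "\<dots> = 3 / (Im z)\<^sup>2" by (simp add: power2_eq_square)
  finally show ?thesis .
qed

lemma telescope_diag_le:
  fixes F :: "nat \<Rightarrow> nat \<Rightarrow> nat \<Rightarrow> complex"
  assumes out: "\<And>m j. m \<le> j \<Longrightarrow> F m j j = 0"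
    and step: "\<And>m. (\<Sum>j<Suc m. cmod (F (Suc m) j j - F m j j)) \<le> K"
  shows "(\<Sum>j<m + k. cmod (F (m + k) j j - F m j j)) \<le> real k * K"
proof (induction k)
  case (Suc k)
  have "(\<Sum>j<m + Suc k. cmod (F (m + Suc k) j j - F m j j)) \<le>
    (\<Sum>j<m + Suc k. cmod (F (Suc (m + k)) j j - F (m + k) j j) + cmod (F (m + k) j j - F m j j))"
    by (intro sum_mono) (simp add: norm_diff_triangle_ineq norm_triangle_ineq3 order_trans[OF _ norm_triangle_ineq])
  also have "\<dots> = (\<Sum>j<Suc (m + k). cmod (F (Suc (m + k)) j j - F (m + k) j j))
     + (\<Sum>j<m + k. cmod (F (m + k) j j - F m j j))"
    by (simp add: sum.distrib out)
  also have "\<dots> \<le> K + real k * K" by (intro add_mono step Suc)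
  finally show ?case by (simp add: algebra_simps)
qed simp

lemma resolvent_diag_steps_le:
  assumes "symmetric_entries A" "Im z > 0"
  shows "(\<Sum>j<m + k. cmod (resolvent A z (m + k) j j - resolvent A z m j j)) \<le> real k * (1 / Im z)"
  by (rule telescope_diag_le) (simp_all only: resolvent_outside step_diag_le[OF assms] simp_thms)

lemma resolvent_sq_diag_steps_le:
  assumes "symmetric_entries A" "Im z > 0"
  shows "(\<Sum>j<m + k. cmod (resolvent_sq A z (m + k) j j - resolvent_sq A z m j j)) \<le> real k * (3 / (Im z)\<^sup>2)"
  by (rule telescope_diag_le) (simp_all only: resolvent_sq_outside step_diag_sq_le[OF assms] simp_thms)

lemma Im_resolvent_diag_nonneg:
  assumes "symmetric_entries A" "Im z > 0"
  shows "Im (resolvent A z m k k) \<ge> 0"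
proof (cases "k < m")
  case True
  have "Im (\<Sum>j<m. cnj (if j = k then 1 else 0) * resolvent A z m j k)
      = Im z * (\<Sum>j<m. (cmod (resolvent A z m j k))\<^sup>2)"
    by (rule Im_quadratic_form[OF assms(1)]) (use True resolvent_equation[OF assms] in simp)
  moreover have "(\<Sum>j<m. cnj (if j = k then 1 else 0) * resolvent A z m j k) = resolvent A z m k k"
  proof -
    have "(\<Sum>j<m. cnj (if j = k then 1 else 0) * resolvent A z m j k)
       = (\<Sum>j<m. resolvent A z m j k * (if j = k then 1 else 0))"
      by (intro sum.cong) auto
    then show ?thesis using True by (simp only: sum_mult_delta)
  qed
  ultimately show ?thesis using assms(2) by (simp add: sum_nonneg)
qed (simp add: resolvent_outside)

lemma resolvent_sq_diag_norm:
  assumes "symmetric_entries A" "Im z > 0"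
  shows "cmod (resolvent_sq A z m j j) \<le> 1 / (Im z)\<^sup>2"
proof -
  have "cmod (resolvent_sq A z m j j) \<le> (\<Sum>l<m. (cmod (resolvent A z m l j))\<^sup>2)"
    unfolding resolvent_sq_def prod_upto_def
    by (rule order_trans[OF norm_sum]) (simp add: norm_mult resolvent_sym[of A z m j] power2_eq_square)
  also have "\<dots> \<le> 1 / (Im z)\<^sup>2" by (rule resolvent_col_norm[OF assms])
  finally show ?thesis .
qed

lemma resolvent_sq_frobenius:
  assumes "symmetric_entries A" "Im z > 0"
  shows "(\<Sum>j<m. \<Sum>k<m. (cmod (resolvent_sq A z m j k))\<^sup>2) \<le> real m / (Im z)^4"
  using resolvent_prod_frobenius[OF assms assms, of m]
  by (simp add: resolvent_sq_def flip: power2_eq_square power_mult)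

section \<open>The dynamics along characteristics\<close>

lemma discrete_gronwall:
  fixes x y :: "nat \<Rightarrow> real"
  assumes "x 0 \<le> 0" "a \<ge> 0" "\<And>i. y i \<ge> 0"
    and step: "\<And>i. i < n \<Longrightarrow> x (Suc i) \<le> (1 + a) * x i + y i"
  shows "x n \<le> (1 + a) ^ n * (\<Sum>i<n. y i)"
  using step
proof (induction n)
  case (Suc n)
  have "x (Suc n) \<le> (1 + a) * x n + y n" using Suc.prems by simp
  also have "\<dots> \<le> (1 + a) * ((1 + a) ^ n * (\<Sum>i<n. y i)) + (1 + a) ^ Suc n * y n"
  proof (intro add_mono mult_left_mono Suc.IH)
    show "y n \<le> (1 + a) ^ Suc n * y n"
      using assms(2,3) mult_right_mono[of 1 "(1 + a) ^ Suc n" "y n"] one_le_power[of "1 + a" "Suc n"] by simp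
  qed (use assms Suc.prems in auto)
  finally show ?case by (simp add: algebra_simps)
qed (use assms in simp)

definition quad_form :: "(nat \<Rightarrow> nat \<Rightarrow> real) \<Rightarrow> nat \<Rightarrow> (nat \<Rightarrow> nat \<Rightarrow> complex) \<Rightarrow> complex" where
  "quad_form A i P = (\<Sum>j<i. \<Sum>k<i. of_real (A j i * A k i) * P j k)"

text \<open>
  The point after i of n steps on the characteristic that starts at w; it ends at w + 1/w.
\<close>

definition characteristic :: "complex \<Rightarrow> nat \<Rightarrow> nat \<Rightarrow> complex" where
  "characteristic w n i = w + of_real (real i / real n) / w"

text \<open>
  The error made in row i when the quadratic forms of R and R^2 at the new row are replaced by the
  normalised traces. Both resolvents are taken at the point reached after the step.
\<close>

definition row_noise :: "complex \<Rightarrow> nat \<Rightarrow> (nat \<Rightarrow> nat \<Rightarrow> real) \<Rightarrow> nat \<Rightarrow> real" where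
  "row_noise w n A i =
     cmod (quad_form A i (resolvent A (characteristic w n (Suc i)) i) - trace_upto i (resolvent A (characteristic w n (Suc i)) i) / of_nat n)
   + cmod (quad_form A i (resolvent_sq A (characteristic w n (Suc i)) i) - trace_upto i (resolvent_sq A (characteristic w n (Suc i)) i) / of_nat n)"

lemma Im_characteristic_ge:
  assumes "Im w > 0" "i \<le> n"
  shows "Im (characteristic w n i) \<ge> Im w * (1 - 1 / (cmod w)\<^sup>2)"
proof -
  have w: "cmod w > 0" using assms by auto
  have "Im (of_real t / w) = - t * (Im w / (cmod w)\<^sup>2)" for t
    by (simp add: Im_divide cmod_power2)
  then have "Im (of_real (real i / real n) / w) = - (real i / real n) * (Im w / (cmod w)\<^sup>2)" .
  moreover have "real i / real n * (Im w / (cmod w)\<^sup>2) \<le> 1 * (Im w / (cmod w)\<^sup>2)"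
    using assms by (intro mult_right_mono) (auto simp: divide_le_eq_1)
  ultimately show ?thesis by (simp add: characteristic_def algebra_simps)
qed

lemma inverse_square_less_1:
  fixes r :: real
  assumes "1 < r"
  shows "1 / r\<^sup>2 < 1"
proof -
  have 1: "1 < r\<^sup>2" using assms by (intro one_less_power) auto
  then have "0 < r\<^sup>2" by linarith
  then show ?thesis using 1 by (simp only: divide_less_eq_1_pos)
qed

lemma characteristic_height_pos:
  assumes "Im w > 0" "cmod w > 1"
  shows "Im w * (1 - 1 / (cmod w)\<^sup>2) > 0"
proof -
  have "1 / (cmod w)\<^sup>2 < 1" by (rule inverse_square_less_1[OF assms(2)])
  then show ?thesis using assms by simp
qed

lemma trace_upto_resolvent_le:
  assumes "symmetric_entries A" "Im z \<ge> \<eta>" "\<eta> > 0"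
  shows "cmod (trace_upto i (resolvent A z i)) \<le> real i / \<eta>"
proof -
  have "cmod (trace_upto i (resolvent A z i)) \<le> (\<Sum>j<i. 1 / \<eta>)"
    unfolding trace_upto_def
  proof (rule order_trans[OF norm_sum], rule sum_mono)
    fix j
    have "cmod (resolvent A z i j j) \<le> 1 / Im z" using assms by (intro resolvent_entry_norm) auto
    also have "\<dots> \<le> 1 / \<eta>" using assms by (intro divide_left_mono) auto
    finally show "cmod (resolvent A z i j j) \<le> 1 / \<eta>" .
  qed
  then show ?thesis by simp
qed

lemma trace_upto_resolvent_sq_le:
  assumes "symmetric_entries A" "Im z \<ge> \<eta>" "\<eta> > 0"
  shows "cmod (trace_upto i (resolvent_sq A z i)) \<le> real i / \<eta>\<^sup>2"
proof -
  have "cmod (trace_upto i (resolvent_sq A z i)) \<le> (\<Sum>j<i. 1 / \<eta>\<^sup>2)"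
    unfolding trace_upto_def
  proof (rule order_trans[OF norm_sum], rule sum_mono)
    fix j
    have "cmod (resolvent_sq A z i j j) \<le> 1 / (Im z)\<^sup>2" using assms by (intro resolvent_sq_diag_norm) auto
    also have "\<dots> \<le> 1 / \<eta>\<^sup>2" using assms by (intro divide_left_mono power_mono) auto
    finally show "cmod (resolvent_sq A z i j j) \<le> 1 / \<eta>\<^sup>2" .
  qed
  then show ?thesis by simp
qed

text \<open>
  Along z_i = w + (i/n)/w the deviation u_i = g_i(z_i) + (i/n)/w measures the distance to the exact
  solution -t/w of the limiting equation. The change of z from one step to the next compensates the
  trace term (1 + g') / (z + g) up to (1 + g') (z + g - w) / (w (z + g)), and z + g - w is u_i up to
  O(1/n). So u satisfies a linear recursion driven by the row noise.
\<close>

theorem resolvent_dynamics: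
  assumes A: "symmetric_entries A" "\<And>i. A i i = 0" and w: "Im w > 0" "cmod w > 1" and n: "n > 0"
  defines "\<eta> \<equiv> Im w * (1 - 1 / (cmod w)\<^sup>2)"
  defines "c \<equiv> 1 + 1 / \<eta>\<^sup>2"
  shows "cmod (trace_upto n (resolvent A (w + 1 / w) n) / of_nat n + 1 / w) \<le>
    exp (c / \<eta>) * ((1 / \<eta> + c / \<eta>\<^sup>2) * ((\<Sum>i<n. row_noise w n A i) / real n)
      + (c\<^sup>2 / \<eta> + 1 / \<eta>^3) / real n)"
proof -
  have eta: "\<eta> > 0" unfolding \<eta>_def by (rule characteristic_height_pos[OF w])
  have c1: "c \<ge> 1" by (simp add: c_def)
  define z where "z = characteristic w n"
  define u where "u i = trace_upto i (resolvent A (z i) i) / of_nat n + of_real (real i / real n) / w" for i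
  have w0: "w \<noteq> 0" using w by auto
  have iw: "cmod (1 / w) \<le> 1" using w by (simp add: norm_divide divide_le_eq_1)
  have z: "Im (z i) \<ge> \<eta>" if "i \<le> n" for i
    using Im_characteristic_ge[OF w(1) that] by (simp add: z_def \<eta>_def)
  have zs: "z (Suc i) = z i + 1 / (of_nat n * w)" for i
    by (simp add: z_def characteristic_def add_divide_distrib)
  have dz: "cmod (z (Suc i) - z i) \<le> 1 / real n" for i
    using iw n by (simp add: zs norm_divide norm_mult field_simps)
  have step: "cmod (u (Suc i)) \<le> (1 + c / \<eta> / real n) * cmod (u i)
     + ((1 / \<eta> + c / \<eta>\<^sup>2) * row_noise w n A i / real n + (c\<^sup>2 / \<eta> + 1 / \<eta>^3) / (real n)\<^sup>2)"
    if i: "i < n" for i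
  proof -
    let ?z = "z (Suc i)" and ?n = "complex_of_nat n"
    define g where "g = trace_upto i (resolvent A ?z i) / ?n"
    define g0 where "g0 = trace_upto i (resolvent A (z i) i) / ?n"
    define d where "d = trace_upto i (resolvent_sq A ?z i) / ?n"
    define q where "q = quad_form A i (resolvent A ?z i)"
    define p where "p = quad_form A i (resolvent_sq A ?z i)"
    have zp: "Im ?z \<ge> \<eta>" "Im (z i) \<ge> \<eta>" "Im ?z > 0" "Im (z i) > 0"
      using z[of "Suc i"] z[of i] i eta by auto
    have nn: "?n \<noteq> 0" using n by simp
    have noise: "row_noise w n A i = cmod (q - g) + cmod (p - d)"
      by (simp add: row_noise_def q_def p_def g_def d_def z_def)
    have S: "schur_compl A ?z i = - (?z + q)"
      by (simp add: schur_compl_def A(2) q_def quad_form_def col_image_def sum_distrib_left ac_simps)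
    have zq: "cmod (?z + q) \<ge> \<eta>"
      using schur_norm_ge'[OF A(1) zp(3), of i] zp(1) unfolding S norm_minus_cancel by linarith
    have "Im g \<ge> 0"
    proof -
      have "Im (trace_upto i (resolvent A ?z i)) \<ge> 0"
        unfolding trace_upto_def by (simp add: sum_nonneg Im_resolvent_diag_nonneg[OF A(1) zp(3)])
      then show ?thesis by (simp add: g_def)
    qed
    then have zg: "cmod (?z + g) \<ge> \<eta>"
      using abs_Im_le_cmod[of "?z + g"] zp(1) by simp
    have z0: "?z + q \<noteq> 0" "?z + g \<noteq> 0" using zq zg eta by auto
    have d: "cmod (1 + d) \<le> c"
    proof -
      have "cmod d \<le> (real i / \<eta>\<^sup>2) / real n"
        unfolding d_def norm_divide norm_of_nat
        by (intro divide_right_mono trace_upto_resolvent_sq_le A(1) zp eta) simp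
      also have "\<dots> \<le> 1 / \<eta>\<^sup>2" using i n eta by (simp add: field_simps)
      finally show ?thesis using norm_triangle_ineq[of 1 d] by (simp add: c_def)
    qed
    \<comment> \<open>the second order remainder of the move from the point of step i to the next\<close>
    define e where "e = g - g0 - d / (?n * w)"
    have e: "cmod e \<le> 1 / \<eta>^3 / (real n)\<^sup>2"
    proof -
      have "e = (trace_upto i (resolvent A ?z i) - trace_upto i (resolvent A (z i) i) - (?z - z i) * trace_upto i (resolvent_sq A ?z i)) / ?n"
        by (simp add: e_def g_def g0_def d_def zs diff_divide_distrib)
      then have "cmod e = cmod (trace_upto i (resolvent A ?z i) - trace_upto i (resolvent A (z i) i) - (?z - z i) * trace_upto i (resolvent_sq A ?z i)) / real n"
        by (simp add: norm_divide)
      also have "\<dots> \<le> ((cmod (?z - z i))\<^sup>2 * real i / \<eta>^3) / real n"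
        unfolding resolvent_sq_def
        by (intro divide_right_mono trace_resolvent_taylor_z A(1) zp(1,2) eta) simp
      also have "\<dots> \<le> ((1 / real n)\<^sup>2 * real n / \<eta>^3) / real n"
        using i eta by (intro divide_right_mono mult_mono power_mono dz) auto
      also have "\<dots> = 1 / \<eta>^3 / (real n)\<^sup>2" using n by (simp add: field_simps power2_eq_square)
      finally show ?thesis .
    qed
    have gg: "cmod (g - g0) \<le> 1 / \<eta>\<^sup>2 / real n"
    proof -
      have "cmod (g - g0) = cmod (trace_upto i (resolvent A ?z i) - trace_upto i (resolvent A (z i) i)) / real n"
        by (simp add: g_def g0_def norm_divide flip: diff_divide_distrib)
      also have "\<dots> \<le> (cmod (?z - z i) * real i / (Im ?z * Im (z i))) / real n"
        by (intro divide_right_mono trace_resolvent_lipschitz_z A(1) zp) simp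
      also have "\<dots> \<le> ((1 / real n) * real n / (\<eta> * \<eta>)) / real n"
        using i eta zp by (intro divide_right_mono frac_le mult_mono dz) auto
      also have "\<dots> = 1 / \<eta>\<^sup>2 / real n" using n by (simp add: power2_eq_square)
      finally show ?thesis .
    qed
    have ui: "u i = g0 + of_real (real i / real n) / w" by (simp add: u_def g0_def)
    have zgw: "?z + g - w = u i + (1 / (?n * w) + (g - g0))"
      by (simp add: ui z_def characteristic_def add_divide_distrib)
    have zgw_le: "cmod (?z + g - w) \<le> cmod (u i) + c / real n"
    proof -
      have "cmod (1 / (?n * w)) \<le> 1 / real n"
        using dz[of i] by (simp add: zs)
      then have "cmod (1 / (?n * w) + (g - g0)) \<le> 1 / real n + 1 / \<eta>\<^sup>2 / real n"
        using gg by (intro norm_triangle_le) simp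
      also have "\<dots> = c / real n" by (simp add: c_def add_divide_distrib)
      finally show ?thesis unfolding zgw by (intro norm_triangle_le) simp
    qed
    have uS: "u (Suc i) = g - (1 + p) / (?z + q) / ?n + of_real (real (Suc i) / real n) / w"
    proof -
      have "trace_upto (Suc i) (resolvent A ?z (Suc i)) = trace_upto i (resolvent A ?z i) - (1 + p) / (?z + q)"
        by (simp only: trace_upto_resolvent_Suc S step_vec_sq_sum p_def quad_form_def resolvent_sq_def divide_minus_right)
          simp
      then show ?thesis by (simp only: u_def g_def diff_divide_distrib)
    qed
    \<comment> \<open>the noise of the row as it enters the recursion\<close>
    define ns where "ns = (p - d) / (?z + q) - (1 + d) * (q - g) / ((?z + q) * (?z + g))"
    have ns: "(1 + p) / (?z + q) - (1 + d) / (?z + g) = ns"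
      using z0 by (simp add: ns_def divide_simps) (simp add: algebra_simps)
    have main: "u (Suc i) = u i + ((1 + d) * ((?z + g - w) / (w * (?z + g))) - ns) / ?n + e"
    proof -
      have "(?z + g - w) / (w * (?z + g)) = 1 / w - 1 / (?z + g)"
        using z0 w0 by (simp add: field_simps)
      then have "((1 + d) * ((?z + g - w) / (w * (?z + g))) - ns) / ?n
         = (1 + d) / w / ?n - (1 + p) / (?z + q) / ?n"
        unfolding ns[symmetric] by (simp add: right_diff_distrib diff_divide_distrib)
      then show ?thesis
        by (simp add: uS ui e_def add_divide_distrib mult.commute)
    qed
    have ns_le: "cmod ns \<le> (1 / \<eta> + c / \<eta>\<^sup>2) * row_noise w n A i"
    proof -
      have "cmod ns \<le> cmod (p - d) / cmod (?z + q) + cmod (1 + d) * cmod (q - g) / (cmod (?z + q) * cmod (?z + g))"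
        unfolding ns_def by (rule order_trans[OF norm_triangle_ineq4]) (simp add: norm_divide norm_mult)
      also have "\<dots> \<le> cmod (p - d) / \<eta> + c * cmod (q - g) / (\<eta> * \<eta>)"
        using eta zq zg d c1 by (intro add_mono frac_le mult_mono) auto
      also have "\<dots> \<le> (cmod (q - g) + cmod (p - d)) / \<eta> + c * (cmod (q - g) + cmod (p - d)) / \<eta>\<^sup>2"
        using eta c1 unfolding power2_eq_square by (intro add_mono divide_right_mono mult_left_mono) auto
      finally show ?thesis by (simp add: noise algebra_simps add_divide_distrib)
    qed
    have drift: "cmod ((1 + d) * ((?z + g - w) / (w * (?z + g)))) \<le> c * ((cmod (u i) + c / real n) / (1 * \<eta>))"
      unfolding norm_mult norm_divide using eta zg d c1 w zgw_le
      by (intro mult_mono frac_le) auto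
    have "cmod (u (Suc i)) \<le> cmod (u i) + (cmod ((1 + d) * ((?z + g - w) / (w * (?z + g)))) + cmod ns) / real n + cmod e"
    proof -
      define Y where "Y = (1 + d) * ((?z + g - w) / (w * (?z + g)))"
      have "cmod (Y - ns) / real n \<le> (cmod Y + cmod ns) / real n"
        by (intro divide_right_mono norm_triangle_ineq4) simp
      moreover have "cmod (u i + (Y - ns) / ?n + e) \<le> cmod (u i) + cmod ((Y - ns) / ?n) + cmod e"
        by (intro norm_triangle_le add_right_mono norm_triangle_ineq)
      ultimately show ?thesis unfolding main Y_def[symmetric] by (simp add: norm_divide)
    qed
    also have "\<dots> \<le> cmod (u i) + (c * ((cmod (u i) + c / real n) / (1 * \<eta>)) + (1 / \<eta> + c / \<eta>\<^sup>2) * row_noise w n A i) / real n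
       + 1 / \<eta>^3 / (real n)\<^sup>2"
      using n by (intro add_mono divide_right_mono drift ns_le e) auto
    also have "\<dots> = (1 + c / \<eta> / real n) * cmod (u i)
     + ((1 / \<eta> + c / \<eta>\<^sup>2) * row_noise w n A i / real n + (c\<^sup>2 / \<eta> + 1 / \<eta>^3) / (real n)\<^sup>2)"
      using n eta by (simp add: add_divide_distrib ring_distribs power2_eq_square)
    finally show ?thesis .
  qed
  have rn: "row_noise w n A i \<ge> 0" for i by (simp add: row_noise_def)
  have "cmod (u n) \<le> (1 + c / \<eta> / real n) ^ n *
     (\<Sum>i<n. (1 / \<eta> + c / \<eta>\<^sup>2) * row_noise w n A i / real n + (c\<^sup>2 / \<eta> + 1 / \<eta>^3) / (real n)\<^sup>2)"
  proof (rule discrete_gronwall[where x = "\<lambda>i. cmod (u i)", OF _ _ _ step])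
    show "cmod (u 0) \<le> 0" by (simp add: u_def trace_upto_def)
  qed (use c1 eta rn in auto)
  also have "(\<Sum>i<n. (1 / \<eta> + c / \<eta>\<^sup>2) * row_noise w n A i / real n + (c\<^sup>2 / \<eta> + 1 / \<eta>^3) / (real n)\<^sup>2)
    = (1 / \<eta> + c / \<eta>\<^sup>2) * ((\<Sum>i<n. row_noise w n A i) / real n) + (c\<^sup>2 / \<eta> + 1 / \<eta>^3) / real n"
    using n by (simp add: sum.distrib sum_distrib_left sum_divide_distrib power2_eq_square)
  also have "(1 + c / \<eta> / real n) ^ n * \<dots> \<le> exp (c / \<eta>) * \<dots>"
  proof (rule mult_right_mono)
    have "(1 + c / \<eta> / real n) ^ n \<le> exp (c / \<eta> / real n) ^ n"
      using c1 eta by (intro power_mono exp_ge_add_one_self) auto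
    also have "\<dots> = exp (c / \<eta>)" using n by (simp add: exp_of_nat_mult[symmetric])
    finally show "(1 + c / \<eta> / real n) ^ n \<le> exp (c / \<eta>)" .
    show "0 \<le> (1 / \<eta> + c / \<eta>\<^sup>2) * ((\<Sum>i<n. row_noise w n A i) / real n) + (c\<^sup>2 / \<eta> + 1 / \<eta>^3) / real n"
      using c1 eta rn by (intro add_nonneg_nonneg mult_nonneg_nonneg divide_nonneg_nonneg sum_nonneg) auto
  qed
  finally show ?thesis using n by (simp add: u_def z_def characteristic_def)
qed

section \<open>Conditional expectations of bounded variables\<close>

context prob_space
begin

lemma bounded_integrable:
  fixes f :: "'a \<Rightarrow> real"
  assumes "f \<in> borel_measurable M" "\<And>\<omega>. \<bar>f \<omega>\<bar> \<le> K"
  shows "integrable M f"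
  by (rule integrable_const_bound[where B = K]) (use assms in auto)

text \<open>
  A version of the conditional expectation that is bounded everywhere and not only almost surely, so
  that products of such variables are integrable without case distinctions on null sets.
\<close>

definition clipped_cond_exp :: "real \<Rightarrow> 'a measure \<Rightarrow> ('a \<Rightarrow> real) \<Rightarrow> 'a \<Rightarrow> real" where
  "clipped_cond_exp K F f \<omega> = max (- K) (min K (real_cond_exp M F f \<omega>))"

lemma subalgebra_sigma_finite: "subalgebra M F \<Longrightarrow> sigma_finite_subalgebra M F"
proof -
  assume "subalgebra M F"
  then interpret finite_measure_subalgebra M F by unfold_locales
  show ?thesis by unfold_locales
qed

lemma clipped_cond_exp_measurable_sub: "clipped_cond_exp K F f \<in> borel_measurable F"
  unfolding clipped_cond_exp_def by measurable

lemma clipped_cond_exp_measurable: "subalgebra M F \<Longrightarrow> clipped_cond_exp K F f \<in> borel_measurable M"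
  by (rule measurable_from_subalg[OF _ clipped_cond_exp_measurable_sub])

lemma clipped_cond_exp_bound: "K \<ge> 0 \<Longrightarrow> \<bar>clipped_cond_exp K F f \<omega>\<bar> \<le> K"
  by (auto simp: clipped_cond_exp_def)

lemma clipped_cond_exp_AE:
  assumes "subalgebra M F" and f: "f \<in> borel_measurable M" "\<And>\<omega>. \<bar>f \<omega>\<bar> \<le> K"
  shows "AE \<omega> in M. clipped_cond_exp K F f \<omega> = real_cond_exp M F f \<omega>"
proof -
  interpret sigma_finite_subalgebra M F by (rule subalgebra_sigma_finite[OF assms(1)])
  have i: "integrable M f" by (rule bounded_integrable[OF f])
  have "AE \<omega> in M. real_cond_exp M F f \<omega> \<le> K"
    by (rule real_cond_exp_le_c[OF i]) (use f(2) in \<open>auto simp: abs_le_iff\<close>)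
  moreover have "AE \<omega> in M. real_cond_exp M F f \<omega> \<ge> - K"
  proof (rule real_cond_exp_ge_c[OF i])
    have "- K \<le> f \<omega>" for \<omega> using f(2)[of \<omega>] by (simp add: abs_le_iff)
    then show "AE \<omega> in M. - K \<le> f \<omega>" by simp
  qed
  ultimately show ?thesis by eventually_elim (auto simp: clipped_cond_exp_def)
qed

lemma clipped_cond_exp_integral:
  assumes F: "subalgebra M F" and f: "f \<in> borel_measurable M" "\<And>\<omega>. \<bar>f \<omega>\<bar> \<le> K"
    and g: "g \<in> borel_measurable F" "\<And>\<omega>. \<bar>g \<omega>\<bar> \<le> L"
  shows "(\<integral>\<omega>. g \<omega> * clipped_cond_exp K F f \<omega> \<partial>M) = (\<integral>\<omega>. g \<omega> * f \<omega> \<partial>M)"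
proof -
  interpret sigma_finite_subalgebra M F by (rule subalgebra_sigma_finite[OF F])
  have [measurable]: "g \<in> borel_measurable M" "f \<in> borel_measurable M"
    using measurable_from_subalg[OF F g(1)] f(1) by auto
  have "integrable M (\<lambda>\<omega>. g \<omega> * f \<omega>)"
    by (rule bounded_integrable[where K = "L * K"])
      (auto simp: abs_mult intro!: mult_mono f g order_trans[OF abs_ge_zero g(2)])
  then have "(\<integral>\<omega>. g \<omega> * real_cond_exp M F f \<omega> \<partial>M) = (\<integral>\<omega>. g \<omega> * f \<omega> \<partial>M)"
    by (intro real_cond_exp_intg g f)
  moreover have "(\<integral>\<omega>. g \<omega> * clipped_cond_exp K F f \<omega> \<partial>M) = (\<integral>\<omega>. g \<omega> * real_cond_exp M F f \<omega> \<partial>M)"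
    using clipped_cond_exp_AE[OF F f] clipped_cond_exp_measurable[OF F, of K f] measurable_from_subalg[OF F borel_measurable_cond_exp]
    by (intro integral_cong_AE) auto
  ultimately show ?thesis by simp
qed

lemma real_cond_exp_abs_le:
  assumes F: "subalgebra M F" and f: "integrable M f"
  shows "AE \<omega> in M. \<bar>real_cond_exp M F f \<omega>\<bar> \<le> real_cond_exp M F (\<lambda>\<omega>. \<bar>f \<omega>\<bar>) \<omega>"
proof -
  interpret sigma_finite_subalgebra M F by (rule subalgebra_sigma_finite[OF F])
  have "AE \<omega> in M. real_cond_exp M F f \<omega> \<le> real_cond_exp M F (\<lambda>\<omega>. \<bar>f \<omega>\<bar>) \<omega>"
    by (rule real_cond_exp_mono) (use f in auto)
  moreover have "AE \<omega> in M. real_cond_exp M F (\<lambda>\<omega>. - f \<omega>) \<omega> \<le> real_cond_exp M F (\<lambda>\<omega>. \<bar>f \<omega>\<bar>) \<omega>"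
    by (rule real_cond_exp_mono) (use f in auto)
  moreover have "AE \<omega> in M. real_cond_exp M F (\<lambda>\<omega>. - f \<omega>) \<omega> = - real_cond_exp M F f \<omega>"
    using real_cond_exp_cmult[OF f, of "-1"] by simp
  ultimately show ?thesis by eventually_elim (auto simp: abs_le_iff)
qed

lemma real_cond_exp_abs_integral_le:
  assumes F: "subalgebra M F" and f: "integrable M f"
  shows "integrable M (\<lambda>\<omega>. \<bar>real_cond_exp M F f \<omega>\<bar>)"
    and "(\<integral>\<omega>. \<bar>real_cond_exp M F f \<omega>\<bar> \<partial>M) \<le> (\<integral>\<omega>. \<bar>f \<omega>\<bar> \<partial>M)"
proof -
  interpret sigma_finite_subalgebra M F by (rule subalgebra_sigma_finite[OF F])
  show 1: "integrable M (\<lambda>\<omega>. \<bar>real_cond_exp M F f \<omega>\<bar>)"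
    using real_cond_exp_int(1)[OF f] by simp
  have "(\<integral>\<omega>. \<bar>real_cond_exp M F f \<omega>\<bar> \<partial>M) \<le> (\<integral>\<omega>. real_cond_exp M F (\<lambda>\<omega>. \<bar>f \<omega>\<bar>) \<omega> \<partial>M)"
    using f real_cond_exp_abs_le[OF F f] by (intro integral_mono_AE 1 real_cond_exp_int) auto
  also have "\<dots> = (\<integral>\<omega>. \<bar>f \<omega>\<bar> \<partial>M)" using f by (intro real_cond_exp_int) auto
  finally show "(\<integral>\<omega>. \<bar>real_cond_exp M F f \<omega>\<bar> \<partial>M) \<le> (\<integral>\<omega>. \<bar>f \<omega>\<bar> \<partial>M)" .
qed

section \<open>Sums of variables that are orthogonal beyond a lag\<close>

lemma integral_double_sum:
  fixes f :: "nat \<Rightarrow> nat \<Rightarrow> 'a \<Rightarrow> real"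
  assumes "\<And>j k. j < N \<Longrightarrow> k < m \<Longrightarrow> integrable M (f j k)"
  shows "(\<integral>\<omega>. (\<Sum>j<N. \<Sum>k<m. f j k \<omega>) \<partial>M) = (\<Sum>j<N. \<Sum>k<m. \<integral>\<omega>. f j k \<omega> \<partial>M)"
proof -
  have "(\<integral>\<omega>. (\<Sum>j<N. \<Sum>k<m. f j k \<omega>) \<partial>M) = (\<Sum>j<N. \<integral>\<omega>. (\<Sum>k<m. f j k \<omega>) \<partial>M)"
    using assms by (intro Bochner_Integration.integral_sum Bochner_Integration.integrable_sum) auto
  also have "\<dots> = (\<Sum>j<N. \<Sum>k<m. \<integral>\<omega>. f j k \<omega> \<partial>M)"
    using assms by (intro sum.cong refl Bochner_Integration.integral_sum) auto
  finally show ?thesis .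
qed

text \<open>
  Each index has at most 2 a partners with a nonzero covariance. The lag 1 is the martingale case.
\<close>

lemma lagged_orthogonal_second_moment:
  fixes T :: "nat \<Rightarrow> 'a \<Rightarrow> real"
  assumes meas: "\<And>j. j < N \<Longrightarrow> T j \<in> borel_measurable M"
    and bound: "\<And>j \<omega>. j < N \<Longrightarrow> \<bar>T j \<omega>\<bar> \<le> K"
    and orth: "\<And>j k. j + a \<le> k \<Longrightarrow> k < N \<Longrightarrow> (\<integral>\<omega>. T j \<omega> * T k \<omega> \<partial>M) = 0"
  shows "(\<integral>\<omega>. (\<Sum>j<N. T j \<omega>)\<^sup>2 \<partial>M) \<le> 2 * real a * (\<Sum>j<N. \<integral>\<omega>. (T j \<omega>)\<^sup>2 \<partial>M)"
proof -
  define s where "s j = (\<integral>\<omega>. (T j \<omega>)\<^sup>2 \<partial>M)" for j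
  define near where "near j k \<longleftrightarrow> j < k + a \<and> k < j + a" for j k
  have s0: "s j \<ge> 0" for j by (simp add: s_def)
  have int2: "integrable M (\<lambda>\<omega>. T j \<omega> * T k \<omega>)" if "j < N" "k < N" for j k
  proof (rule bounded_integrable[where K = "K * K"])
    show "(\<lambda>\<omega>. T j \<omega> * T k \<omega>) \<in> borel_measurable M" using meas that by simp
    show "\<bar>T j \<omega> * T k \<omega>\<bar> \<le> K * K" for \<omega>
      unfolding abs_mult using bound[OF that(1), of \<omega>] bound[OF that(2), of \<omega>] by (intro mult_mono) auto
  qed
  have pair: "(\<integral>\<omega>. T j \<omega> * T k \<omega> \<partial>M) \<le> (if near j k then (s j + s k) / 2 else 0)" if "j < N" "k < N" for j k
  proof (cases "near j k")
    case True
    have "(\<integral>\<omega>. T j \<omega> * T k \<omega> \<partial>M) \<le> (\<integral>\<omega>. ((T j \<omega>)\<^sup>2 + (T k \<omega>)\<^sup>2) / 2 \<partial>M)"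
    proof (rule integral_mono[OF int2[OF that]])
      show "integrable M (\<lambda>\<omega>. ((T j \<omega>)\<^sup>2 + (T k \<omega>)\<^sup>2) / 2)"
        using int2[of j j] int2[of k k] that by (simp add: power2_eq_square)
      show "T j \<omega> * T k \<omega> \<le> ((T j \<omega>)\<^sup>2 + (T k \<omega>)\<^sup>2) / 2" for \<omega>
        using sum_squares_bound[of "T j \<omega>" "T k \<omega>"] by simp
    qed
    also have "\<dots> = (s j + s k) / 2"
      using int2[of j j] int2[of k k] that by (simp add: s_def power2_eq_square)
    finally show ?thesis using True by simp
  next
    case False
    then have "j + a \<le> k \<or> k + a \<le> j" by (auto simp: near_def)
    then show ?thesis
      using orth[of j k] orth[of k j] that False by (auto simp: mult.commute)
  qed
  have "(\<integral>\<omega>. (\<Sum>j<N. T j \<omega>)\<^sup>2 \<partial>M) = (\<integral>\<omega>. (\<Sum>j<N. \<Sum>k<N. T j \<omega> * T k \<omega>) \<partial>M)"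
    by (simp add: power2_eq_square sum_product)
  also have "\<dots> = (\<Sum>j<N. \<Sum>k<N. \<integral>\<omega>. T j \<omega> * T k \<omega> \<partial>M)"
    by (rule integral_double_sum) (rule int2)
  also have "\<dots> \<le> (\<Sum>j<N. \<Sum>k<N. if near j k then (s j + s k) / 2 else 0)"
    by (intro sum_mono pair) auto
  also have "\<dots> = (\<Sum>j<N. \<Sum>k<N. if near j k then s j / 2 else 0) + (\<Sum>j<N. \<Sum>k<N. if near j k then s k / 2 else 0)"
    unfolding sum.distrib[symmetric] by (intro sum.cong refl) (auto simp: add_divide_distrib)
  also have "(\<Sum>j<N. \<Sum>k<N. if near j k then s k / 2 else 0) = (\<Sum>k<N. \<Sum>j<N. if near k j then s k / 2 else 0)"
    by (subst sum.swap) (intro sum.cong refl, auto simp: near_def)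
  also have "(\<Sum>j<N. \<Sum>k<N. if near j k then s j / 2 else 0) + \<dots> = (\<Sum>j<N. \<Sum>k<N. if near j k then s j else 0)"
    unfolding sum.distrib[symmetric] by (intro sum.cong refl) auto
  also have "\<dots> \<le> (\<Sum>j<N. 2 * real a * s j)"
  proof (rule sum_mono)
    fix j
    have "(\<Sum>k<N. if near j k then s j else 0) = s j * real (card ({..<N} \<inter> {k. near j k}))"
      by (simp add: sum.If_cases)
    also have "\<dots> \<le> s j * real (2 * a)"
    proof (intro mult_left_mono s0 of_nat_mono)
      have "{..<N} \<inter> {k. near j k} \<subseteq> {j + 1 - a..<j + a}" by (auto simp: near_def)
      then have "card ({..<N} \<inter> {k. near j k}) \<le> card {j + 1 - a..<j + a}"
        by (rule card_mono[rotated]) simp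
      then show "card ({..<N} \<inter> {k. near j k}) \<le> 2 * a" by simp
    qed
    finally show "(\<Sum>k<N. if near j k then s j else 0) \<le> 2 * real a * s j" by (simp add: mult_ac)
  qed
  finally show ?thesis by (simp add: s_def sum_distrib_left)
qed

lemma abs_moment_le_sqrt:
  fixes f :: "'a \<Rightarrow> real"
  assumes f: "f \<in> borel_measurable M" "\<And>\<omega>. \<bar>f \<omega>\<bar> \<le> K" and V: "(\<integral>\<omega>. (f \<omega>)\<^sup>2 \<partial>M) \<le> V"
  shows "(\<integral>\<omega>. \<bar>f \<omega>\<bar> \<partial>M) \<le> sqrt V"
proof -
  have 1: "integrable M (\<lambda>\<omega>. \<bar>f \<omega>\<bar>)" using bounded_integrable[OF f] by simp
  have 2: "integrable M (\<lambda>\<omega>. \<bar>f \<omega>\<bar>\<^sup>2)"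
  proof (rule bounded_integrable[where K = "K\<^sup>2"])
    show "(\<lambda>\<omega>. \<bar>f \<omega>\<bar>\<^sup>2) \<in> borel_measurable M" using f(1) by simp
    show "\<bar>\<bar>f \<omega>\<bar>\<^sup>2\<bar> \<le> K\<^sup>2" for \<omega> using f(2)[of \<omega>] by (simp add: abs_le_square_iff[symmetric] abs_le_iff)
  qed
  have "0 \<le> variance (\<lambda>\<omega>. \<bar>f \<omega>\<bar>)" by (rule variance_positive)
  then have "(\<integral>\<omega>. \<bar>f \<omega>\<bar> \<partial>M)\<^sup>2 \<le> V" using variance_eq[OF 1 2] V by simp
  then show ?thesis by (rule real_le_rsqrt)
qed

end

section \<open>The array, its filtrations and its truncation\<close>

definition index_algebra ::
  "'a measure \<Rightarrow> (int \<Rightarrow> int \<Rightarrow> 'a \<Rightarrow> real) \<Rightarrow> (int \<times> int) set \<Rightarrow> 'a measure" where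
  "index_algebra M X I = sigma (space M)
     {X u v -` S \<inter> space M | u v S. (u, v) \<in> I \<and> v \<le> u \<and> S \<in> sets borel}"

lemma past_algebra_eq: "past_algebra M X a i j = index_algebra M X (past_indices a i j)"
  by (simp add: past_algebra_def index_algebra_def)

definition rows_upto :: "int \<Rightarrow> (int \<times> int) set" where
  "rows_upto r = {(u, v). u \<le> r}"

text \<open>
  The part of the lagged past of (i,j) that increases with j: complete rows up to i - a, and row i up
  to column j - a. The lagged past itself also contains entries of the rows between i - a and i,
  except those near column j, and this destroys the nesting.
\<close>

definition nested_past :: "nat \<Rightarrow> int \<Rightarrow> int \<Rightarrow> (int \<times> int) set" where
  "nested_past a i j = {(u, v). u \<le> i - int a \<or> (u = i \<and> v \<le> j - int a)}"

lemma rows_subset_nested: "r \<le> i - int a \<Longrightarrow> rows_upto r \<subseteq> nested_past a i j"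
  by (auto simp: rows_upto_def nested_past_def)

lemma nested_subset_past: "a \<ge> 1 \<Longrightarrow> nested_past a i j \<subseteq> past_indices a i j"
  by (auto simp: nested_past_def past_indices_def lex_le_def)

lemma past_subset_rows: "past_indices a i j \<subseteq> rows_upto i"
  by (auto simp: past_indices_def lex_le_def rows_upto_def)

lemma nested_subset_rows: "nested_past a i j \<subseteq> rows_upto i"
  by (auto simp: nested_past_def rows_upto_def)

lemma rows_subset_past1: "r < i \<Longrightarrow> rows_upto r \<subseteq> past_indices 1 i j"
  by (auto simp: past_indices_def lex_le_def rows_upto_def)

lemma past1_mono: "k < j \<Longrightarrow> past_indices 1 i k \<subseteq> past_indices 1 i j"
  by (auto simp: past_indices_def lex_le_def)

lemma nested_mono: "k \<le> j \<Longrightarrow> nested_past a i k \<subseteq> nested_past a i j"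
  by (auto simp: nested_past_def)

locale martingale_array = prob_space M
  for M :: "'a measure" +
  fixes X :: "int \<Rightarrow> int \<Rightarrow> 'a \<Rightarrow> real" and h :: "real \<Rightarrow> real" and C :: real
  assumes X_measurable [measurable]: "\<And>i j. X i j \<in> borel_measurable M"
    and X_square_integrable: "\<And>i j. integrable M (\<lambda>\<omega>. (X i j \<omega>)\<^sup>2)"
    and X_martingale: "\<And>i j. 1 \<le> j \<Longrightarrow> j \<le> i \<Longrightarrow>
      AE \<omega> in M. real_cond_exp M (past_algebra M X 1 i j) (X i j) \<omega> = 0"
    and h_ge_1: "\<And>x. 0 \<le> x \<Longrightarrow> 1 \<le> h x"
    and h_mono: "mono_on {0..} h"
    and X_moment: "\<And>i j. (\<integral>\<^sup>+\<omega>. ennreal ((X i j \<omega>)\<^sup>2 * h \<bar>X i j \<omega>\<bar>) \<partial>M) \<le> ennreal C"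
    and C_pos: "C > 0"
begin

abbreviation Alg :: "(int \<times> int) set \<Rightarrow> 'a measure" where
  "Alg I \<equiv> index_algebra M X I"

lemma space_Alg [simp]: "space (Alg I) = space M"
  by (simp add: index_algebra_def space_measure_of_conv)

lemma sets_Alg: "sets (Alg I) = sigma_sets (space M)
     {X u v -` S \<inter> space M | u v S. (u, v) \<in> I \<and> v \<le> u \<and> S \<in> sets borel}"
  unfolding index_algebra_def by (rule sets_measure_of) auto

lemma Alg_subalgebra: "subalgebra M (Alg I)"
  unfolding subalgebra_def sets_Alg
  by (auto intro!: sets.sigma_sets_subset measurable_sets[OF X_measurable])

lemma X_measurable_Alg: "(u, v) \<in> I \<Longrightarrow> v \<le> u \<Longrightarrow> X u v \<in> borel_measurable (Alg I)"
  by (rule measurableI) (auto simp: sets_Alg)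

lemma Alg_mono: "I \<subseteq> J \<Longrightarrow> subalgebra (Alg J) (Alg I)"
  unfolding subalgebra_def sets_Alg by (auto intro!: sigma_sets_mono')

lemma measurable_Alg_mono: "f \<in> borel_measurable (Alg I) \<Longrightarrow> I \<subseteq> J \<Longrightarrow> f \<in> borel_measurable (Alg J)"
  using measurable_from_subalg[OF Alg_mono] .

lemma measurable_Alg_M: "f \<in> borel_measurable (Alg I) \<Longrightarrow> f \<in> borel_measurable M"
  using measurable_from_subalg[OF Alg_subalgebra] .

lemma X_integrable: "integrable M (X i j)"
  by (rule square_integrable_imp_integrable[OF X_measurable X_square_integrable])

lemma X_second_moment: "(\<integral>\<omega>. (X i j \<omega>)\<^sup>2 \<partial>M) \<le> C"
proof -
  have "ennreal (\<integral>\<omega>. (X i j \<omega>)\<^sup>2 \<partial>M) = (\<integral>\<^sup>+\<omega>. ennreal ((X i j \<omega>)\<^sup>2) \<partial>M)"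
    using X_square_integrable by (intro nn_integral_eq_integral[symmetric]) auto
  also have "\<dots> \<le> (\<integral>\<^sup>+\<omega>. ennreal ((X i j \<omega>)\<^sup>2 * h \<bar>X i j \<omega>\<bar>) \<partial>M)"
    by (intro nn_integral_mono ennreal_leI) (simp add: mult_le_cancel_left1 h_ge_1)
  also have "\<dots> \<le> ennreal C" by (rule X_moment)
  finally show ?thesis using C_pos by (simp add: ennreal_le_iff)
qed

definition Xlarge :: "real \<Rightarrow> int \<Rightarrow> int \<Rightarrow> 'a \<Rightarrow> real" where
  "Xlarge \<tau> i j \<omega> = (if \<bar>X i j \<omega>\<bar> \<le> \<tau> then 0 else X i j \<omega>)"

definition Xsmall :: "real \<Rightarrow> int \<Rightarrow> int \<Rightarrow> 'a \<Rightarrow> real" where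
  "Xsmall \<tau> i j \<omega> = (if \<bar>X i j \<omega>\<bar> \<le> \<tau> then X i j \<omega> else 0)"

lemma Xlarge_measurable [measurable]: "Xlarge \<tau> i j \<in> borel_measurable M"
  unfolding Xlarge_def by measurable

lemma Xsmall_measurable [measurable]: "Xsmall \<tau> i j \<in> borel_measurable M"
  unfolding Xsmall_def by measurable

lemma Xsmall_bound: "\<tau> \<ge> 0 \<Longrightarrow> \<bar>Xsmall \<tau> i j \<omega>\<bar> \<le> \<tau>"
  by (simp add: Xsmall_def)

lemma Xlarge_square_integrable: "integrable M (\<lambda>\<omega>. (Xlarge \<tau> i j \<omega>)\<^sup>2)"
  by (rule Bochner_Integration.integrable_bound[OF X_square_integrable[of i j]])
    (auto simp: Xlarge_def)

lemma Xlarge_integrable: "integrable M (Xlarge \<tau> i j)"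
  by (rule square_integrable_imp_integrable[OF Xlarge_measurable Xlarge_square_integrable])

lemma Xlarge_second_moment:
  assumes "\<tau> \<ge> 0"
  shows "(\<integral>\<omega>. (Xlarge \<tau> i j \<omega>)\<^sup>2 \<partial>M) \<le> C / h \<tau>"
proof -
  have h0: "h \<tau> > 0" using h_ge_1[OF assms] by simp
  have "ennreal (\<integral>\<omega>. (Xlarge \<tau> i j \<omega>)\<^sup>2 * h \<tau> \<partial>M) = (\<integral>\<^sup>+\<omega>. ennreal ((Xlarge \<tau> i j \<omega>)\<^sup>2 * h \<tau>) \<partial>M)"
    using Xlarge_square_integrable h0 by (intro nn_integral_eq_integral[symmetric]) auto
  also have "\<dots> \<le> (\<integral>\<^sup>+\<omega>. ennreal ((X i j \<omega>)\<^sup>2 * h \<bar>X i j \<omega>\<bar>) \<partial>M)"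
  proof (intro nn_integral_mono ennreal_leI)
    fix \<omega>
    have "h \<tau> \<le> h \<bar>X i j \<omega>\<bar>" if "\<not> \<bar>X i j \<omega>\<bar> \<le> \<tau>"
      using that assms by (intro mono_onD[OF h_mono]) auto
    then show "(Xlarge \<tau> i j \<omega>)\<^sup>2 * h \<tau> \<le> (X i j \<omega>)\<^sup>2 * h \<bar>X i j \<omega>\<bar>"
      using h_ge_1[of "\<bar>X i j \<omega>\<bar>"] by (auto simp: Xlarge_def intro!: mult_left_mono)
  qed
  also have "\<dots> \<le> ennreal C" by (rule X_moment)
  finally have "(\<integral>\<omega>. (Xlarge \<tau> i j \<omega>)\<^sup>2 * h \<tau> \<partial>M) \<le> C" using C_pos by (simp add: ennreal_le_iff)
  then show ?thesis using h0 by (simp add: field_simps)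
qed

text \<open>
  On the set where it is not 0, the large part exceeds \<tau>; this trades one factor \<tau> against the
  second moment.
\<close>

lemma Xlarge_first_moment:
  assumes "\<tau> \<ge> 0"
  shows "\<tau> * (\<integral>\<omega>. \<bar>Xlarge \<tau> i j \<omega>\<bar> \<partial>M) \<le> C / h \<tau>"
proof -
  have "\<tau> * (\<integral>\<omega>. \<bar>Xlarge \<tau> i j \<omega>\<bar> \<partial>M) = (\<integral>\<omega>. \<tau> * \<bar>Xlarge \<tau> i j \<omega>\<bar> \<partial>M)" by simp
  also have "\<dots> \<le> (\<integral>\<omega>. (Xlarge \<tau> i j \<omega>)\<^sup>2 \<partial>M)"
  proof (intro integral_mono)
    show "integrable M (\<lambda>\<omega>. \<tau> * \<bar>Xlarge \<tau> i j \<omega>\<bar>)" using Xlarge_integrable by simp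
    show "integrable M (\<lambda>\<omega>. (Xlarge \<tau> i j \<omega>)\<^sup>2)" by (rule Xlarge_square_integrable)
    fix \<omega>
    have "\<tau> * \<bar>Xlarge \<tau> i j \<omega>\<bar> \<le> \<bar>Xlarge \<tau> i j \<omega>\<bar> * \<bar>Xlarge \<tau> i j \<omega>\<bar>"
      using mult_right_mono[of \<tau> "\<bar>X i j \<omega>\<bar>" "\<bar>X i j \<omega>\<bar>"] by (simp add: Xlarge_def)
    then show "\<tau> * \<bar>Xlarge \<tau> i j \<omega>\<bar> \<le> (Xlarge \<tau> i j \<omega>)\<^sup>2" by (simp add: power2_eq_square)
  qed
  also have "\<dots> \<le> C / h \<tau>" by (rule Xlarge_second_moment[OF assms])
  finally show ?thesis .
qed

text \<open>
  The conditional mean of the truncated entry; subtracting it restores the martingale property.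
\<close>

definition drift :: "real \<Rightarrow> int \<Rightarrow> int \<Rightarrow> 'a \<Rightarrow> real" where
  "drift \<tau> i j = clipped_cond_exp \<tau> (Alg (past_indices 1 i j)) (Xsmall \<tau> i j)"

definition Xtrunc :: "real \<Rightarrow> int \<Rightarrow> int \<Rightarrow> 'a \<Rightarrow> real" where
  "Xtrunc \<tau> i j \<omega> = Xsmall \<tau> i j \<omega> - drift \<tau> i j \<omega>"

lemma drift_measurable [measurable]: "drift \<tau> i j \<in> borel_measurable M"
  unfolding drift_def by (rule clipped_cond_exp_measurable[OF Alg_subalgebra])

lemma Xtrunc_measurable [measurable]: "Xtrunc \<tau> i j \<in> borel_measurable M"
  unfolding Xtrunc_def by measurable

lemma drift_bound: "\<tau> \<ge> 0 \<Longrightarrow> \<bar>drift \<tau> i j \<omega>\<bar> \<le> \<tau>"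
  unfolding drift_def by (rule clipped_cond_exp_bound)

lemma Xtrunc_bound: "\<tau> \<ge> 0 \<Longrightarrow> \<bar>Xtrunc \<tau> i j \<omega>\<bar> \<le> 2 * \<tau>"
  using drift_bound[of \<tau> i j \<omega>] Xsmall_bound[of \<tau> i j \<omega>] by (simp add: Xtrunc_def)

lemma Xsmall_measurable_Alg: "(i, j) \<in> I \<Longrightarrow> j \<le> i \<Longrightarrow> Xsmall \<tau> i j \<in> borel_measurable (Alg I)"
  using X_measurable_Alg[of i j I] unfolding Xsmall_def by measurable

lemma Xtrunc_measurable_Alg:
  assumes "(i, j) \<in> I" "past_indices 1 i j \<subseteq> I" "j \<le> i"
  shows "Xtrunc \<tau> i j \<in> borel_measurable (Alg I)"
proof -
  have "drift \<tau> i j \<in> borel_measurable (Alg I)"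
    unfolding drift_def by (rule measurable_Alg_mono[OF clipped_cond_exp_measurable_sub assms(2)])
  then show ?thesis
    using Xsmall_measurable_Alg[OF assms(1,3), of \<tau>] unfolding Xtrunc_def by measurable
qed

lemma Xtrunc_orthogonal:
  assumes "\<tau> \<ge> 0" and g: "g \<in> borel_measurable (Alg (past_indices 1 i j))" "\<And>\<omega>. \<bar>g \<omega>\<bar> \<le> L"
  shows "(\<integral>\<omega>. g \<omega> * Xtrunc \<tau> i j \<omega> \<partial>M) = 0"
proof -
  note gM [measurable] = measurable_Alg_M[OF g(1)]
  have i: "integrable M (\<lambda>\<omega>. g \<omega> * f \<omega>)" if [measurable]: "f \<in> borel_measurable M" and "\<And>\<omega>. \<bar>f \<omega>\<bar> \<le> \<tau>" for f
    by (rule bounded_integrable[where K = "L * \<tau>"])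
      (auto simp: abs_mult intro!: mult_mono that g order_trans[OF abs_ge_zero g(2)])
  have "(\<integral>\<omega>. g \<omega> * Xtrunc \<tau> i j \<omega> \<partial>M) =
      (\<integral>\<omega>. g \<omega> * Xsmall \<tau> i j \<omega> \<partial>M) - (\<integral>\<omega>. g \<omega> * drift \<tau> i j \<omega> \<partial>M)"
    unfolding Xtrunc_def right_diff_distrib
    by (intro Bochner_Integration.integral_diff i Xsmall_bound drift_bound assms) measurable
  also have "(\<integral>\<omega>. g \<omega> * drift \<tau> i j \<omega> \<partial>M) = (\<integral>\<omega>. g \<omega> * Xsmall \<tau> i j \<omega> \<partial>M)"
    unfolding drift_def
    by (rule clipped_cond_exp_integral[OF Alg_subalgebra _ _ g]) (auto intro: Xsmall_bound assms)
  finally show ?thesis by simp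
qed

text \<open>
  The entry has conditional mean 0, so the conditional means of its small and its large part are
  opposite, and the latter is small in mean.
\<close>

lemma drift_first_moment:
  assumes "\<tau> \<ge> 0" "1 \<le> j" "j \<le> i"
  shows "\<tau> * (\<integral>\<omega>. \<bar>drift \<tau> i j \<omega>\<bar> \<partial>M) \<le> C / h \<tau>"
proof -
  let ?F = "Alg (past_indices 1 i j)"
  interpret sigma_finite_subalgebra M ?F by (rule subalgebra_sigma_finite[OF Alg_subalgebra])
  have "AE \<omega> in M. real_cond_exp M ?F (\<lambda>\<omega>. X i j \<omega> - Xlarge \<tau> i j \<omega>) \<omega>
      = real_cond_exp M ?F (X i j) \<omega> - real_cond_exp M ?F (Xlarge \<tau> i j) \<omega>"
    by (rule real_cond_exp_diff[OF X_integrable Xlarge_integrable])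
  moreover have "(\<lambda>\<omega>. X i j \<omega> - Xlarge \<tau> i j \<omega>) = Xsmall \<tau> i j"
    by (auto simp: Xlarge_def Xsmall_def)
  moreover have "AE \<omega> in M. drift \<tau> i j \<omega> = real_cond_exp M ?F (Xsmall \<tau> i j) \<omega>"
    unfolding drift_def by (rule clipped_cond_exp_AE[OF Alg_subalgebra]) (auto intro: Xsmall_bound assms)
  ultimately have ae: "AE \<omega> in M. \<bar>drift \<tau> i j \<omega>\<bar> = \<bar>real_cond_exp M ?F (Xlarge \<tau> i j) \<omega>\<bar>"
    using X_martingale[OF assms(2,3)] unfolding past_algebra_eq by (auto elim!: eventually_elim2)
  have "(\<integral>\<omega>. \<bar>drift \<tau> i j \<omega>\<bar> \<partial>M) = (\<integral>\<omega>. \<bar>real_cond_exp M ?F (Xlarge \<tau> i j) \<omega>\<bar> \<partial>M)"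
    using ae measurable_from_subalg[OF Alg_subalgebra borel_measurable_cond_exp]
    by (intro integral_cong_AE) auto
  also have "\<dots> \<le> (\<integral>\<omega>. \<bar>Xlarge \<tau> i j \<omega>\<bar> \<partial>M)"
    by (rule real_cond_exp_abs_integral_le[OF Alg_subalgebra Xlarge_integrable])
  finally have "\<tau> * (\<integral>\<omega>. \<bar>drift \<tau> i j \<omega>\<bar> \<partial>M) \<le> \<tau> * (\<integral>\<omega>. \<bar>Xlarge \<tau> i j \<omega>\<bar> \<partial>M)"
    using assms(1) by (rule mult_left_mono)
  also have "\<dots> \<le> C / h \<tau>" by (rule Xlarge_first_moment[OF assms(1)])
  finally show ?thesis .
qed

lemma drift_integrable: "\<tau> \<ge> 0 \<Longrightarrow> integrable M (drift \<tau> i j)"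
  by (rule bounded_integrable[OF drift_measurable drift_bound])

text \<open>
  The lagged conditional second moments are controlled for the small part itself, which depends on a
  single entry; the recentred variable depends on the whole past. The bound allows the passage
  from one to the other.
\<close>

lemma square_recentring:
  assumes "\<tau> \<ge> 0" "1 \<le> j" "j \<le> i"
  shows "(\<integral>\<omega>. \<bar>(Xtrunc \<tau> i j \<omega>)\<^sup>2 - (Xsmall \<tau> i j \<omega>)\<^sup>2\<bar> \<partial>M) \<le> 3 * C / h \<tau>"
proof -
  have le: "\<bar>(Xtrunc \<tau> i j \<omega>)\<^sup>2 - (Xsmall \<tau> i j \<omega>)\<^sup>2\<bar> \<le> 3 * \<tau> * \<bar>drift \<tau> i j \<omega>\<bar>" for \<omega>
  proof -
    have "(Xtrunc \<tau> i j \<omega>)\<^sup>2 - (Xsmall \<tau> i j \<omega>)\<^sup>2 = (drift \<tau> i j \<omega> - 2 * Xsmall \<tau> i j \<omega>) * drift \<tau> i j \<omega>"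
      by (simp add: Xtrunc_def power2_eq_square algebra_simps)
    moreover have "\<bar>drift \<tau> i j \<omega> - 2 * Xsmall \<tau> i j \<omega>\<bar> \<le> 3 * \<tau>"
      using drift_bound[OF assms(1), of i j \<omega>] Xsmall_bound[OF assms(1), of i j \<omega>] by linarith
    ultimately show ?thesis by (simp add: abs_mult mult_right_mono)
  qed
  have "(\<integral>\<omega>. \<bar>(Xtrunc \<tau> i j \<omega>)\<^sup>2 - (Xsmall \<tau> i j \<omega>)\<^sup>2\<bar> \<partial>M) \<le> (\<integral>\<omega>. 3 * \<tau> * \<bar>drift \<tau> i j \<omega>\<bar> \<partial>M)"
  proof (rule integral_mono[OF _ _ le])
    show *: "integrable M (\<lambda>\<omega>. 3 * \<tau> * \<bar>drift \<tau> i j \<omega>\<bar>)" using drift_integrable[OF assms(1)] by simp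
    show "integrable M (\<lambda>\<omega>. \<bar>(Xtrunc \<tau> i j \<omega>)\<^sup>2 - (Xsmall \<tau> i j \<omega>)\<^sup>2\<bar>)"
      by (rule Bochner_Integration.integrable_bound[OF *]) (use le assms(1) in \<open>auto simp: abs_mult\<close>)
  qed
  also have "\<dots> = 3 * (\<tau> * (\<integral>\<omega>. \<bar>drift \<tau> i j \<omega>\<bar> \<partial>M))" by simp
  also have "\<dots> \<le> 3 * (C / h \<tau>)" by (intro mult_left_mono drift_first_moment assms) auto
  finally show ?thesis by simp
qed

lemma truncation_error:
  assumes "\<tau> \<ge> 0" "1 \<le> j" "j \<le> i"
  shows "integrable M (\<lambda>\<omega>. (X i j \<omega> - Xtrunc \<tau> i j \<omega>)\<^sup>2)"
    and "(\<integral>\<omega>. (X i j \<omega> - Xtrunc \<tau> i j \<omega>)\<^sup>2 \<partial>M) \<le> 4 * C / h \<tau>"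
proof -
  have le: "(X i j \<omega> - Xtrunc \<tau> i j \<omega>)\<^sup>2 \<le> 2 * (Xlarge \<tau> i j \<omega>)\<^sup>2 + 2 * (\<tau> * \<bar>drift \<tau> i j \<omega>\<bar>)" for \<omega>
  proof -
    have eq: "X i j \<omega> - Xtrunc \<tau> i j \<omega> = Xlarge \<tau> i j \<omega> + drift \<tau> i j \<omega>"
      by (simp add: Xtrunc_def Xlarge_def Xsmall_def)
    have "(Xlarge \<tau> i j \<omega> + drift \<tau> i j \<omega>)\<^sup>2 \<le> 2 * (Xlarge \<tau> i j \<omega>)\<^sup>2 + 2 * (drift \<tau> i j \<omega>)\<^sup>2"
      using sum_squares_bound[of "Xlarge \<tau> i j \<omega>" "drift \<tau> i j \<omega>"] by (simp add: power2_sum)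
    moreover have "(drift \<tau> i j \<omega>)\<^sup>2 \<le> \<tau> * \<bar>drift \<tau> i j \<omega>\<bar>"
      using mult_right_mono[OF drift_bound[OF assms(1), of i j \<omega>], of "\<bar>drift \<tau> i j \<omega>\<bar>"]
      by (simp add: power2_eq_square)
    ultimately show ?thesis unfolding eq by linarith
  qed
  have *: "integrable M (\<lambda>\<omega>. 2 * (Xlarge \<tau> i j \<omega>)\<^sup>2 + 2 * (\<tau> * \<bar>drift \<tau> i j \<omega>\<bar>))"
    using drift_integrable[OF assms(1)] Xlarge_square_integrable by simp
  show i: "integrable M (\<lambda>\<omega>. (X i j \<omega> - Xtrunc \<tau> i j \<omega>)\<^sup>2)"
    by (rule Bochner_Integration.integrable_bound[OF *]) (use le assms(1) in \<open>auto simp: abs_mult\<close>)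
  have "(\<integral>\<omega>. (X i j \<omega> - Xtrunc \<tau> i j \<omega>)\<^sup>2 \<partial>M)
      \<le> (\<integral>\<omega>. 2 * (Xlarge \<tau> i j \<omega>)\<^sup>2 + 2 * (\<tau> * \<bar>drift \<tau> i j \<omega>\<bar>) \<partial>M)"
    by (rule integral_mono[OF i * le])
  also have "\<dots> = 2 * (\<integral>\<omega>. (Xlarge \<tau> i j \<omega>)\<^sup>2 \<partial>M) + 2 * (\<tau> * (\<integral>\<omega>. \<bar>drift \<tau> i j \<omega>\<bar> \<partial>M))"
    using drift_integrable[OF assms(1)] Xlarge_square_integrable by simp
  also have "\<dots> \<le> 2 * (C / h \<tau>) + 2 * (C / h \<tau>)"
    by (intro add_mono mult_left_mono drift_first_moment Xlarge_second_moment assms) auto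
  finally show "(\<integral>\<omega>. (X i j \<omega> - Xtrunc \<tau> i j \<omega>)\<^sup>2 \<partial>M) \<le> 4 * C / h \<tau>" by simp
qed

end

section \<open>Quadratic forms in one row\<close>

lemma symmetric_double_sum:
  fixes f :: "nat \<Rightarrow> nat \<Rightarrow> real"
  assumes "\<And>j k. f j k = f k j"
  shows "(\<Sum>j<i. \<Sum>k<i. f j k) = (\<Sum>j<i. f j j) + 2 * (\<Sum>j<i. \<Sum>k<j. f j k)"
proof (induction i)
  case (Suc i)
  have "(\<Sum>j<Suc i. \<Sum>k<Suc i. f j k) = (\<Sum>j<i. \<Sum>k<i. f j k) + (\<Sum>j<i. f j i) + (\<Sum>k<i. f i k) + f i i"
    by (simp add: sum.distrib)
  also have "(\<Sum>j<i. f j i) = (\<Sum>k<i. f i k)" using assms by simp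
  finally show ?case using Suc by simp
qed simp

context martingale_array
begin

definition trunc_entry :: "real \<Rightarrow> nat \<Rightarrow> nat \<Rightarrow> 'a \<Rightarrow> real" where
  "trunc_entry \<tau> i j = Xtrunc \<tau> (int i + 1) (int j + 1)"

definition small_square :: "real \<Rightarrow> nat \<Rightarrow> nat \<Rightarrow> 'a \<Rightarrow> real" where
  "small_square \<tau> i j \<omega> = (Xsmall \<tau> (int i + 1) (int j + 1) \<omega>)\<^sup>2"

definition predicted_square :: "real \<Rightarrow> nat \<Rightarrow> nat \<Rightarrow> nat \<Rightarrow> 'a \<Rightarrow> real" where
  "predicted_square \<tau> a i j = clipped_cond_exp (\<tau>\<^sup>2) (Alg (nested_past a (int i + 1) (int j + 1))) (small_square \<tau> i j)"

lemma trunc_entry_measurable [measurable]: "trunc_entry \<tau> i j \<in> borel_measurable M"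
  unfolding trunc_entry_def by measurable

lemma small_square_measurable [measurable]: "small_square \<tau> i j \<in> borel_measurable M"
  unfolding small_square_def by measurable

lemma predicted_square_measurable [measurable]: "predicted_square \<tau> a i j \<in> borel_measurable M"
  unfolding predicted_square_def by (rule clipped_cond_exp_measurable[OF Alg_subalgebra])

lemma trunc_entry_bound: "\<tau> \<ge> 0 \<Longrightarrow> \<bar>trunc_entry \<tau> i j \<omega>\<bar> \<le> 2 * \<tau>"
  unfolding trunc_entry_def by (rule Xtrunc_bound)

lemma small_square_bound: "\<tau> \<ge> 0 \<Longrightarrow> \<bar>small_square \<tau> i j \<omega>\<bar> \<le> \<tau>\<^sup>2"
  using Xsmall_bound[of \<tau> "int i + 1" "int j + 1" \<omega>]
  by (simp add: small_square_def abs_le_square_iff[symmetric])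

lemma predicted_square_bound: "\<bar>predicted_square \<tau> a i j \<omega>\<bar> \<le> \<tau>\<^sup>2"
  unfolding predicted_square_def by (rule clipped_cond_exp_bound) simp

lemma trunc_entry_square_bound: "\<tau> \<ge> 0 \<Longrightarrow> (trunc_entry \<tau> i j \<omega>)\<^sup>2 \<le> 4 * \<tau>\<^sup>2"
proof -
  assume "\<tau> \<ge> 0"
  from trunc_entry_bound[OF this, of i j \<omega>] have "\<bar>trunc_entry \<tau> i j \<omega>\<bar>\<^sup>2 \<le> (2 * \<tau>)\<^sup>2" by (intro power_mono) auto
  then show ?thesis by (simp add: power_mult_distrib)
qed

lemma trunc_entry_measurable_past:
  assumes "k < j" "j \<le> i"
  shows "trunc_entry \<tau> i k \<in> borel_measurable (Alg (past_indices 1 (int i + 1) (int j + 1)))"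
  unfolding trunc_entry_def
proof (rule Xtrunc_measurable_Alg)
  show "(int i + 1, int k + 1) \<in> past_indices 1 (int i + 1) (int j + 1)"
    using assms by (simp add: past_indices_def lex_le_def)
  show "past_indices 1 (int i + 1) (int k + 1) \<subseteq> past_indices 1 (int i + 1) (int j + 1)"
    using assms by (intro past1_mono) simp
qed (use assms in simp)

lemma rows_measurable_past:
  "f \<in> borel_measurable (Alg (rows_upto (int i))) \<Longrightarrow>
    f \<in> borel_measurable (Alg (past_indices 1 (int i + 1) (int j + 1)))"
  by (erule measurable_Alg_mono) (rule rows_subset_past1, simp)

lemma square_integral_le:
  fixes f g :: "'a \<Rightarrow> real"
  assumes f: "f \<in> borel_measurable M" "\<And>\<omega>. (f \<omega>)\<^sup>2 \<le> B"
    and g: "g \<in> borel_measurable M" "\<And>\<omega>. \<bar>g \<omega>\<bar> \<le> L"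
  shows "(\<integral>\<omega>. (f \<omega> * g \<omega>)\<^sup>2 \<partial>M) \<le> B * (\<integral>\<omega>. (g \<omega>)\<^sup>2 \<partial>M)"
proof -
  have g2: "(g \<omega>)\<^sup>2 \<le> L\<^sup>2" for \<omega> using g(2)[of \<omega>] by (simp add: abs_le_square_iff[symmetric])
  have i: "integrable M (\<lambda>\<omega>. B * (g \<omega>)\<^sup>2)"
    using g(1) g2 by (intro integrable_mult_right bounded_integrable[where K = "L\<^sup>2"]) auto
  have le: "(f \<omega> * g \<omega>)\<^sup>2 \<le> B * (g \<omega>)\<^sup>2" for \<omega>
    unfolding power_mult_distrib by (intro mult_right_mono f) simp
  have "(\<integral>\<omega>. (f \<omega> * g \<omega>)\<^sup>2 \<partial>M) \<le> (\<integral>\<omega>. B * (g \<omega>)\<^sup>2 \<partial>M)"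
  proof (rule integral_mono[OF _ i le])
    show "integrable M (\<lambda>\<omega>. (f \<omega> * g \<omega>)\<^sup>2)"
      by (rule Bochner_Integration.integrable_bound[OF i]) (use f(1) g(1) le in \<open>auto intro!: order_trans[OF le]\<close>)
  qed
  then show ?thesis by simp
qed

text \<open>
  Q is determined by the earlier rows, so both the sum over j and, for each j, the inner sum over k
  are martingale transforms of the recentred row, and orthogonality applies twice.
\<close>

lemma off_diagonal_fluctuation:
  fixes Q :: "'a \<Rightarrow> nat \<Rightarrow> nat \<Rightarrow> real"
  assumes tau: "\<tau> \<ge> 0" and n: "n \<ge> 1" "i \<le> n" and K: "K \<ge> 1"
    and Qm: "\<And>j k. (\<lambda>\<omega>. Q \<omega> j k) \<in> borel_measurable (Alg (rows_upto (int i)))"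
    and Qf: "\<And>\<omega>. (\<Sum>j<i. \<Sum>k<i. (Q \<omega> j k)\<^sup>2) \<le> K * real n"
  defines "S \<equiv> \<lambda>\<omega>. \<Sum>j<i. trunc_entry \<tau> i j \<omega> * (\<Sum>k<j. trunc_entry \<tau> i k \<omega> * Q \<omega> j k)"
  shows "integrable M (\<lambda>\<omega>. \<bar>S \<omega>\<bar>)" and "(\<integral>\<omega>. \<bar>S \<omega>\<bar> \<partial>M) \<le> 8 * K * \<tau>\<^sup>2 * sqrt (real n)"
proof -
  have QM [measurable]: "(\<lambda>\<omega>. Q \<omega> j k) \<in> borel_measurable M" for j k
    by (rule measurable_Alg_M[OF Qm])
  \<comment> \<open>a crude bound for single entries, good enough for integrability\<close>
  define B where "B = 1 + K * real n"
  have B0: "B \<ge> 0" using K by (simp add: B_def)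
  have Qb: "\<bar>Q \<omega> j k\<bar> \<le> B" if "j < i" "k < i" for \<omega> j k
  proof -
    have "(Q \<omega> j k)\<^sup>2 \<le> (\<Sum>k<i. (Q \<omega> j k)\<^sup>2)" using that by (intro member_le_sum) auto
    also have "\<dots> \<le> (\<Sum>j<i. \<Sum>k<i. (Q \<omega> j k)\<^sup>2)"
      using that by (intro member_le_sum[where f = "\<lambda>j. \<Sum>k<i. (Q \<omega> j k)\<^sup>2"] sum_nonneg) auto
    finally have "(Q \<omega> j k)\<^sup>2 \<le> K * real n" using Qf[of \<omega>] by linarith
    moreover have "0 \<le> (\<bar>Q \<omega> j k\<bar> - 1)\<^sup>2" by simp
    then have "2 * \<bar>Q \<omega> j k\<bar> \<le> 1 + (Q \<omega> j k)\<^sup>2" by (simp add: power2_diff)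
    ultimately show ?thesis using B0 unfolding B_def by linarith
  qed
  define c where "c j \<omega> = (\<Sum>k<j. trunc_entry \<tau> i k \<omega> * Q \<omega> j k)" for j \<omega>
  define D where "D = real n * (2 * \<tau> * B)"
  have D0: "D \<ge> 0" using tau B0 by (simp add: D_def)
  have xQ: "\<bar>trunc_entry \<tau> i k \<omega> * Q \<omega> j k\<bar> \<le> 2 * \<tau> * B" if "j < i" "k < i" for j k \<omega>
    unfolding abs_mult using that tau B0 by (intro mult_mono trunc_entry_bound Qb) auto
  have cb: "\<bar>c j \<omega>\<bar> \<le> D" if "j < i" for j \<omega>
  proof -
    have "\<bar>c j \<omega>\<bar> \<le> (\<Sum>k<j. 2 * \<tau> * B)"
      unfolding c_def by (rule order_trans[OF sum_abs], rule sum_mono) (use xQ that in auto)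
    also have "\<dots> \<le> D" using that n tau B0 unfolding D_def by (simp add: mult_right_mono)
    finally show ?thesis .
  qed
  have cM [measurable]: "c j \<in> borel_measurable M" for j unfolding c_def by measurable
  have c_past: "c j \<in> borel_measurable (Alg (past_indices 1 (int i + 1) (int k + 1)))" if "j \<le> k" "k \<le> i" for j k
    unfolding c_def
    by (intro borel_measurable_sum borel_measurable_times trunc_entry_measurable_past rows_measurable_past Qm)
      (use that in auto)
  have c2: "(\<integral>\<omega>. (c j \<omega>)\<^sup>2 \<partial>M) \<le> 8 * \<tau>\<^sup>2 * (\<Sum>k<j. \<integral>\<omega>. (Q \<omega> j k)\<^sup>2 \<partial>M)" if j: "j < i" for j
  proof -
    have "(\<integral>\<omega>. (c j \<omega>)\<^sup>2 \<partial>M) \<le> 2 * real 1 * (\<Sum>k<j. \<integral>\<omega>. (trunc_entry \<tau> i k \<omega> * Q \<omega> j k)\<^sup>2 \<partial>M)"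
      unfolding c_def
    proof (rule lagged_orthogonal_second_moment)
      fix k l assume kl: "k + 1 \<le> l" "l < j"
      have "(\<integral>\<omega>. (trunc_entry \<tau> i k \<omega> * Q \<omega> j k * Q \<omega> j l) * Xtrunc \<tau> (int i + 1) (int l + 1) \<omega> \<partial>M) = 0"
      proof (rule Xtrunc_orthogonal[OF tau])
        show "(\<lambda>\<omega>. trunc_entry \<tau> i k \<omega> * Q \<omega> j k * Q \<omega> j l) \<in> borel_measurable (Alg (past_indices 1 (int i + 1) (int l + 1)))"
          using kl j by (intro borel_measurable_times trunc_entry_measurable_past rows_measurable_past Qm) auto
        show "\<bar>trunc_entry \<tau> i k \<omega> * Q \<omega> j k * Q \<omega> j l\<bar> \<le> 2 * \<tau> * B * B" for \<omega>
          unfolding abs_mult[of _ "Q \<omega> j l"] using kl j tau B0 by (intro mult_mono xQ Qb) auto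
      qed
      then show "(\<integral>\<omega>. trunc_entry \<tau> i k \<omega> * Q \<omega> j k * (trunc_entry \<tau> i l \<omega> * Q \<omega> j l) \<partial>M) = 0"
        by (simp add: trunc_entry_def mult_ac)
    next
      show "\<bar>trunc_entry \<tau> i k \<omega> * Q \<omega> j k\<bar> \<le> 2 * \<tau> * B" if "k < j" for k \<omega> using xQ that j by simp
    qed measurable
    also have "\<dots> \<le> 2 * real 1 * (\<Sum>k<j. 4 * \<tau>\<^sup>2 * (\<integral>\<omega>. (Q \<omega> j k)\<^sup>2 \<partial>M))"
      by (intro mult_left_mono sum_mono square_integral_le[where L = B] trunc_entry_square_bound tau Qb)
        (use j in auto)
    finally show ?thesis by (simp add: sum_distrib_left mult.assoc)
  qed
  have S2: "(\<integral>\<omega>. (S \<omega>)\<^sup>2 \<partial>M) \<le> 64 * \<tau>^4 * (K * real n)"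
  proof -
    have "(\<integral>\<omega>. (S \<omega>)\<^sup>2 \<partial>M) \<le> 2 * real 1 * (\<Sum>j<i. \<integral>\<omega>. (trunc_entry \<tau> i j \<omega> * c j \<omega>)\<^sup>2 \<partial>M)"
      unfolding S_def c_def[symmetric]
    proof (rule lagged_orthogonal_second_moment)
      fix k l assume kl: "k + 1 \<le> l" "l < i"
      have "(\<integral>\<omega>. (trunc_entry \<tau> i k \<omega> * c k \<omega> * c l \<omega>) * Xtrunc \<tau> (int i + 1) (int l + 1) \<omega> \<partial>M) = 0"
      proof (rule Xtrunc_orthogonal[OF tau])
        show "(\<lambda>\<omega>. trunc_entry \<tau> i k \<omega> * c k \<omega> * c l \<omega>) \<in> borel_measurable (Alg (past_indices 1 (int i + 1) (int l + 1)))"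
          using kl by (intro borel_measurable_times trunc_entry_measurable_past c_past) auto
        show "\<bar>trunc_entry \<tau> i k \<omega> * c k \<omega> * c l \<omega>\<bar> \<le> 2 * \<tau> * D * D" for \<omega>
          unfolding abs_mult using kl tau D0 by (intro mult_mono trunc_entry_bound cb mult_nonneg_nonneg) auto
      qed
      then show "(\<integral>\<omega>. trunc_entry \<tau> i k \<omega> * c k \<omega> * (trunc_entry \<tau> i l \<omega> * c l \<omega>) \<partial>M) = 0"
        by (simp add: trunc_entry_def mult_ac)
    next
      show "\<bar>trunc_entry \<tau> i j \<omega> * c j \<omega>\<bar> \<le> 2 * \<tau> * D" if "j < i" for j \<omega>
        unfolding abs_mult using that tau by (intro mult_mono trunc_entry_bound cb) auto
    qed measurable
    also have "\<dots> \<le> 2 * real 1 * (\<Sum>j<i. 4 * \<tau>\<^sup>2 * (8 * \<tau>\<^sup>2 * (\<Sum>k<j. \<integral>\<omega>. (Q \<omega> j k)\<^sup>2 \<partial>M)))"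
    proof (intro mult_left_mono sum_mono)
      fix j assume "j \<in> {..<i}"
      then have j: "j < i" by simp
      have "(\<integral>\<omega>. (trunc_entry \<tau> i j \<omega> * c j \<omega>)\<^sup>2 \<partial>M) \<le> 4 * \<tau>\<^sup>2 * (\<integral>\<omega>. (c j \<omega>)\<^sup>2 \<partial>M)"
        by (rule square_integral_le[where L = D]) (use trunc_entry_square_bound tau cb j in auto)
      also have "\<dots> \<le> 4 * \<tau>\<^sup>2 * (8 * \<tau>\<^sup>2 * (\<Sum>k<j. \<integral>\<omega>. (Q \<omega> j k)\<^sup>2 \<partial>M))"
        by (intro mult_left_mono c2 j) auto
      finally show "(\<integral>\<omega>. (trunc_entry \<tau> i j \<omega> * c j \<omega>)\<^sup>2 \<partial>M) \<le> 4 * \<tau>\<^sup>2 * (8 * \<tau>\<^sup>2 * (\<Sum>k<j. \<integral>\<omega>. (Q \<omega> j k)\<^sup>2 \<partial>M))" .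
    qed simp
    also have "\<dots> = 64 * \<tau>^4 * (\<Sum>j<i. \<Sum>k<j. \<integral>\<omega>. (Q \<omega> j k)\<^sup>2 \<partial>M)"
      by (simp add: sum_distrib_left mult.assoc power4_eq_xxxx power2_eq_square)
    also have "\<dots> \<le> 64 * \<tau>^4 * (K * real n)"
    proof (rule mult_left_mono)
      have Qi: "integrable M (\<lambda>\<omega>. (Q \<omega> j k)\<^sup>2)" if "j < i" "k < i" for j k
        by (rule bounded_integrable[where K = "B\<^sup>2"]) (use Qb[OF that] B0 in \<open>auto simp: abs_le_square_iff[symmetric]\<close>)
      have "(\<Sum>j<i. \<Sum>k<j. \<integral>\<omega>. (Q \<omega> j k)\<^sup>2 \<partial>M) \<le> (\<Sum>j<i. \<Sum>k<i. \<integral>\<omega>. (Q \<omega> j k)\<^sup>2 \<partial>M)"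
        by (intro sum_mono sum_mono2) auto
      also have "\<dots> = (\<integral>\<omega>. (\<Sum>j<i. \<Sum>k<i. (Q \<omega> j k)\<^sup>2) \<partial>M)"
        by (rule integral_double_sum[symmetric]) (rule Qi)
      also have "\<dots> \<le> K * real n"
        by (rule integral_le_const) (use Qi Qf in \<open>auto intro!: Bochner_Integration.integrable_sum\<close>)
      finally show "(\<Sum>j<i. \<Sum>k<j. \<integral>\<omega>. (Q \<omega> j k)\<^sup>2 \<partial>M) \<le> K * real n" .
    qed (use tau in simp)
    finally show ?thesis .
  qed
  have SM [measurable]: "S \<in> borel_measurable M" unfolding S_def by measurable
  have Sb: "\<bar>S \<omega>\<bar> \<le> real i * (2 * \<tau> * D)" for \<omega>
  proof -
    have "\<bar>S \<omega>\<bar> \<le> (\<Sum>j<i. 2 * \<tau> * D)"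
      unfolding S_def c_def[symmetric]
      by (rule order_trans[OF sum_abs], rule sum_mono)
        (use tau cb in \<open>auto simp: abs_mult intro!: mult_mono trunc_entry_bound\<close>)
    then show ?thesis by simp
  qed
  show "integrable M (\<lambda>\<omega>. \<bar>S \<omega>\<bar>)" using bounded_integrable[OF SM Sb] by simp
  have "(\<integral>\<omega>. \<bar>S \<omega>\<bar> \<partial>M) \<le> sqrt (64 * \<tau>^4 * (K * real n))"
    by (rule abs_moment_le_sqrt[OF SM Sb S2])
  also have "\<dots> \<le> sqrt ((8 * K * \<tau>\<^sup>2 * sqrt (real n))\<^sup>2)"
  proof (rule real_sqrt_le_mono)
    have "K * real n \<le> K\<^sup>2 * real n" using K by (intro mult_right_mono) (auto simp: power2_eq_square)
    then have "64 * \<tau>^4 * (K * real n) \<le> 64 * \<tau>^4 * (K\<^sup>2 * real n)" by (intro mult_left_mono) auto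
    also have "\<dots> = (8 * K * \<tau>\<^sup>2 * sqrt (real n))\<^sup>2"
      by (simp add: power_mult_distrib flip: power_mult)
    finally show "64 * \<tau>^4 * (K * real n) \<le> (8 * K * \<tau>\<^sup>2 * sqrt (real n))\<^sup>2" .
  qed
  also have "\<dots> = 8 * K * \<tau>\<^sup>2 * sqrt (real n)" using K by simp
  finally show "(\<integral>\<omega>. \<bar>S \<omega>\<bar> \<partial>M) \<le> 8 * K * \<tau>\<^sup>2 * sqrt (real n)" .
qed

lemma small_square_measurable_nested:
  assumes "k + a \<le> j" "k \<le> i"
  shows "small_square \<tau> i k \<in> borel_measurable (Alg (nested_past a (int i + 1) (int j + 1)))"
proof -
  have "Xsmall \<tau> (int i + 1) (int k + 1) \<in> borel_measurable (Alg (nested_past a (int i + 1) (int j + 1)))"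
    by (rule Xsmall_measurable_Alg) (use assms in \<open>auto simp: nested_past_def\<close>)
  then show ?thesis unfolding small_square_def by measurable
qed

lemma predicted_square_measurable_nested:
  assumes "k \<le> j"
  shows "predicted_square \<tau> a i k \<in> borel_measurable (Alg (nested_past a (int i + 1) (int j + 1)))"
  unfolding predicted_square_def by (rule measurable_Alg_mono[OF clipped_cond_exp_measurable_sub nested_mono]) (use assms in simp)

text \<open>
  The weights come from the minor that is a rows older and are therefore known to the nested past of
  each column; the centred squares are then orthogonal as soon as their columns are a apart.
\<close>

lemma diagonal_fluctuation:
  fixes Q' :: "'a \<Rightarrow> nat \<Rightarrow> real"
  assumes tau: "\<tau> \<ge> 0" and n: "n \<ge> 1" "i \<le> n" and K: "K \<ge> 1" and a: "a \<ge> 1"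
    and Qm: "\<And>j. (\<lambda>\<omega>. Q' \<omega> j) \<in> borel_measurable (Alg (rows_upto (int i + 1 - int a)))"
    and Qb: "\<And>\<omega> j. \<bar>Q' \<omega> j\<bar> \<le> K"
  defines "S \<equiv> \<lambda>\<omega>. \<Sum>j<i. (small_square \<tau> i j \<omega> - predicted_square \<tau> a i j \<omega>) * Q' \<omega> j"
  shows "integrable M (\<lambda>\<omega>. \<bar>S \<omega>\<bar>)" and "(\<integral>\<omega>. \<bar>S \<omega>\<bar> \<partial>M) \<le> 3 * real a * K * \<tau>\<^sup>2 * sqrt (real n)"
proof -
  define T where "T j \<omega> = (small_square \<tau> i j \<omega> - predicted_square \<tau> a i j \<omega>) * Q' \<omega> j" for j \<omega>
  have QM [measurable]: "(\<lambda>\<omega>. Q' \<omega> j) \<in> borel_measurable M" for j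
    by (rule measurable_Alg_M[OF Qm])
  have Qn: "(\<lambda>\<omega>. Q' \<omega> l) \<in> borel_measurable (Alg (nested_past a (int i + 1) (int j + 1)))" for l j
    by (rule measurable_Alg_mono[OF Qm rows_subset_nested]) simp
  have db: "\<bar>small_square \<tau> i j \<omega> - predicted_square \<tau> a i j \<omega>\<bar> \<le> 2 * \<tau>\<^sup>2" for j \<omega>
    using small_square_bound[OF tau, of i j \<omega>] predicted_square_bound[of \<tau> a i j \<omega>] by linarith
  have Tb: "\<bar>T j \<omega>\<bar> \<le> 2 * \<tau>\<^sup>2 * K" for j \<omega>
    unfolding T_def abs_mult by (intro mult_mono db Qb) auto
  have TM [measurable]: "T j \<in> borel_measurable M" for j unfolding T_def by measurable
  have "(\<integral>\<omega>. (S \<omega>)\<^sup>2 \<partial>M) \<le> 2 * real a * (\<Sum>j<i. \<integral>\<omega>. (T j \<omega>)\<^sup>2 \<partial>M)"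
    unfolding S_def T_def[symmetric]
  proof (rule lagged_orthogonal_second_moment)
    fix k l assume kl: "k + a \<le> l" "l < i"
    let ?H = "Alg (nested_past a (int i + 1) (int l + 1))"
    define g where "g \<omega> = T k \<omega> * Q' \<omega> l" for \<omega>
    have gm: "g \<in> borel_measurable ?H"
      unfolding g_def T_def using kl
      by (intro borel_measurable_times borel_measurable_diff small_square_measurable_nested predicted_square_measurable_nested Qn) auto
    have gb: "\<bar>g \<omega>\<bar> \<le> 2 * \<tau>\<^sup>2 * K * K" for \<omega>
      unfolding g_def abs_mult[of "T k \<omega>"] using K by (intro mult_mono Tb Qb) auto
    have "(\<integral>\<omega>. g \<omega> * predicted_square \<tau> a i l \<omega> \<partial>M) = (\<integral>\<omega>. g \<omega> * small_square \<tau> i l \<omega> \<partial>M)"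
      unfolding predicted_square_def by (rule clipped_cond_exp_integral[OF Alg_subalgebra small_square_measurable small_square_bound[OF tau] gm gb])
    moreover have "integrable M (\<lambda>\<omega>. g \<omega> * f \<omega>)"
      if "f \<in> borel_measurable M" "\<And>\<omega>. \<bar>f \<omega>\<bar> \<le> \<tau>\<^sup>2" for f
      by (rule bounded_integrable[where K = "2 * \<tau>\<^sup>2 * K * K * \<tau>\<^sup>2"])
        (use that measurable_Alg_M[OF gm] K in \<open>auto simp: abs_mult intro!: mult_mono gb\<close>)
    ultimately have "(\<integral>\<omega>. g \<omega> * small_square \<tau> i l \<omega> - g \<omega> * predicted_square \<tau> a i l \<omega> \<partial>M) = 0"
      using small_square_bound[OF tau] predicted_square_bound by (subst Bochner_Integration.integral_diff) auto
    then show "(\<integral>\<omega>. T k \<omega> * T l \<omega> \<partial>M) = 0"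
      by (simp add: g_def T_def[of l] algebra_simps)
  qed (use Tb in measurable)
  also have "\<dots> \<le> 2 * real a * (\<Sum>j<i. (2 * \<tau>\<^sup>2 * K)\<^sup>2)"
  proof (intro mult_left_mono sum_mono)
    fix j
    have T2: "(T j \<omega>)\<^sup>2 \<le> (2 * \<tau>\<^sup>2 * K)\<^sup>2" for \<omega>
      using power_mono[OF Tb[of j \<omega>], of 2] by simp
    show "(\<integral>\<omega>. (T j \<omega>)\<^sup>2 \<partial>M) \<le> (2 * \<tau>\<^sup>2 * K)\<^sup>2"
      by (rule integral_le_const) (use T2 in \<open>auto intro!: bounded_integrable[where K = "(2 * \<tau>\<^sup>2 * K)\<^sup>2"]\<close>)
  qed simp
  also have "\<dots> \<le> (3 * real a * K * \<tau>\<^sup>2 * sqrt (real n))\<^sup>2"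
  proof -
    have "2 * real a * (\<Sum>j<i. (2 * \<tau>\<^sup>2 * K)\<^sup>2) = 8 * (K\<^sup>2 * (\<tau>\<^sup>2)\<^sup>2) * (real a * real i)"
      by (simp add: power_mult_distrib)
    also have "\<dots> \<le> 9 * (K\<^sup>2 * (\<tau>\<^sup>2)\<^sup>2) * ((real a)\<^sup>2 * real n)"
      using a n by (intro mult_mono) (auto simp: power2_eq_square)
    finally show ?thesis by (simp add: power_mult_distrib mult_ac)
  qed
  finally have S2: "(\<integral>\<omega>. (S \<omega>)\<^sup>2 \<partial>M) \<le> (3 * real a * K * \<tau>\<^sup>2 * sqrt (real n))\<^sup>2" .
  have SM [measurable]: "S \<in> borel_measurable M" unfolding S_def by measurable
  have Sb: "\<bar>S \<omega>\<bar> \<le> real i * (2 * \<tau>\<^sup>2 * K)" for \<omega>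
  proof -
    have "\<bar>S \<omega>\<bar> \<le> (\<Sum>j<i. 2 * \<tau>\<^sup>2 * K)"
      unfolding S_def T_def[symmetric] by (rule order_trans[OF sum_abs], rule sum_mono) (rule Tb)
    then show ?thesis by simp
  qed
  show "integrable M (\<lambda>\<omega>. \<bar>S \<omega>\<bar>)" using bounded_integrable[OF SM Sb] by simp
  show "(\<integral>\<omega>. \<bar>S \<omega>\<bar> \<partial>M) \<le> 3 * real a * K * \<tau>\<^sup>2 * sqrt (real n)"
    using abs_moment_le_sqrt[OF SM Sb S2] K by simp
qed

text \<open>
  The quadratic form minus the trace splits into the off-diagonal part, the recentring of the squares,
  the replacement of Q by the older Q', the deviation of the squares from their predictions, and the
  distance of the predictions from 1. Only the last is not small by itself; it stays in the bound.
\<close>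

lemma row_fluctuation:
  fixes Q :: "'a \<Rightarrow> nat \<Rightarrow> nat \<Rightarrow> real" and Q' :: "'a \<Rightarrow> nat \<Rightarrow> real"
  assumes tau: "\<tau> \<ge> 1" and n: "n \<ge> 1" "i \<le> n" and K: "K \<ge> 1" and a: "a \<ge> 1"
    and Qm: "\<And>j k. (\<lambda>\<omega>. Q \<omega> j k) \<in> borel_measurable (Alg (rows_upto (int i)))"
    and Qsym: "\<And>\<omega> j k. Q \<omega> j k = Q \<omega> k j"
    and Qf: "\<And>\<omega>. (\<Sum>j<i. \<Sum>k<i. (Q \<omega> j k)\<^sup>2) \<le> K * real n"
    and Qd: "\<And>\<omega> j. \<bar>Q \<omega> j j\<bar> \<le> K"
    and Qm': "\<And>j. (\<lambda>\<omega>. Q' \<omega> j) \<in> borel_measurable (Alg (rows_upto (int i + 1 - int a)))"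
    and Qd': "\<And>\<omega> j. \<bar>Q' \<omega> j\<bar> \<le> K"
    and QQ': "\<And>\<omega>. (\<Sum>j<i. \<bar>Q \<omega> j j - Q' \<omega> j\<bar>) \<le> K * real a"
  shows "\<exists>r. integrable M r \<and> (\<forall>\<omega>. 0 \<le> r \<omega>) \<and> (\<integral>\<omega>. r \<omega> \<partial>M) \<le> 21 * K * real a * \<tau>\<^sup>2 / sqrt (real n) + 3 * K * C / h \<tau> \<and>
    (\<forall>\<omega>. \<bar>(\<Sum>j<i. \<Sum>k<i. trunc_entry \<tau> i j \<omega> * trunc_entry \<tau> i k \<omega> * Q \<omega> j k) / real n - (\<Sum>j<i. Q \<omega> j j) / real n\<bar>
      \<le> r \<omega> + K / real n * (\<Sum>j<i. \<bar>predicted_square \<tau> a i j \<omega> - 1\<bar>))"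
proof -
  have t0: "\<tau> \<ge> 0" using tau by simp
  have n0: "real n > 0" using n by simp
  define S1 where "S1 = (\<lambda>\<omega>. \<Sum>j<i. trunc_entry \<tau> i j \<omega> * (\<Sum>k<j. trunc_entry \<tau> i k \<omega> * Q \<omega> j k))"
  define S2 where "S2 = (\<lambda>\<omega>. \<Sum>j<i. (small_square \<tau> i j \<omega> - predicted_square \<tau> a i j \<omega>) * Q' \<omega> j)"
  define E0 where "E0 = (\<lambda>\<omega>. \<Sum>j<i. \<bar>(trunc_entry \<tau> i j \<omega>)\<^sup>2 - small_square \<tau> i j \<omega>\<bar>)"
  define r where "r = (\<lambda>\<omega>. 2 / real n * \<bar>S1 \<omega>\<bar> + 1 / real n * \<bar>S2 \<omega>\<bar> + K / real n * E0 \<omega> + 2 * \<tau>\<^sup>2 * (K * real a) / real n)"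
  have S1: "integrable M (\<lambda>\<omega>. \<bar>S1 \<omega>\<bar>)" "(\<integral>\<omega>. \<bar>S1 \<omega>\<bar> \<partial>M) \<le> 8 * K * \<tau>\<^sup>2 * sqrt (real n)"
    unfolding S1_def by (rule off_diagonal_fluctuation[OF t0 n K Qm Qf])+
  have S2: "integrable M (\<lambda>\<omega>. \<bar>S2 \<omega>\<bar>)" "(\<integral>\<omega>. \<bar>S2 \<omega>\<bar> \<partial>M) \<le> 3 * real a * K * \<tau>\<^sup>2 * sqrt (real n)"
    unfolding S2_def by (rule diagonal_fluctuation[OF t0 n K a Qm' Qd'])+
  have e_int: "integrable M (\<lambda>\<omega>. \<bar>(trunc_entry \<tau> i j \<omega>)\<^sup>2 - small_square \<tau> i j \<omega>\<bar>)" for j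
  proof (rule bounded_integrable[where K = "5 * \<tau>\<^sup>2"])
    show "\<bar>\<bar>(trunc_entry \<tau> i j \<omega>)\<^sup>2 - small_square \<tau> i j \<omega>\<bar>\<bar> \<le> 5 * \<tau>\<^sup>2" for \<omega>
      using trunc_entry_square_bound[OF t0, of i j \<omega>] small_square_bound[OF t0, of i j \<omega>] zero_le_power2[of "trunc_entry \<tau> i j \<omega>"] by linarith
  qed measurable
  have E0_int: "integrable M E0" unfolding E0_def by (intro Bochner_Integration.integrable_sum e_int)
  have E0_le: "(\<integral>\<omega>. E0 \<omega> \<partial>M) \<le> real n * (3 * C / h \<tau>)"
  proof -
    have "(\<integral>\<omega>. E0 \<omega> \<partial>M) = (\<Sum>j<i. \<integral>\<omega>. \<bar>(trunc_entry \<tau> i j \<omega>)\<^sup>2 - small_square \<tau> i j \<omega>\<bar> \<partial>M)"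
      unfolding E0_def by (intro Bochner_Integration.integral_sum e_int)
    also have "\<dots> \<le> (\<Sum>j<i. 3 * C / h \<tau>)"
      unfolding trunc_entry_def small_square_def by (intro sum_mono square_recentring t0) auto
    also have "\<dots> \<le> real n * (3 * C / h \<tau>)"
      using n C_pos h_ge_1[OF t0] by (simp add: mult_right_mono divide_right_mono)
    finally show ?thesis .
  qed
  have r_int: "integrable M r" unfolding r_def using S1(1) S2(1) E0_int by simp
  have "(\<integral>\<omega>. r \<omega> \<partial>M) = 2 / real n * (\<integral>\<omega>. \<bar>S1 \<omega>\<bar> \<partial>M) + 1 / real n * (\<integral>\<omega>. \<bar>S2 \<omega>\<bar> \<partial>M)
      + K / real n * (\<integral>\<omega>. E0 \<omega> \<partial>M) + 2 * \<tau>\<^sup>2 * (K * real a) / real n"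
    unfolding r_def using S1(1) S2(1) E0_int by (simp add: prob_space)
  also have "\<dots> \<le> 2 / real n * (8 * K * \<tau>\<^sup>2 * sqrt (real n)) + 1 / real n * (3 * real a * K * \<tau>\<^sup>2 * sqrt (real n))
      + K / real n * (real n * (3 * C / h \<tau>)) + 2 * \<tau>\<^sup>2 * (K * real a) / real n"
    using K by (intro add_mono mult_left_mono S1 S2 E0_le) auto
  also have "\<dots> \<le> 16 * (K * real a * \<tau>\<^sup>2 / sqrt (real n)) + 3 * (K * real a * \<tau>\<^sup>2 / sqrt (real n))
      + 3 * K * C / h \<tau> + 2 * (K * real a * \<tau>\<^sup>2 / sqrt (real n))"
  proof (intro add_mono)
    have "sqrt (real n) / real n = 1 / sqrt (real n)" using n0 by (simp add: real_div_sqrt divide_simps)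
    then have s: "x * sqrt (real n) / real n = x / sqrt (real n)" for x
      by (metis mult.right_neutral times_divide_eq_right)
    have "2 / real n * (8 * K * \<tau>\<^sup>2 * sqrt (real n)) = 16 * (K * 1 * \<tau>\<^sup>2 / sqrt (real n))"
      using s[of "16 * K * \<tau>\<^sup>2"] by simp
    also have "\<dots> \<le> 16 * (K * real a * \<tau>\<^sup>2 / sqrt (real n))"
      using K a by (intro mult_left_mono divide_right_mono mult_right_mono) auto
    finally show "2 / real n * (8 * K * \<tau>\<^sup>2 * sqrt (real n)) \<le> 16 * (K * real a * \<tau>\<^sup>2 / sqrt (real n))" .
    show "1 / real n * (3 * real a * K * \<tau>\<^sup>2 * sqrt (real n)) \<le> 3 * (K * real a * \<tau>\<^sup>2 / sqrt (real n))"
      using s[of "3 * real a * K * \<tau>\<^sup>2"] by (simp add: mult_ac)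
    show "K / real n * (real n * (3 * C / h \<tau>)) \<le> 3 * K * C / h \<tau>" using n0 by (simp add: mult_ac)
    have "sqrt (real n) \<le> real n"
      using n real_sqrt_le_mono[of "real n" "real n * real n"] by simp
    then have "2 * (K * real a * \<tau>\<^sup>2) / real n \<le> 2 * (K * real a * \<tau>\<^sup>2) / sqrt (real n)"
      using K n0 by (intro divide_left_mono) auto
    then show "2 * \<tau>\<^sup>2 * (K * real a) / real n \<le> 2 * (K * real a * \<tau>\<^sup>2 / sqrt (real n))"
      by (simp add: mult_ac)
  qed
  finally have r_le: "(\<integral>\<omega>. r \<omega> \<partial>M) \<le> 21 * K * real a * \<tau>\<^sup>2 / sqrt (real n) + 3 * K * C / h \<tau>"
    by (simp add: algebra_simps)
  have bound: "\<bar>(\<Sum>j<i. \<Sum>k<i. trunc_entry \<tau> i j \<omega> * trunc_entry \<tau> i k \<omega> * Q \<omega> j k) / real n - (\<Sum>j<i. Q \<omega> j j) / real n\<bar>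
      \<le> r \<omega> + K / real n * (\<Sum>j<i. \<bar>predicted_square \<tau> a i j \<omega> - 1\<bar>)" for \<omega>
  proof -
    let ?x = "\<lambda>j. trunc_entry \<tau> i j \<omega>" and ?y = "\<lambda>j. small_square \<tau> i j \<omega>" and ?h = "\<lambda>j. predicted_square \<tau> a i j \<omega>"
    have "(\<Sum>j<i. \<Sum>k<i. ?x j * ?x k * Q \<omega> j k) = (\<Sum>j<i. ?x j * ?x j * Q \<omega> j j) + 2 * (\<Sum>j<i. \<Sum>k<j. ?x j * ?x k * Q \<omega> j k)"
      by (rule symmetric_double_sum) (metis Qsym mult.commute)
    also have "(\<Sum>j<i. \<Sum>k<j. ?x j * ?x k * Q \<omega> j k) = S1 \<omega>"
      by (simp add: S1_def sum_distrib_left mult.assoc)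
    finally have 1: "(\<Sum>j<i. \<Sum>k<i. ?x j * ?x k * Q \<omega> j k) - (\<Sum>j<i. Q \<omega> j j)
      = 2 * S1 \<omega> + (\<Sum>j<i. (?x j * ?x j - 1) * Q \<omega> j j)"
      by (simp add: sum_subtractf left_diff_distrib)
    \<comment> \<open>recentring, older weights, deviation from the prediction, error of the prediction\<close>
    have 2: "(\<Sum>j<i. (?x j * ?x j - 1) * Q \<omega> j j) = (\<Sum>j<i. ((?x j)\<^sup>2 - ?y j) * Q \<omega> j j)
       + (\<Sum>j<i. (?y j - 1) * (Q \<omega> j j - Q' \<omega> j)) + S2 \<omega> + (\<Sum>j<i. (?h j - 1) * Q' \<omega> j)"
      unfolding S2_def sum.distrib[symmetric]
      by (intro sum.cong refl) (simp add: algebra_simps power2_eq_square)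
    have 3: "\<bar>\<Sum>j<i. ((?x j)\<^sup>2 - ?y j) * Q \<omega> j j\<bar> \<le> K * E0 \<omega>"
    proof -
      have "\<bar>\<Sum>j<i. ((?x j)\<^sup>2 - ?y j) * Q \<omega> j j\<bar> \<le> (\<Sum>j<i. \<bar>(?x j)\<^sup>2 - ?y j\<bar> * K)"
        by (rule order_trans[OF sum_abs], rule sum_mono) (simp add: abs_mult mult_left_mono Qd)
      then show ?thesis by (simp add: E0_def sum_distrib_left mult.commute)
    qed
    have 4: "\<bar>\<Sum>j<i. (?y j - 1) * (Q \<omega> j j - Q' \<omega> j)\<bar> \<le> 2 * \<tau>\<^sup>2 * (K * real a)"
    proof -
      have "\<bar>\<Sum>j<i. (?y j - 1) * (Q \<omega> j j - Q' \<omega> j)\<bar> \<le> (\<Sum>j<i. (2 * \<tau>\<^sup>2) * \<bar>Q \<omega> j j - Q' \<omega> j\<bar>)"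
      proof (rule order_trans[OF sum_abs], rule sum_mono, unfold abs_mult, rule mult_right_mono)
        fix j
        have "\<tau>\<^sup>2 \<ge> 1" using tau by simp
        then show "\<bar>?y j - 1\<bar> \<le> 2 * \<tau>\<^sup>2" using small_square_bound[OF t0, of i j \<omega>] by linarith
      qed simp
      also have "\<dots> \<le> 2 * \<tau>\<^sup>2 * (K * real a)"
        unfolding sum_distrib_left[symmetric] by (intro mult_left_mono QQ') simp
      finally show ?thesis .
    qed
    have 5: "\<bar>\<Sum>j<i. (?h j - 1) * Q' \<omega> j\<bar> \<le> K * (\<Sum>j<i. \<bar>?h j - 1\<bar>)"
    proof -
      have "\<bar>\<Sum>j<i. (?h j - 1) * Q' \<omega> j\<bar> \<le> (\<Sum>j<i. \<bar>?h j - 1\<bar> * K)"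
        by (rule order_trans[OF sum_abs], rule sum_mono) (simp add: abs_mult mult_left_mono Qd')
      then show ?thesis by (simp add: sum_distrib_left mult.commute)
    qed
    have "\<bar>(\<Sum>j<i. \<Sum>k<i. ?x j * ?x k * Q \<omega> j k) / real n - (\<Sum>j<i. Q \<omega> j j) / real n\<bar>
      = \<bar>2 * S1 \<omega> + (\<Sum>j<i. (?x j * ?x j - 1) * Q \<omega> j j)\<bar> / real n"
      unfolding 1[symmetric] by (simp flip: diff_divide_distrib)
    also have "\<dots> \<le> (2 * \<bar>S1 \<omega>\<bar> + (K * E0 \<omega> + 2 * \<tau>\<^sup>2 * (K * real a) + \<bar>S2 \<omega>\<bar> + K * (\<Sum>j<i. \<bar>?h j - 1\<bar>))) / real n"
      unfolding 2 using 3 4 5 by (intro divide_right_mono) linarith+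
    also have "\<dots> = r \<omega> + K / real n * (\<Sum>j<i. \<bar>?h j - 1\<bar>)"
      by (simp add: r_def add_divide_distrib)
    finally show ?thesis .
  qed
  have r0: "0 \<le> r \<omega>" for \<omega>
    unfolding r_def E0_def using K n0
    by (intro add_nonneg_nonneg mult_nonneg_nonneg divide_nonneg_nonneg sum_nonneg) auto
  show ?thesis by (rule exI[of _ r], intro conjI allI r_int r0 r_le bound)
qed

end

section \<open>Conditional variances\<close>

context martingale_array
begin

text \<open>
  The quantity whose average the hypothesis controls, with indices shifted to start at 0.
\<close>

definition var_gap :: "nat \<Rightarrow> (int \<Rightarrow> int \<Rightarrow> real) \<Rightarrow> nat \<Rightarrow> nat \<Rightarrow> 'a \<Rightarrow> real" where
  "var_gap a \<sigma> i j \<omega> = \<bar>real_cond_exp M (past_algebra M X a (int i + 1) (int j + 1))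
     (\<lambda>\<omega>'. (X (int i + 1) (int j + 1) \<omega>')\<^sup>2 - (\<sigma> (int i + 1) (int j + 1))\<^sup>2) \<omega>\<bar>"

text \<open>
  Since the nested past is contained in the lagged past, the distance of the prediction from \<sigma>^2 is
  at most the prediction W of V, where V is the distance of the lagged conditional second moment from
  \<sigma>^2. A row sum of W - V is known once the row is known and has mean 0 given the rows up to
  i - a, so that the row sums are orthogonal beyond lag a. The remaining V is the gap of the hypothesis
  up to the conditional expectation of the large part.
\<close>

lemma conditional_variance_fluctuation:
  assumes tau: "\<tau> \<ge> 1" and n: "n \<ge> 1" and a: "a \<ge> 1"
    and var: "\<And>i j. (\<integral>\<omega>. (X i j \<omega>)\<^sup>2 \<partial>M) = (\<sigma> i j)\<^sup>2"
  shows "\<exists>r. integrable M r \<and> (\<forall>\<omega>. 0 \<le> r \<omega>) \<and> (\<integral>\<omega>. r \<omega> \<partial>M) \<le> 3 * real a * (\<tau>\<^sup>2 + C) / sqrt (real n) + C / h \<tau> \<and>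
    (AE \<omega> in M. (\<Sum>i<n. \<Sum>j<i. \<bar>predicted_square \<tau> a i j \<omega> - 1\<bar>) / (real n)\<^sup>2 \<le> r \<omega>
      + (\<Sum>i<n. \<Sum>j<i. var_gap a \<sigma> i j \<omega>) / (real n)\<^sup>2
      + (\<Sum>i<n. \<Sum>j<i. \<bar>(\<sigma> (int i + 1) (int j + 1))\<^sup>2 - 1\<bar>) / (real n)\<^sup>2)"
proof -
  have t0: "\<tau> \<ge> 0" using tau by simp
  have n0: "real n > 0" using n by simp
  define F where "F i j = Alg (past_indices a (int i + 1) (int j + 1))" for i j
  define H where "H i j = Alg (nested_past a (int i + 1) (int j + 1))" for i j
  define s where "s i j = (\<sigma> (int i + 1) (int j + 1))\<^sup>2" for i j
  define B where "B = \<tau>\<^sup>2 + C"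
  have B0: "B \<ge> 0" using C_pos by (simp add: B_def)
  define V where "V i j \<omega> = \<bar>clipped_cond_exp (\<tau>\<^sup>2) (F i j) (small_square \<tau> i j) \<omega> - s i j\<bar>" for i j \<omega>
  define W where "W i j = clipped_cond_exp B (H i j) (V i j)" for i j
  define L where "L i j \<omega> = \<bar>real_cond_exp M (F i j) (\<lambda>\<omega>. (Xlarge \<tau> (int i + 1) (int j + 1) \<omega>)\<^sup>2) \<omega>\<bar>" for i j \<omega>
  have F: "subalgebra M (F i j)" and H: "subalgebra M (H i j)" for i j
    unfolding F_def H_def by (rule Alg_subalgebra)+
  have FH: "subalgebra (F i j) (H i j)" for i j
    unfolding F_def H_def by (rule Alg_mono[OF nested_subset_past[OF a]])
  have s: "0 \<le> s i j" "s i j \<le> C" for i j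
    using X_second_moment[of "int i + 1" "int j + 1"] by (auto simp: s_def var)
  have Vb: "\<bar>V i j \<omega>\<bar> \<le> B" for i j \<omega>
    using clipped_cond_exp_bound[of "\<tau>\<^sup>2" "F i j" "small_square \<tau> i j" \<omega>] s[of i j] by (simp add: V_def B_def)
  have VF: "V i j \<in> borel_measurable (F i j)" for i j
    unfolding V_def using clipped_cond_exp_measurable_sub[of "\<tau>\<^sup>2" "F i j" "small_square \<tau> i j"] by measurable
  have VM [measurable]: "V i j \<in> borel_measurable M" for i j
    by (rule measurable_from_subalg[OF F VF])
  have WH: "W i j \<in> borel_measurable (H i j)" for i j
    unfolding W_def by (rule clipped_cond_exp_measurable_sub)
  have WM [measurable]: "W i j \<in> borel_measurable M" for i j
    by (rule measurable_from_subalg[OF H WH])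
  have Wb: "\<bar>W i j \<omega>\<bar> \<le> B" for i j \<omega> unfolding W_def by (rule clipped_cond_exp_bound[OF B0])
  have yint: "integrable M (small_square \<tau> i j)" for i j
    by (rule bounded_integrable[OF small_square_measurable small_square_bound[OF t0]])
  have predicted_square_le: "AE \<omega> in M. \<bar>predicted_square \<tau> a i j \<omega> - s i j\<bar> \<le> W i j \<omega>" for i j
  proof -
    interpret sigma_finite_subalgebra M "H i j" by (rule subalgebra_sigma_finite[OF H])
    let ?v = "clipped_cond_exp (\<tau>\<^sup>2) (F i j) (small_square \<tau> i j)"
    have vM: "?v \<in> borel_measurable M" by (rule clipped_cond_exp_measurable[OF F])
    have vi: "integrable M ?v" by (rule bounded_integrable[OF vM clipped_cond_exp_bound]) simp
    have c: "AE \<omega> in M. real_cond_exp M (H i j) (\<lambda>_. s i j) \<omega> = s i j"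
      by (rule real_cond_exp_F_meas) auto
    have "AE \<omega> in M. predicted_square \<tau> a i j \<omega> = real_cond_exp M (H i j) (small_square \<tau> i j) \<omega>"
      unfolding predicted_square_def H_def by (rule clipped_cond_exp_AE[OF Alg_subalgebra small_square_measurable small_square_bound[OF t0]])
    moreover have "AE \<omega> in M. real_cond_exp M (H i j) (real_cond_exp M (F i j) (small_square \<tau> i j)) \<omega>
        = real_cond_exp M (H i j) (small_square \<tau> i j) \<omega>"
      by (rule real_cond_exp_nested_subalg[OF F FH yint])
    moreover have "AE \<omega> in M. real_cond_exp M (H i j) (real_cond_exp M (F i j) (small_square \<tau> i j)) \<omega>
        = real_cond_exp M (H i j) ?v \<omega>"
      using clipped_cond_exp_AE[OF F small_square_measurable small_square_bound[OF t0], of i j i j] vM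
        measurable_from_subalg[OF F borel_measurable_cond_exp]
      by (intro real_cond_exp_cong) auto
    moreover have "AE \<omega> in M. real_cond_exp M (H i j) (\<lambda>\<omega>. ?v \<omega> - s i j) \<omega>
        = real_cond_exp M (H i j) ?v \<omega> - real_cond_exp M (H i j) (\<lambda>_. s i j) \<omega>"
      by (rule real_cond_exp_diff[OF vi]) simp
    moreover have "AE \<omega> in M. \<bar>real_cond_exp M (H i j) (\<lambda>\<omega>. ?v \<omega> - s i j) \<omega>\<bar>
        \<le> real_cond_exp M (H i j) (\<lambda>\<omega>. \<bar>?v \<omega> - s i j\<bar>) \<omega>"
      using vi by (intro real_cond_exp_abs_le[OF H]) simp
    moreover have "AE \<omega> in M. W i j \<omega> = real_cond_exp M (H i j) (\<lambda>\<omega>. \<bar>?v \<omega> - s i j\<bar>) \<omega>"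
      using clipped_cond_exp_AE[OF H VM Vb, of i j i j] by (simp add: W_def V_def[abs_def])
    ultimately show ?thesis using c by eventually_elim simp
  qed
  have V_le: "AE \<omega> in M. V i j \<omega> \<le> var_gap a \<sigma> i j \<omega> + L i j \<omega>" for i j
  proof -
    interpret sigma_finite_subalgebra M "F i j" by (rule subalgebra_sigma_finite[OF F])
    let ?X = "\<lambda>\<omega>. (X (int i + 1) (int j + 1) \<omega>)\<^sup>2 - s i j" and ?l = "\<lambda>\<omega>. (Xlarge \<tau> (int i + 1) (int j + 1) \<omega>)\<^sup>2"
    have c: "AE \<omega> in M. real_cond_exp M (F i j) (\<lambda>_. s i j) \<omega> = s i j"
      by (rule real_cond_exp_F_meas) auto
    have eq: "(\<lambda>\<omega>. ?X \<omega> - ?l \<omega>) = (\<lambda>\<omega>. small_square \<tau> i j \<omega> - s i j)"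
      by (auto simp: small_square_def Xsmall_def Xlarge_def)
    have "AE \<omega> in M. real_cond_exp M (F i j) (\<lambda>\<omega>. ?X \<omega> - ?l \<omega>) \<omega>
       = real_cond_exp M (F i j) ?X \<omega> - real_cond_exp M (F i j) ?l \<omega>"
      by (rule real_cond_exp_diff) (simp_all add: X_square_integrable Xlarge_square_integrable)
    then have "AE \<omega> in M. real_cond_exp M (F i j) (\<lambda>\<omega>. small_square \<tau> i j \<omega> - s i j) \<omega>
       = real_cond_exp M (F i j) ?X \<omega> - real_cond_exp M (F i j) ?l \<omega>"
      unfolding eq .
    moreover have "AE \<omega> in M. real_cond_exp M (F i j) (\<lambda>\<omega>. small_square \<tau> i j \<omega> - s i j) \<omega>
       = real_cond_exp M (F i j) (small_square \<tau> i j) \<omega> - real_cond_exp M (F i j) (\<lambda>_. s i j) \<omega>"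
      by (rule real_cond_exp_diff[OF yint]) simp
    moreover have "AE \<omega> in M. clipped_cond_exp (\<tau>\<^sup>2) (F i j) (small_square \<tau> i j) \<omega> = real_cond_exp M (F i j) (small_square \<tau> i j) \<omega>"
      by (rule clipped_cond_exp_AE[OF F small_square_measurable small_square_bound[OF t0]])
    ultimately have "AE \<omega> in M. V i j \<omega> \<le> \<bar>real_cond_exp M (F i j) ?X \<omega>\<bar> + L i j \<omega>"
      using c
    proof eventually_elim
      case (elim \<omega>)
      then show ?case unfolding V_def L_def by linarith
    qed
    then show ?thesis by (simp add: var_gap_def past_algebra_eq F_def s_def)
  qed
  define T where "T i \<omega> = (\<Sum>j<i. W i j \<omega> - V i j \<omega>)" for i \<omega>
  define D where "D = real n * (2 * B)"
  have D0: "D \<ge> 0" using B0 by (simp add: D_def)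
  have dWV: "\<bar>W i j \<omega> - V i j \<omega>\<bar> \<le> 2 * B" for i j \<omega>
    using Wb[of i j \<omega>] Vb[of i j \<omega>] by linarith
  have Tb: "\<bar>T i \<omega>\<bar> \<le> D" if "i < n" for i \<omega>
  proof -
    have "\<bar>T i \<omega>\<bar> \<le> (\<Sum>j<i. 2 * B)"
      unfolding T_def by (rule order_trans[OF sum_abs], rule sum_mono) (rule dWV)
    also have "\<dots> \<le> D" using that B0 by (simp add: D_def mult_right_mono)
    finally show ?thesis .
  qed
  have TM [measurable]: "T i \<in> borel_measurable M" for i unfolding T_def by measurable
  have T_rows: "T k \<in> borel_measurable (Alg (rows_upto (int k + 1)))" for k
    unfolding T_def
  proof (intro borel_measurable_sum borel_measurable_diff)
    fix j
    show "W k j \<in> borel_measurable (Alg (rows_upto (int k + 1)))"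
      using WH[of k j] unfolding H_def by (rule measurable_Alg_mono) (rule nested_subset_rows)
    show "V k j \<in> borel_measurable (Alg (rows_upto (int k + 1)))"
      using VF[of k j] unfolding F_def by (rule measurable_Alg_mono) (rule past_subset_rows)
  qed
  have G2: "(\<integral>\<omega>. (\<Sum>i<n. T i \<omega>)\<^sup>2 \<partial>M) \<le> 2 * real a * (\<Sum>i<n. \<integral>\<omega>. (T i \<omega>)\<^sup>2 \<partial>M)"
  proof (rule lagged_orthogonal_second_moment[OF TM Tb])
    fix k l assume kl: "k + a \<le> l" "l < n"
    have kn: "k < n" using kl a by simp
    have *: "(\<integral>\<omega>. T k \<omega> * (W l j \<omega> - V l j \<omega>) \<partial>M) = 0" for j
    proof -
      have TH: "T k \<in> borel_measurable (H l j)"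
        unfolding H_def
        by (rule measurable_Alg_mono[OF T_rows rows_subset_nested]) (use kl in simp)
      have "(\<integral>\<omega>. T k \<omega> * W l j \<omega> \<partial>M) = (\<integral>\<omega>. T k \<omega> * V l j \<omega> \<partial>M)"
        unfolding W_def by (rule clipped_cond_exp_integral[OF H VM Vb TH Tb[OF kn]])
      moreover have "integrable M (\<lambda>\<omega>. T k \<omega> * f \<omega>)" if "f \<in> borel_measurable M" "\<And>\<omega>. \<bar>f \<omega>\<bar> \<le> B" for f
        by (rule bounded_integrable[where K = "D * B"])
          (use that D0 in \<open>auto simp: abs_mult intro!: mult_mono Tb[OF kn]\<close>)
      ultimately show ?thesis
        unfolding right_diff_distrib using Wb Vb by (subst Bochner_Integration.integral_diff) auto
    qed
    have "(\<integral>\<omega>. T k \<omega> * T l \<omega> \<partial>M) = (\<integral>\<omega>. (\<Sum>j<l. T k \<omega> * (W l j \<omega> - V l j \<omega>)) \<partial>M)"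
      by (simp add: T_def[of l] sum_distrib_left)
    also have "\<dots> = (\<Sum>j<l. \<integral>\<omega>. T k \<omega> * (W l j \<omega> - V l j \<omega>) \<partial>M)"
      by (intro Bochner_Integration.integral_sum bounded_integrable[where K = "D * (2 * B)"])
        (use D0 in \<open>auto simp: abs_mult intro!: mult_mono Tb[OF kn] dWV\<close>)
    finally show "(\<integral>\<omega>. T k \<omega> * T l \<omega> \<partial>M) = 0" by (simp add: *)
  qed
  also have "\<dots> \<le> 2 * real a * (\<Sum>i<n. D\<^sup>2)"
  proof (intro mult_left_mono sum_mono)
    fix i assume "i \<in> {..<n}"
    then have T2: "(T i \<omega>)\<^sup>2 \<le> D\<^sup>2" for \<omega>
      using power_mono[OF Tb[of i \<omega>], of 2] by simp
    show "(\<integral>\<omega>. (T i \<omega>)\<^sup>2 \<partial>M) \<le> D\<^sup>2"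
      by (rule integral_le_const) (use T2 in \<open>auto intro!: bounded_integrable[where K = "D\<^sup>2"]\<close>)
  qed simp
  also have "\<dots> \<le> (3 * real a * B * real n * sqrt (real n))\<^sup>2"
  proof -
    have "2 * real a * (\<Sum>i<n. D\<^sup>2) = 8 * (B\<^sup>2 * (real n)\<^sup>2 * real n) * real a"
      by (simp add: D_def power_mult_distrib)
    also have "\<dots> \<le> 9 * (B\<^sup>2 * (real n)\<^sup>2 * real n) * (real a)\<^sup>2"
      using a by (intro mult_mono) (auto simp: power2_eq_square)
    finally show ?thesis by (simp add: power_mult_distrib mult_ac)
  qed
  finally have G2: "(\<integral>\<omega>. (\<Sum>i<n. T i \<omega>)\<^sup>2 \<partial>M) \<le> (3 * real a * B * real n * sqrt (real n))\<^sup>2" .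
  define G where "G \<omega> = \<bar>\<Sum>i<n. T i \<omega>\<bar>" for \<omega>
  have Gb: "\<bar>\<Sum>i<n. T i \<omega>\<bar> \<le> real n * D" for \<omega>
  proof -
    have "\<bar>\<Sum>i<n. T i \<omega>\<bar> \<le> (\<Sum>i<n. D)"
      by (rule order_trans[OF sum_abs], rule sum_mono) (simp add: Tb)
    then show ?thesis by simp
  qed
  have SM: "(\<lambda>\<omega>. \<Sum>i<n. T i \<omega>) \<in> borel_measurable M" by measurable
  have G_int: "integrable M G"
    unfolding G_def by (rule integrable_abs[OF bounded_integrable[OF SM Gb]])
  have "(\<integral>\<omega>. G \<omega> \<partial>M) \<le> sqrt ((3 * real a * B * real n * sqrt (real n))\<^sup>2)"
    unfolding G_def by (rule abs_moment_le_sqrt[OF SM Gb G2])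
  also have "\<dots> = 3 * real a * B * real n * sqrt (real n)" using B0 by simp
  finally have G_le: "(\<integral>\<omega>. G \<omega> \<partial>M) \<le> 3 * real a * B * real n * sqrt (real n)" .
  have L_int: "integrable M (L i j)" and L_le: "(\<integral>\<omega>. L i j \<omega> \<partial>M) \<le> C / h \<tau>" for i j
  proof -
    show "integrable M (L i j)"
      unfolding L_def by (rule real_cond_exp_abs_integral_le[OF F Xlarge_square_integrable])
    have "(\<integral>\<omega>. L i j \<omega> \<partial>M) \<le> (\<integral>\<omega>. \<bar>(Xlarge \<tau> (int i + 1) (int j + 1) \<omega>)\<^sup>2\<bar> \<partial>M)"
      unfolding L_def by (rule real_cond_exp_abs_integral_le[OF F Xlarge_square_integrable])
    also have "\<dots> \<le> C / h \<tau>" using Xlarge_second_moment[OF t0] by simp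
    finally show "(\<integral>\<omega>. L i j \<omega> \<partial>M) \<le> C / h \<tau>" .
  qed
  define r where "r \<omega> = G \<omega> / (real n)\<^sup>2 + (\<Sum>i<n. \<Sum>j<i. L i j \<omega>) / (real n)\<^sup>2" for \<omega>
  have LL_int: "integrable M (\<lambda>\<omega>. \<Sum>i<n. \<Sum>j<i. L i j \<omega>)"
    by (intro Bochner_Integration.integrable_sum L_int)
  have r_int: "integrable M r" unfolding r_def using G_int LL_int by simp
  have "(\<integral>\<omega>. r \<omega> \<partial>M) = (\<integral>\<omega>. G \<omega> \<partial>M) / (real n)\<^sup>2 + (\<integral>\<omega>. (\<Sum>i<n. \<Sum>j<i. L i j \<omega>) \<partial>M) / (real n)\<^sup>2"
    unfolding r_def using G_int LL_int by simp
  also have "\<dots> \<le> (3 * real a * B * real n * sqrt (real n)) / (real n)\<^sup>2 + ((real n)\<^sup>2 * (C / h \<tau>)) / (real n)\<^sup>2"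
  proof (intro add_mono divide_right_mono G_le)
    have "(\<integral>\<omega>. (\<Sum>i<n. \<Sum>j<i. L i j \<omega>) \<partial>M) = (\<Sum>i<n. \<integral>\<omega>. (\<Sum>j<i. L i j \<omega>) \<partial>M)"
      by (intro Bochner_Integration.integral_sum Bochner_Integration.integrable_sum L_int)
    also have "\<dots> = (\<Sum>i<n. \<Sum>j<i. \<integral>\<omega>. L i j \<omega> \<partial>M)"
      by (intro sum.cong refl Bochner_Integration.integral_sum L_int)
    also have "\<dots> \<le> (\<Sum>i<n. \<Sum>j<n. C / h \<tau>)"
    proof (intro sum_mono)
      fix i assume "i \<in> {..<n}"
      have "(\<Sum>j<i. \<integral>\<omega>. L i j \<omega> \<partial>M) \<le> (\<Sum>j<i. C / h \<tau>)" by (intro sum_mono L_le)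
      also have "\<dots> \<le> (\<Sum>j<n. C / h \<tau>)"
        using \<open>i \<in> {..<n}\<close> C_pos h_ge_1[OF t0] by (intro sum_mono2) auto
      finally show "(\<Sum>j<i. \<integral>\<omega>. L i j \<omega> \<partial>M) \<le> (\<Sum>j<n. C / h \<tau>)" .
    qed
    finally show "(\<integral>\<omega>. (\<Sum>i<n. \<Sum>j<i. L i j \<omega>) \<partial>M) \<le> (real n)\<^sup>2 * (C / h \<tau>)"
      by (simp add: power2_eq_square mult.assoc)
  qed auto
  also have "(3 * real a * B * real n * sqrt (real n)) / (real n)\<^sup>2 = 3 * real a * B * (sqrt (real n) / real n)"
    using n0 by (simp add: power2_eq_square)
  also have "sqrt (real n) / real n = 1 / sqrt (real n)" using n0 by (simp add: real_div_sqrt divide_simps)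
  finally have r_le: "(\<integral>\<omega>. r \<omega> \<partial>M) \<le> 3 * real a * (\<tau>\<^sup>2 + C) / sqrt (real n) + C / h \<tau>"
    using n0 by (simp add: B_def)
  have "AE \<omega> in M. \<forall>i j. \<bar>predicted_square \<tau> a i j \<omega> - s i j\<bar> \<le> W i j \<omega> \<and> V i j \<omega> \<le> var_gap a \<sigma> i j \<omega> + L i j \<omega>"
    using predicted_square_le V_le by (simp add: AE_all_countable)
  then have ae: "AE \<omega> in M. (\<Sum>i<n. \<Sum>j<i. \<bar>predicted_square \<tau> a i j \<omega> - 1\<bar>) / (real n)\<^sup>2 \<le> r \<omega>
      + (\<Sum>i<n. \<Sum>j<i. var_gap a \<sigma> i j \<omega>) / (real n)\<^sup>2
      + (\<Sum>i<n. \<Sum>j<i. \<bar>(\<sigma> (int i + 1) (int j + 1))\<^sup>2 - 1\<bar>) / (real n)\<^sup>2"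
  proof eventually_elim
    case (elim \<omega>)
    have "\<bar>predicted_square \<tau> a i j \<omega> - 1\<bar> \<le> (W i j \<omega> - V i j \<omega>) + (var_gap a \<sigma> i j \<omega> + (L i j \<omega> + \<bar>s i j - 1\<bar>))" for i j
      using elim[rule_format, of i j] by linarith
    then have "(\<Sum>i<n. \<Sum>j<i. \<bar>predicted_square \<tau> a i j \<omega> - 1\<bar>)
      \<le> (\<Sum>i<n. \<Sum>j<i. (W i j \<omega> - V i j \<omega>) + (var_gap a \<sigma> i j \<omega> + (L i j \<omega> + \<bar>s i j - 1\<bar>)))"
      by (intro sum_mono)
    also have "\<dots> = (\<Sum>i<n. T i \<omega>) + ((\<Sum>i<n. \<Sum>j<i. var_gap a \<sigma> i j \<omega>)
       + ((\<Sum>i<n. \<Sum>j<i. L i j \<omega>) + (\<Sum>i<n. \<Sum>j<i. \<bar>s i j - 1\<bar>)))"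
      by (simp only: sum.distrib T_def)
    also have "\<dots> \<le> G \<omega> + ((\<Sum>i<n. \<Sum>j<i. var_gap a \<sigma> i j \<omega>)
       + ((\<Sum>i<n. \<Sum>j<i. L i j \<omega>) + (\<Sum>i<n. \<Sum>j<i. \<bar>s i j - 1\<bar>)))"
      by (simp add: G_def)
    finally have "(\<Sum>i<n. \<Sum>j<i. \<bar>predicted_square \<tau> a i j \<omega> - 1\<bar>) / (real n)\<^sup>2 \<le> \<dots> / (real n)\<^sup>2"
      by (rule divide_right_mono) simp
    then show ?case by (simp add: r_def s_def add_divide_distrib)
  qed
  have r0: "0 \<le> r \<omega>" for \<omega>
    unfolding r_def G_def L_def by (intro add_nonneg_nonneg divide_nonneg_nonneg sum_nonneg) auto
  show ?thesis by (rule exI[of _ r], intro conjI allI r_int r0 r_le ae)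
qed

end

section \<open>The resolvent of the truncated matrix\<close>

context martingale_array
begin

text \<open>
  The n diagonal entries contribute O(1/n) to the normalised Frobenius distance, and with a zero
  diagonal the Schur complement is -(z + b^T R b).
\<close>

definition trunc_matrix :: "real \<Rightarrow> nat \<Rightarrow> 'a \<Rightarrow> nat \<Rightarrow> nat \<Rightarrow> real" where
  "trunc_matrix \<tau> n \<omega> j k = (if j = k then 0 else trunc_entry \<tau> (max j k) (min j k) \<omega> / sqrt (real n))"

lemma trunc_matrix_symmetric: "symmetric_entries (trunc_matrix \<tau> n \<omega>)"
  by (auto simp: symmetric_entries_def trunc_matrix_def max.commute min.commute)

lemma trunc_matrix_diag: "trunc_matrix \<tau> n \<omega> i i = 0"
  by (simp add: trunc_matrix_def)

lemma trunc_matrix_lower: "j < i \<Longrightarrow> trunc_matrix \<tau> n \<omega> j i = trunc_entry \<tau> i j \<omega> / sqrt (real n)"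
  by (simp add: trunc_matrix_def)

lemma trunc_entry_measurable_rows:
  assumes "int i + 1 \<le> r" "j \<le> i"
  shows "trunc_entry \<tau> i j \<in> borel_measurable (Alg (rows_upto r))"
  unfolding trunc_entry_def
proof (rule Xtrunc_measurable_Alg)
  show "past_indices 1 (int i + 1) (int j + 1) \<subseteq> rows_upto r"
    using past_subset_rows[of 1 "int i + 1" "int j + 1"] assms by (auto simp: rows_upto_def)
qed (use assms in \<open>auto simp: rows_upto_def\<close>)

lemma trunc_matrix_measurable_rows:
  assumes "int j < r" "int k < r"
  shows "(\<lambda>\<omega>. trunc_matrix \<tau> n \<omega> j k) \<in> borel_measurable (Alg (rows_upto r))"
proof -
  have "trunc_entry \<tau> (max j k) (min j k) \<in> borel_measurable (Alg (rows_upto r))"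
    by (rule trunc_entry_measurable_rows) (use assms in \<open>auto simp: max_def min_def\<close>)
  then show ?thesis unfolding trunc_matrix_def by measurable
qed

lemma resolvent_measurable_rows:
  assumes "m = 0 \<or> int m \<le> r"
  shows "(\<lambda>\<omega>. resolvent (trunc_matrix \<tau> n \<omega>) z m j k) \<in> borel_measurable (Alg (rows_upto r))"
  using assms
proof (induction m arbitrary: j k)
  case (Suc m)
  have R [measurable]: "(\<lambda>\<omega>. resolvent (trunc_matrix \<tau> n \<omega>) z m j k) \<in> borel_measurable (Alg (rows_upto r))" for j k
    using Suc by auto
  have A [measurable]: "(\<lambda>\<omega>. trunc_matrix \<tau> n \<omega> j k) \<in> borel_measurable (Alg (rows_upto r))" if "j \<le> m" "k \<le> m" for j k
    by (rule trunc_matrix_measurable_rows) (use Suc.prems that in auto)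
  have u: "(\<lambda>\<omega>. col_image (trunc_matrix \<tau> n \<omega>) z m j) \<in> borel_measurable (Alg (rows_upto r))" for j
    unfolding col_image_def
    by (intro borel_measurable_sum borel_measurable_times R borel_measurable_of_real A) auto
  have v: "(\<lambda>\<omega>. step_vec (trunc_matrix \<tau> n \<omega>) z m j) \<in> borel_measurable (Alg (rows_upto r))" for j
    unfolding step_vec_def by (intro borel_measurable_diff u) auto
  have S: "(\<lambda>\<omega>. schur_compl (trunc_matrix \<tau> n \<omega>) z m) \<in> borel_measurable (Alg (rows_upto r))"
    unfolding schur_compl_def
    by (intro borel_measurable_diff borel_measurable_sum borel_measurable_times u borel_measurable_of_real A
        borel_measurable_const) auto
  show ?case unfolding resolvent_Suc
    by (intro borel_measurable_add borel_measurable_divide borel_measurable_times R v S)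
qed simp

lemma resolvent_sq_measurable_rows:
  assumes "m = 0 \<or> int m \<le> r"
  shows "(\<lambda>\<omega>. resolvent_sq (trunc_matrix \<tau> n \<omega>) z m j k) \<in> borel_measurable (Alg (rows_upto r))"
  unfolding resolvent_sq_def prod_upto_def
  by (intro borel_measurable_sum borel_measurable_times resolvent_measurable_rows assms)

text \<open>
  P m stands for R or R^2 at the minor of size m. The minor of size i + 1 - a provides the older weights;
  for i + 1 < a the truncated subtraction gives size 0, where P has to be known to every algebra.
\<close>

lemma component_fluctuation:
  fixes P :: "'a \<Rightarrow> nat \<Rightarrow> nat \<Rightarrow> nat \<Rightarrow> complex" and c :: "complex \<Rightarrow> real"
  assumes c: "c = Re \<or> c = Im"
    and tau: "\<tau> \<ge> 1" and n: "n \<ge> 1" "i \<le> n" and K: "K \<ge> 1" and a: "a \<ge> 1"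
    and Pm: "\<And>m r j k. m = 0 \<or> int m \<le> r \<Longrightarrow> (\<lambda>\<omega>. P \<omega> m j k) \<in> borel_measurable (Alg (rows_upto r))"
    and Psym: "\<And>\<omega> m j k. P \<omega> m j k = P \<omega> m k j"
    and Pf: "\<And>\<omega> m. (\<Sum>j<m. \<Sum>k<m. (cmod (P \<omega> m j k))\<^sup>2) \<le> K * real m"
    and Pd: "\<And>\<omega> m j. cmod (P \<omega> m j j) \<le> K"
    and PP: "\<And>\<omega> m k. (\<Sum>j<m + k. cmod (P \<omega> (m + k) j j - P \<omega> m j j)) \<le> K * real k"
  shows "\<exists>r. integrable M r \<and> (\<forall>\<omega>. 0 \<le> r \<omega>) \<and> (\<integral>\<omega>. r \<omega> \<partial>M) \<le> 21 * K * real a * \<tau>\<^sup>2 / sqrt (real n) + 3 * K * C / h \<tau> \<and>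
    (\<forall>\<omega>. \<bar>c (quad_form (trunc_matrix \<tau> n \<omega>) i (P \<omega> i) - trace_upto i (P \<omega> i) / of_nat n)\<bar>
      \<le> r \<omega> + K / real n * (\<Sum>j<i. \<bar>predicted_square \<tau> a i j \<omega> - 1\<bar>))"
proof -
  have cle: "\<bar>c z\<bar> \<le> cmod z" for z using c abs_Re_le_cmod abs_Im_le_cmod by auto
  have cdiff: "c (x - y) = c x - c y" for x y using c by auto
  have csum: "c (sum f I) = (\<Sum>i\<in>I. c (f i))" for f :: "nat \<Rightarrow> complex" and I using c by auto
  have creal: "c (of_real x * y) = x * c y" for x y using c by auto
  have cm: "(\<lambda>\<omega>. c (f \<omega>)) \<in> borel_measurable N" if "f \<in> borel_measurable N" for f and N :: "'a measure"
    using c that by auto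
  let ?m = "i + 1 - a"
  let ?Q = "\<lambda>\<omega> j k. c (P \<omega> i j k)" and ?Q' = "\<lambda>\<omega> j. c (P \<omega> ?m j j)"
  have "\<exists>r. integrable M r \<and> (\<forall>\<omega>. 0 \<le> r \<omega>) \<and> (\<integral>\<omega>. r \<omega> \<partial>M) \<le> 21 * K * real a * \<tau>\<^sup>2 / sqrt (real n) + 3 * K * C / h \<tau> \<and>
    (\<forall>\<omega>. \<bar>(\<Sum>j<i. \<Sum>k<i. trunc_entry \<tau> i j \<omega> * trunc_entry \<tau> i k \<omega> * ?Q \<omega> j k) / real n - (\<Sum>j<i. ?Q \<omega> j j) / real n\<bar>
      \<le> r \<omega> + K / real n * (\<Sum>j<i. \<bar>predicted_square \<tau> a i j \<omega> - 1\<bar>))"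
  proof (rule row_fluctuation[OF tau n K a, where Q' = ?Q'])
    show "(\<lambda>\<omega>. c (P \<omega> i j k)) \<in> borel_measurable (Alg (rows_upto (int i)))" for j k
      by (intro cm Pm) simp
    show "c (P \<omega> i j k) = c (P \<omega> i k j)" for \<omega> j k by (simp only: Psym[of \<omega> i j k])
    show "(\<Sum>j<i. \<Sum>k<i. (c (P \<omega> i j k))\<^sup>2) \<le> K * real n" for \<omega>
    proof -
      have "(\<Sum>j<i. \<Sum>k<i. (c (P \<omega> i j k))\<^sup>2) \<le> (\<Sum>j<i. \<Sum>k<i. (cmod (P \<omega> i j k))\<^sup>2)"
        by (intro sum_mono) (metis abs_le_square_iff abs_norm_cancel cle)
      also have "\<dots> \<le> K * real i" by (rule Pf)
      also have "\<dots> \<le> K * real n" using n K by simp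
      finally show ?thesis .
    qed
    show "\<bar>c (P \<omega> i j j)\<bar> \<le> K" for \<omega> j by (rule order_trans[OF cle Pd])
    show "\<bar>c (P \<omega> ?m j j)\<bar> \<le> K" for \<omega> j by (rule order_trans[OF cle Pd])
    show "(\<lambda>\<omega>. c (P \<omega> ?m j j)) \<in> borel_measurable (Alg (rows_upto (int i + 1 - int a)))" for j
      by (intro cm Pm) auto
    show "(\<Sum>j<i. \<bar>c (P \<omega> i j j) - c (P \<omega> ?m j j)\<bar>) \<le> K * real a" for \<omega>
    proof -
      have i: "?m + (i - ?m) = i" using a by simp
      have "(\<Sum>j<i. \<bar>c (P \<omega> i j j) - c (P \<omega> ?m j j)\<bar>) \<le> (\<Sum>j<i. cmod (P \<omega> i j j - P \<omega> ?m j j))"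
        unfolding cdiff[symmetric] by (intro sum_mono cle)
      also have "\<dots> \<le> K * real (i - ?m)" using PP[of \<omega> ?m "i - ?m"] unfolding i .
      also have "\<dots> \<le> K * real a" using K by (intro mult_left_mono of_nat_mono) auto
      finally show ?thesis .
    qed
  qed
  moreover have "c (quad_form (trunc_matrix \<tau> n \<omega>) i (P \<omega> i) - trace_upto i (P \<omega> i) / of_nat n)
     = (\<Sum>j<i. \<Sum>k<i. trunc_entry \<tau> i j \<omega> * trunc_entry \<tau> i k \<omega> * ?Q \<omega> j k) / real n - (\<Sum>j<i. ?Q \<omega> j j) / real n" for \<omega>
  proof -
    have "c (quad_form (trunc_matrix \<tau> n \<omega>) i (P \<omega> i)) = (\<Sum>j<i. \<Sum>k<i. trunc_entry \<tau> i j \<omega> * trunc_entry \<tau> i k \<omega> * ?Q \<omega> j k / real n)"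
      unfolding quad_form_def csum
      by (intro sum.cong refl) (simp only: creal, simp add: trunc_matrix_lower)
    moreover have "trace_upto i (P \<omega> i) / of_nat n = of_real (1 / real n) * (\<Sum>j<i. P \<omega> i j j)"
      by (simp add: trace_upto_def)
    then have "c (trace_upto i (P \<omega> i) / of_nat n) = (\<Sum>j<i. ?Q \<omega> j j) / real n"
      by (simp only: creal csum) simp
    ultimately show ?thesis by (simp add: cdiff sum_divide_distrib)
  qed
  ultimately show ?thesis by simp
qed

lemma functional_fluctuation:
  fixes P :: "'a \<Rightarrow> nat \<Rightarrow> nat \<Rightarrow> nat \<Rightarrow> complex"
  assumes tau: "\<tau> \<ge> 1" and n: "n \<ge> 1" "i \<le> n" and K: "K \<ge> 1" and a: "a \<ge> 1"
    and P: "\<And>m r j k. m = 0 \<or> int m \<le> r \<Longrightarrow> (\<lambda>\<omega>. P \<omega> m j k) \<in> borel_measurable (Alg (rows_upto r))"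
      "\<And>\<omega> m j k. P \<omega> m j k = P \<omega> m k j"
      "\<And>\<omega> m. (\<Sum>j<m. \<Sum>k<m. (cmod (P \<omega> m j k))\<^sup>2) \<le> K * real m"
      "\<And>\<omega> m j. cmod (P \<omega> m j j) \<le> K"
      "\<And>\<omega> m k. (\<Sum>j<m + k. cmod (P \<omega> (m + k) j j - P \<omega> m j j)) \<le> K * real k"
  shows "\<exists>r. integrable M r \<and> (\<forall>\<omega>. 0 \<le> r \<omega>) \<and> (\<integral>\<omega>. r \<omega> \<partial>M) \<le> 2 * (21 * K * real a * \<tau>\<^sup>2 / sqrt (real n) + 3 * K * C / h \<tau>) \<and>
    (\<forall>\<omega>. cmod (quad_form (trunc_matrix \<tau> n \<omega>) i (P \<omega> i) - trace_upto i (P \<omega> i) / of_nat n)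
      \<le> r \<omega> + 2 * (K / real n * (\<Sum>j<i. \<bar>predicted_square \<tau> a i j \<omega> - 1\<bar>)))"
proof -
  let ?B = "21 * K * real a * \<tau>\<^sup>2 / sqrt (real n) + 3 * K * C / h \<tau>"
  let ?D = "\<lambda>\<omega>. quad_form (trunc_matrix \<tau> n \<omega>) i (P \<omega> i) - trace_upto i (P \<omega> i) / of_nat n"
  let ?Y = "\<lambda>\<omega>. K / real n * (\<Sum>j<i. \<bar>predicted_square \<tau> a i j \<omega> - 1\<bar>)"
  obtain r where r: "integrable M r" "\<And>\<omega>. 0 \<le> r \<omega>" "(\<integral>\<omega>. r \<omega> \<partial>M) \<le> ?B" "\<And>\<omega>. \<bar>Re (?D \<omega>)\<bar> \<le> r \<omega> + ?Y \<omega>"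
    using component_fluctuation[OF _ tau n K a P, of Re] by auto
  obtain s where s: "integrable M s" "\<And>\<omega>. 0 \<le> s \<omega>" "(\<integral>\<omega>. s \<omega> \<partial>M) \<le> ?B" "\<And>\<omega>. \<bar>Im (?D \<omega>)\<bar> \<le> s \<omega> + ?Y \<omega>"
    using component_fluctuation[OF _ tau n K a P, of Im] by auto
  have "cmod (?D \<omega>) \<le> (r \<omega> + s \<omega>) + 2 * ?Y \<omega>" for \<omega>
    using cmod_le[of "?D \<omega>"] r(4)[of \<omega>] s(4)[of \<omega>] by linarith
  moreover have "(\<integral>\<omega>. r \<omega> + s \<omega> \<partial>M) \<le> 2 * ?B"
    unfolding Bochner_Integration.integral_add[OF r(1) s(1)] mult_2 by (intro add_mono r s)
  moreover have "integrable M (\<lambda>\<omega>. r \<omega> + s \<omega>)" using r s by simp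
  moreover have "0 \<le> r \<omega> + s \<omega>" for \<omega> using r(2) s(2) by simp
  ultimately show ?thesis by blast
qed

lemma row_noise_fluctuation:
  fixes w :: complex
  assumes tau: "\<tau> \<ge> 1" and n: "i < n" and a: "a \<ge> 1" and w: "Im w > 0" "cmod w > 1"
  defines "\<eta> \<equiv> Im w * (1 - 1 / (cmod w)\<^sup>2)"
  defines "K \<equiv> 3 * (1 + 1 / \<eta>) ^ 4"
  shows "\<exists>r. integrable M r \<and> (\<forall>\<omega>. 0 \<le> r \<omega>) \<and> (\<integral>\<omega>. r \<omega> \<partial>M) \<le> 4 * (21 * K * real a * \<tau>\<^sup>2 / sqrt (real n) + 3 * K * C / h \<tau>) \<and>
    (\<forall>\<omega>. row_noise w n (trunc_matrix \<tau> n \<omega>) i \<le> r \<omega> + 4 * (K / real n * (\<Sum>j<i. \<bar>predicted_square \<tau> a i j \<omega> - 1\<bar>)))"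
proof -
  have eta: "\<eta> > 0" unfolding \<eta>_def by (rule characteristic_height_pos[OF w])
  define z where "z = characteristic w n (Suc i)"
  have z: "Im z \<ge> \<eta>" unfolding z_def \<eta>_def by (rule Im_characteristic_ge[OF w(1)]) (use n in simp)
  have z0: "Im z > 0" using z eta by linarith
  define b where "b = 1 + 1 / \<eta>"
  have b1: "b \<ge> 1" using eta by (simp add: b_def)
  have iz: "1 / Im z \<le> b" "1 / Im z \<ge> 0"
  proof -
    have "1 / Im z \<le> 1 / \<eta>" using z eta by (intro divide_left_mono) auto
    then show "1 / Im z \<le> b" by (simp add: b_def)
    show "1 / Im z \<ge> 0" using z0 by simp
  qed
  have izp: "c / (Im z)^p \<le> K" if "p \<le> 4" "0 \<le> c" "c \<le> 3" for c p
  proof -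
    have "c / (Im z)^p = c * (1 / Im z)^p" by (simp add: power_divide)
    also have "\<dots> \<le> 3 * b^p" using that iz by (intro mult_mono power_mono) auto
    also have "\<dots> \<le> 3 * b^4" using that b1 by (intro mult_left_mono power_increasing) auto
    finally show ?thesis by (simp add: K_def b_def)
  qed
  have K1: "K \<ge> 1" using one_le_power[OF b1, of 4] by (simp add: K_def b_def)
  let ?B = "21 * K * real a * \<tau>\<^sup>2 / sqrt (real n) + 3 * K * C / h \<tau>"
  let ?Y = "\<lambda>\<omega>. 2 * (K / real n * (\<Sum>j<i. \<bar>predicted_square \<tau> a i j \<omega> - 1\<bar>))"
  note S = trunc_matrix_symmetric[of \<tau> n]
  have "\<exists>r. integrable M r \<and> (\<forall>\<omega>. 0 \<le> r \<omega>) \<and> (\<integral>\<omega>. r \<omega> \<partial>M) \<le> 2 * ?B \<and>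
    (\<forall>\<omega>. cmod (quad_form (trunc_matrix \<tau> n \<omega>) i (resolvent (trunc_matrix \<tau> n \<omega>) z i) - trace_upto i (resolvent (trunc_matrix \<tau> n \<omega>) z i) / of_nat n)
      \<le> r \<omega> + ?Y \<omega>)"
  proof (rule functional_fluctuation[OF tau _ _ K1 a, where P = "\<lambda>\<omega>. resolvent (trunc_matrix \<tau> n \<omega>) z"])
    show "(\<lambda>\<omega>. resolvent (trunc_matrix \<tau> n \<omega>) z m j k) \<in> borel_measurable (Alg (rows_upto r))" if "m = 0 \<or> int m \<le> r" for m r j k
      by (rule resolvent_measurable_rows[OF that])
    show "(\<Sum>j<m. \<Sum>k<m. (cmod (resolvent (trunc_matrix \<tau> n \<omega>) z m j k))\<^sup>2) \<le> K * real m" for \<omega> m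
      using resolvent_frobenius[OF S z0, of \<omega> m] mult_right_mono[OF izp[of 2 1], of "real m"] by simp
    show "cmod (resolvent (trunc_matrix \<tau> n \<omega>) z m j j) \<le> K" for \<omega> m j
      using resolvent_entry_norm[OF S z0, of \<omega> m j j] izp[of 1 1] by simp
    show "(\<Sum>j<m + k. cmod (resolvent (trunc_matrix \<tau> n \<omega>) z (m + k) j j - resolvent (trunc_matrix \<tau> n \<omega>) z m j j)) \<le> K * real k" for \<omega> m k
      using resolvent_diag_steps_le[OF S z0, of \<omega> m k] mult_right_mono[OF izp[of 1 1], of "real k"] by simp
  qed (use n resolvent_sym in auto)
  then obtain r where r: "integrable M r" "\<And>\<omega>. 0 \<le> r \<omega>" "(\<integral>\<omega>. r \<omega> \<partial>M) \<le> 2 * ?B"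
    "\<And>\<omega>. cmod (quad_form (trunc_matrix \<tau> n \<omega>) i (resolvent (trunc_matrix \<tau> n \<omega>) z i) - trace_upto i (resolvent (trunc_matrix \<tau> n \<omega>) z i) / of_nat n) \<le> r \<omega> + ?Y \<omega>"
    by blast
  have "\<exists>r. integrable M r \<and> (\<forall>\<omega>. 0 \<le> r \<omega>) \<and> (\<integral>\<omega>. r \<omega> \<partial>M) \<le> 2 * ?B \<and>
    (\<forall>\<omega>. cmod (quad_form (trunc_matrix \<tau> n \<omega>) i (resolvent_sq (trunc_matrix \<tau> n \<omega>) z i) - trace_upto i (resolvent_sq (trunc_matrix \<tau> n \<omega>) z i) / of_nat n)
      \<le> r \<omega> + ?Y \<omega>)"
  proof (rule functional_fluctuation[OF tau _ _ K1 a, where P = "\<lambda>\<omega>. resolvent_sq (trunc_matrix \<tau> n \<omega>) z"])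
    show "(\<lambda>\<omega>. resolvent_sq (trunc_matrix \<tau> n \<omega>) z m j k) \<in> borel_measurable (Alg (rows_upto r))" if "m = 0 \<or> int m \<le> r" for m r j k
      by (rule resolvent_sq_measurable_rows[OF that])
    show "(\<Sum>j<m. \<Sum>k<m. (cmod (resolvent_sq (trunc_matrix \<tau> n \<omega>) z m j k))\<^sup>2) \<le> K * real m" for \<omega> m
      using resolvent_sq_frobenius[OF S z0, of \<omega> m] mult_right_mono[OF izp[of 4 1], of "real m"] by simp
    show "cmod (resolvent_sq (trunc_matrix \<tau> n \<omega>) z m j j) \<le> K" for \<omega> m j
      using resolvent_sq_diag_norm[OF S z0, of \<omega> m j] izp[of 2 1] by simp
    show "(\<Sum>j<m + k. cmod (resolvent_sq (trunc_matrix \<tau> n \<omega>) z (m + k) j j - resolvent_sq (trunc_matrix \<tau> n \<omega>) z m j j)) \<le> K * real k" for \<omega> m k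
      using resolvent_sq_diag_steps_le[OF S z0, of \<omega> m k] mult_right_mono[OF izp[of 2 3], of "real k"]
      by (simp add: mult.commute)
  qed (use n resolvent_sq_sym in auto)
  then obtain s where s: "integrable M s" "\<And>\<omega>. 0 \<le> s \<omega>" "(\<integral>\<omega>. s \<omega> \<partial>M) \<le> 2 * ?B"
    "\<And>\<omega>. cmod (quad_form (trunc_matrix \<tau> n \<omega>) i (resolvent_sq (trunc_matrix \<tau> n \<omega>) z i) - trace_upto i (resolvent_sq (trunc_matrix \<tau> n \<omega>) z i) / of_nat n) \<le> s \<omega> + ?Y \<omega>"
    by blast
  have "row_noise w n (trunc_matrix \<tau> n \<omega>) i \<le> (r \<omega> + s \<omega>) + 4 * (K / real n * (\<Sum>j<i. \<bar>predicted_square \<tau> a i j \<omega> - 1\<bar>))" for \<omega>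
    using r(4)[of \<omega>] s(4)[of \<omega>] unfolding row_noise_def z_def[symmetric] by linarith
  moreover have "(\<integral>\<omega>. r \<omega> + s \<omega> \<partial>M) \<le> 4 * ?B"
  proof -
    have "(\<integral>\<omega>. r \<omega> + s \<omega> \<partial>M) \<le> 2 * ?B + 2 * ?B"
      unfolding Bochner_Integration.integral_add[OF r(1) s(1)] by (intro add_mono r s)
    moreover have "2 * x + 2 * x = 4 * x" for x :: real by simp
    ultimately show ?thesis by (simp only:)
  qed
  moreover have "integrable M (\<lambda>\<omega>. r \<omega> + s \<omega>)" using r s by simp
  moreover have "0 \<le> r \<omega> + s \<omega>" for \<omega> using r(2) s(2) by simp
  ultimately show ?thesis by blast
qed

text \<open>
  The constant c does not depend on the lag a, while D does. Therefore a can be sent to infinity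
  after n.
\<close>

lemma truncated_resolvent_fluctuation:
  fixes w :: complex
  assumes w: "Im w > 0" "cmod w > 1"
    and var: "\<And>i j. (\<integral>\<omega>. (X i j \<omega>)\<^sup>2 \<partial>M) = (\<sigma> i j)\<^sup>2"
  shows "\<exists>c\<ge>0. \<forall>a\<ge>1. \<exists>D\<ge>0. \<forall>\<tau>\<ge>1. \<forall>n\<ge>1. \<exists>r. integrable M r \<and> (\<forall>\<omega>. 0 \<le> r \<omega>) \<and>
      (\<integral>\<omega>. r \<omega> \<partial>M) \<le> D * (\<tau>\<^sup>2 / sqrt (real n) + 1 / h \<tau>) \<and>
    (AE \<omega> in M. cmod (trace_upto n (resolvent (trunc_matrix \<tau> n \<omega>) (w + 1 / w) n) / of_nat n + 1 / w) \<le> r \<omega>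
      + c * ((\<Sum>i<n. \<Sum>j<i. var_gap a \<sigma> i j \<omega>) / (real n)\<^sup>2
      + (\<Sum>i<n. \<Sum>j<i. \<bar>(\<sigma> (int i + 1) (int j + 1))\<^sup>2 - 1\<bar>) / (real n)\<^sup>2))"
proof -
  define \<eta> where "\<eta> = Im w * (1 - 1 / (cmod w)\<^sup>2)"
  define K where "K = 3 * (1 + 1 / \<eta>) ^ 4"
  define c where "c = 1 + 1 / \<eta>\<^sup>2"
  define \<alpha> where "\<alpha> = exp (c / \<eta>) * (1 / \<eta> + c / \<eta>\<^sup>2)"
  define \<beta> where "\<beta> = exp (c / \<eta>) * (c\<^sup>2 / \<eta> + 1 / \<eta>^3)"
  have eta: "\<eta> > 0" unfolding \<eta>_def by (rule characteristic_height_pos[OF w])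
  have nn: "\<alpha> \<ge> 0" "\<beta> \<ge> 0" "K \<ge> 0" using eta by (auto simp: \<alpha>_def \<beta>_def K_def c_def)
  show ?thesis
  proof (rule exI[of _ "\<alpha> * (4 * K)"], intro conjI allI impI)
    show "\<alpha> * (4 * K) \<ge> 0" using nn by simp
    fix a :: nat assume a: "a \<ge> 1"
    define D where "D = \<alpha> * (84 * K * real a + 12 * K * C + 4 * K * (3 * real a * (1 + C) + C)) + \<beta>"
    show "\<exists>D\<ge>0. \<forall>\<tau>\<ge>1. \<forall>n\<ge>1. \<exists>r. integrable M r \<and> (\<forall>\<omega>. 0 \<le> r \<omega>) \<and>
      (\<integral>\<omega>. r \<omega> \<partial>M) \<le> D * (\<tau>\<^sup>2 / sqrt (real n) + 1 / h \<tau>) \<and>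
      (AE \<omega> in M. cmod (trace_upto n (resolvent (trunc_matrix \<tau> n \<omega>) (w + 1 / w) n) / of_nat n + 1 / w) \<le> r \<omega>
        + \<alpha> * (4 * K) * ((\<Sum>i<n. \<Sum>j<i. var_gap a \<sigma> i j \<omega>) / (real n)\<^sup>2
        + (\<Sum>i<n. \<Sum>j<i. \<bar>(\<sigma> (int i + 1) (int j + 1))\<^sup>2 - 1\<bar>) / (real n)\<^sup>2))"
    proof (rule exI[of _ D], intro conjI allI impI)
      show "D \<ge> 0" using nn C_pos by (simp add: D_def)
      fix \<tau> :: real and n :: nat assume tau: "\<tau> \<ge> 1" and n: "n \<ge> 1"
      have n0: "real n > 0" using n by simp
      have h1: "h \<tau> \<ge> 1" using tau by (intro h_ge_1) simp
      let ?B = "4 * (21 * K * real a * \<tau>\<^sup>2 / sqrt (real n) + 3 * K * C / h \<tau>)"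
      have "\<forall>i\<in>{..<n}. \<exists>r. integrable M r \<and> (\<forall>\<omega>. 0 \<le> r \<omega>) \<and> (\<integral>\<omega>. r \<omega> \<partial>M) \<le> ?B \<and>
        (\<forall>\<omega>. row_noise w n (trunc_matrix \<tau> n \<omega>) i \<le> r \<omega> + 4 * (K / real n * (\<Sum>j<i. \<bar>predicted_square \<tau> a i j \<omega> - 1\<bar>)))"
        unfolding K_def \<eta>_def by (intro ballI row_noise_fluctuation tau a w) simp
      then obtain r where r: "\<And>i. i < n \<Longrightarrow> integrable M (r i)" "\<And>i \<omega>. i < n \<Longrightarrow> 0 \<le> r i \<omega>" "\<And>i. i < n \<Longrightarrow> (\<integral>\<omega>. r i \<omega> \<partial>M) \<le> ?B"
        "\<And>i \<omega>. i < n \<Longrightarrow> row_noise w n (trunc_matrix \<tau> n \<omega>) i \<le> r i \<omega> + 4 * (K / real n * (\<Sum>j<i. \<bar>predicted_square \<tau> a i j \<omega> - 1\<bar>))"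
        unfolding bchoice_iff by auto
      obtain s where s: "integrable M s" "\<And>\<omega>. 0 \<le> s \<omega>" "(\<integral>\<omega>. s \<omega> \<partial>M) \<le> 3 * real a * (\<tau>\<^sup>2 + C) / sqrt (real n) + C / h \<tau>"
        "AE \<omega> in M. (\<Sum>i<n. \<Sum>j<i. \<bar>predicted_square \<tau> a i j \<omega> - 1\<bar>) / (real n)\<^sup>2 \<le> s \<omega>
          + (\<Sum>i<n. \<Sum>j<i. var_gap a \<sigma> i j \<omega>) / (real n)\<^sup>2
          + (\<Sum>i<n. \<Sum>j<i. \<bar>(\<sigma> (int i + 1) (int j + 1))\<^sup>2 - 1\<bar>) / (real n)\<^sup>2"
        using conditional_variance_fluctuation[OF tau n a var] by blast
      define t where "t \<omega> = \<alpha> * ((\<Sum>i<n. r i \<omega>) / real n + 4 * K * s \<omega>) + \<beta> / real n" for \<omega>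
      have ri: "integrable M (\<lambda>\<omega>. \<Sum>i<n. r i \<omega>)" by (intro Bochner_Integration.integrable_sum r) auto
      have ti: "integrable M t" unfolding t_def using ri s(1) by simp
      have t0: "0 \<le> t \<omega>" for \<omega>
        unfolding t_def using nn r(2) s(2)
        by (intro add_nonneg_nonneg mult_nonneg_nonneg divide_nonneg_nonneg sum_nonneg) auto
      let ?q = "\<tau>\<^sup>2 / sqrt (real n)"
      have q: "?q \<ge> 0" by simp
      have tt: "\<tau>\<^sup>2 \<ge> 1" using tau by simp
      have rB: "(\<integral>\<omega>. (\<Sum>i<n. r i \<omega>) \<partial>M) \<le> real n * ?B"
      proof -
        have "(\<integral>\<omega>. (\<Sum>i<n. r i \<omega>) \<partial>M) = (\<Sum>i<n. \<integral>\<omega>. r i \<omega> \<partial>M)"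
          by (intro Bochner_Integration.integral_sum r) auto
        also have "\<dots> \<le> (\<Sum>i<n. ?B)" by (intro sum_mono r) auto
        finally show ?thesis by simp
      qed
      have "(\<integral>\<omega>. t \<omega> \<partial>M) = \<alpha> * ((\<integral>\<omega>. (\<Sum>i<n. r i \<omega>) \<partial>M) / real n + 4 * K * (\<integral>\<omega>. s \<omega> \<partial>M)) + \<beta> / real n"
        unfolding t_def using ri s(1) by (simp add: prob_space)
      also have "\<dots> \<le> \<alpha> * ((real n * ?B) / real n + 4 * K * (3 * real a * (\<tau>\<^sup>2 + C) / sqrt (real n) + C / h \<tau>)) + \<beta> / real n"
        using nn n0 by (intro add_right_mono mult_left_mono add_mono divide_right_mono rB s) auto
      also have "(real n * ?B) / real n = ?B" using n0 by simp
      also have "?B = 84 * K * real a * ?q + 12 * K * C * (1 / h \<tau>)" by (simp add: algebra_simps)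
      also have "\<alpha> * (84 * K * real a * ?q + 12 * K * C * (1 / h \<tau>) + 4 * K * (3 * real a * (\<tau>\<^sup>2 + C) / sqrt (real n) + C / h \<tau>)) + \<beta> / real n
        \<le> \<alpha> * (84 * K * real a * (?q + 1 / h \<tau>) + 12 * K * C * (?q + 1 / h \<tau>)
            + 4 * K * (3 * real a * (1 + C) * (?q + 1 / h \<tau>) + C * (?q + 1 / h \<tau>))) + \<beta> * (?q + 1 / h \<tau>)"
      proof (intro add_mono mult_left_mono)
        have "(\<tau>\<^sup>2 + C) \<le> (1 + C) * \<tau>\<^sup>2" using tt C_pos by (simp add: algebra_simps)
        then have "3 * real a * (\<tau>\<^sup>2 + C) / sqrt (real n) \<le> 3 * real a * ((1 + C) * \<tau>\<^sup>2) / sqrt (real n)"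
          by (intro divide_right_mono mult_left_mono) auto
        also have "\<dots> = 3 * real a * (1 + C) * ?q" by simp
        also have "\<dots> \<le> 3 * real a * (1 + C) * (?q + 1 / h \<tau>)"
          using h1 C_pos by (intro mult_left_mono) auto
        finally show "3 * real a * (\<tau>\<^sup>2 + C) / sqrt (real n) \<le> 3 * real a * (1 + C) * (?q + 1 / h \<tau>)" .
        show "C / h \<tau> \<le> C * (?q + 1 / h \<tau>)"
          using C_pos q by (simp add: distrib_left)
        have sq: "sqrt (real n) \<le> real n"
          using n real_sqrt_le_mono[of "real n" "real n * real n"] by simp
        have "1 / real n \<le> \<tau>\<^sup>2 / sqrt (real n)" using tt sq n0 by (intro frac_le) auto
        then have "1 / real n \<le> ?q + 1 / h \<tau>" using h1 by (simp add: add_increasing2)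
        then show "\<beta> / real n \<le> \<beta> * (?q + 1 / h \<tau>)"
          using mult_left_mono[OF _ nn(2)] by fastforce
      qed (use nn h1 C_pos q in auto)
      also have "\<dots> = D * (?q + 1 / h \<tau>)" unfolding D_def by (simp only: distrib_right distrib_left mult.assoc)
      finally have t_le: "(\<integral>\<omega>. t \<omega> \<partial>M) \<le> D * (\<tau>\<^sup>2 / sqrt (real n) + 1 / h \<tau>)" .
      have ae: "AE \<omega> in M. cmod (trace_upto n (resolvent (trunc_matrix \<tau> n \<omega>) (w + 1 / w) n) / of_nat n + 1 / w) \<le> t \<omega>
        + \<alpha> * (4 * K) * ((\<Sum>i<n. \<Sum>j<i. var_gap a \<sigma> i j \<omega>) / (real n)\<^sup>2
        + (\<Sum>i<n. \<Sum>j<i. \<bar>(\<sigma> (int i + 1) (int j + 1))\<^sup>2 - 1\<bar>) / (real n)\<^sup>2)"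
        using s(4)
      proof eventually_elim
        case (elim \<omega>)
        let ?A = "trunc_matrix \<tau> n \<omega>"
        let ?y = "\<lambda>i. \<Sum>j<i. \<bar>predicted_square \<tau> a i j \<omega> - 1\<bar>"
        let ?E = "(\<Sum>i<n. \<Sum>j<i. var_gap a \<sigma> i j \<omega>) / (real n)\<^sup>2
          + (\<Sum>i<n. \<Sum>j<i. \<bar>(\<sigma> (int i + 1) (int j + 1))\<^sup>2 - 1\<bar>) / (real n)\<^sup>2"
        have "(\<Sum>i<n. row_noise w n ?A i) \<le> (\<Sum>i<n. r i \<omega> + 4 * (K / real n * ?y i))"
          by (intro sum_mono r) auto
        also have "\<dots> = (\<Sum>i<n. r i \<omega>) + 4 * (K / real n * (\<Sum>i<n. ?y i))"
          by (simp only: sum.distrib sum_distrib_left)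
        finally have "(\<Sum>i<n. row_noise w n ?A i) / real n \<le> ((\<Sum>i<n. r i \<omega>) + 4 * (K / real n * (\<Sum>i<n. ?y i))) / real n"
          by (rule divide_right_mono) simp
        also have "\<dots> = (\<Sum>i<n. r i \<omega>) / real n + 4 * K * ((\<Sum>i<n. ?y i) / (real n)\<^sup>2)"
          by (simp add: add_divide_distrib power2_eq_square)
        also have "\<dots> \<le> (\<Sum>i<n. r i \<omega>) / real n + 4 * K * (s \<omega> + ?E)"
          using nn elim by (intro add_left_mono mult_left_mono) auto
        finally have N: "(\<Sum>i<n. row_noise w n ?A i) / real n \<le> (\<Sum>i<n. r i \<omega>) / real n + 4 * K * (s \<omega> + ?E)" .
        have "cmod (trace_upto n (resolvent ?A (w + 1 / w) n) / of_nat n + 1 / w)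
           \<le> \<alpha> * ((\<Sum>i<n. row_noise w n ?A i) / real n) + \<beta> / real n"
          using resolvent_dynamics[OF trunc_matrix_symmetric trunc_matrix_diag w, of n \<tau> n \<omega>] n
          unfolding \<alpha>_def \<beta>_def c_def \<eta>_def by (simp add: algebra_simps)
        also have "\<dots> \<le> \<alpha> * ((\<Sum>i<n. r i \<omega>) / real n + 4 * K * (s \<omega> + ?E)) + \<beta> / real n"
          by (intro add_right_mono mult_left_mono N nn)
        also have "\<dots> = t \<omega> + \<alpha> * (4 * K) * ?E"
          unfolding t_def by (simp only: distrib_left distrib_right mult.assoc add_ac)
        finally show ?case .
      qed
      show "\<exists>r. integrable M r \<and> (\<forall>\<omega>. 0 \<le> r \<omega>) \<and>
      (\<integral>\<omega>. r \<omega> \<partial>M) \<le> D * (\<tau>\<^sup>2 / sqrt (real n) + 1 / h \<tau>) \<and>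
      (AE \<omega> in M. cmod (trace_upto n (resolvent (trunc_matrix \<tau> n \<omega>) (w + 1 / w) n) / of_nat n + 1 / w) \<le> r \<omega>
        + \<alpha> * (4 * K) * ((\<Sum>i<n. \<Sum>j<i. var_gap a \<sigma> i j \<omega>) / (real n)\<^sup>2
        + (\<Sum>i<n. \<Sum>j<i. \<bar>(\<sigma> (int i + 1) (int j + 1))\<^sup>2 - 1\<bar>) / (real n)\<^sup>2))"
        by (rule exI[of _ t], intro conjI allI ti t0 t_le ae)
    qed
  qed
qed

definition entry_matrix :: "nat \<Rightarrow> 'a \<Rightarrow> nat \<Rightarrow> nat \<Rightarrow> real" where
  "entry_matrix n \<omega> j k = X (int (max j k) + 1) (int (min j k) + 1) \<omega> / sqrt (real n)"

lemma entry_matrix_symmetric: "symmetric_entries (entry_matrix n \<omega>)"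
  by (auto simp: symmetric_entries_def entry_matrix_def max.commute min.commute)

lemma truncation_frobenius:
  assumes tau: "\<tau> \<ge> 1" and n: "n \<ge> 1"
  defines "d \<equiv> \<lambda>\<omega>. (\<Sum>j<n. \<Sum>k<n. (entry_matrix n \<omega> j k - trunc_matrix \<tau> n \<omega> j k)\<^sup>2) / real n"
  shows "integrable M d" and "(\<integral>\<omega>. d \<omega> \<partial>M) \<le> C / real n + 4 * C / h \<tau>"
proof -
  have t0: "\<tau> \<ge> 0" using tau by simp
  have n0: "real n > 0" using n by simp
  let ?D = "\<lambda>j k \<omega>. (entry_matrix n \<omega> j k - trunc_matrix \<tau> n \<omega> j k)\<^sup>2"
  have entry: "integrable M (?D j k) \<and> (\<integral>\<omega>. ?D j k \<omega> \<partial>M) \<le> (if j = k then C else 0) / real n + 4 * C / h \<tau> / real n" for j k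
  proof (cases "j = k")
    case True
    have eq: "?D j k \<omega> = (X (int k + 1) (int k + 1) \<omega>)\<^sup>2 / real n" for \<omega>
      using True by (simp add: entry_matrix_def trunc_matrix_def power_divide)
    have "0 \<le> 4 * C / h \<tau> / real n" using C_pos h_ge_1[OF t0] by simp
    then show ?thesis unfolding eq using True X_square_integrable X_second_moment[of "int k + 1" "int k + 1"]
      by (auto simp: divide_right_mono add_increasing2)
  next
    case False
    define i l where "i = int (max j k) + 1" and "l = int (min j k) + 1"
    have eq: "?D j k \<omega> = (X i l \<omega> - Xtrunc \<tau> i l \<omega>)\<^sup>2 / real n" for \<omega>
      using False by (simp add: entry_matrix_def trunc_matrix_def trunc_entry_def i_def l_def power_divide flip: diff_divide_distrib)
    have "1 \<le> l" "l \<le> i" by (auto simp: i_def l_def)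
    note te = truncation_error[OF t0 this]
    show ?thesis unfolding eq using False te(1) divide_right_mono[OF te(2), of "real n"] by simp
  qed
  show "integrable M d" unfolding d_def
    by (intro integrable_divide Bochner_Integration.integrable_sum) (use entry in auto)
  have "(\<integral>\<omega>. d \<omega> \<partial>M) = (\<Sum>j<n. \<Sum>k<n. \<integral>\<omega>. ?D j k \<omega> \<partial>M) / real n"
    unfolding d_def integral_divide_zero
    by (intro arg_cong2[where f = "(/)"] integral_double_sum refl) (use entry in auto)
  also have "\<dots> \<le> (\<Sum>j<n. \<Sum>k<n. (if j = k then C else 0) / real n + 4 * C / h \<tau> / real n) / real n"
    by (intro divide_right_mono sum_mono) (use entry in auto)
  also have "\<dots> = C / real n + 4 * C / h \<tau>"
    using n0 by (simp add: sum.distrib field_simps flip: sum_divide_distrib)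
  finally show "(\<integral>\<omega>. d \<omega> \<partial>M) \<le> C / real n + 4 * C / h \<tau>" .
qed

end

section \<open>Eigenvalues and the trace of the resolvent\<close>

lemma map_poly_of_real_inj:
  fixes p q :: "real poly"
  assumes "map_poly complex_of_real p = map_poly complex_of_real q"
  shows "p = q"
proof (rule poly_eqI)
  fix k
  have "coeff (map_poly complex_of_real p) k = coeff (map_poly complex_of_real q) k" using assms by simp
  then show "coeff p k = coeff q k" by (simp add: coeff_map_poly)
qed

lemma map_poly_of_real_mult:
  "map_poly complex_of_real (p * q) = map_poly complex_of_real p * map_poly complex_of_real q"
  by (rule poly_eqI) (simp add: coeff_map_poly coeff_mult)

text \<open>
  An eigenvector for a complex root is a solution of (A - z) y = 0, and the identity for the imaginary
  part of the quadratic form then forces Im z = 0.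
\<close>

lemma symmetric_char_poly_splits:
  fixes a :: "nat \<Rightarrow> nat \<Rightarrow> real" and n :: nat
  assumes S: "symmetric_entries a"
  defines "A \<equiv> mat n n (\<lambda>(r, c). a r c)"
  obtains ls where "length ls = n" "char_poly A = (\<Prod>l\<leftarrow>ls. [:- l, 1:])"
proof -
  have A: "A \<in> carrier_mat n n" by (simp add: A_def)
  define B where "B = map_mat complex_of_real A"
  have B: "B \<in> carrier_mat n n" using A by (simp add: B_def)
  obtain as where as: "char_poly B = (\<Prod>l\<leftarrow>as. [:- l, 1:])" "length as = n"
    using char_poly_factorized[OF B] by blast
  have im: "Im e = 0" if e: "e \<in> set as" for e
  proof -
    have "poly (char_poly B) e = 0" unfolding as(1) by (rule linear_poly_root[OF e])
    then have "eigenvalue B e" using eigenvalue_root_char_poly[OF B] by simp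
    then obtain v where v: "v \<in> carrier_vec n" "v \<noteq> 0\<^sub>v n" "B *\<^sub>v v = e \<cdot>\<^sub>v v"
      using B by (auto simp: eigenvalue_def eigenvector_def)
    have "(\<Sum>l<n. of_real (a j l) * v $ l) - e * v $ j = 0" if j: "j < n" for j
    proof -
      have "(B *\<^sub>v v) $ j = (\<Sum>l<n. of_real (a j l) * v $ l)"
        using j v(1) B by (auto simp: scalar_prod_def B_def A_def atLeast0LessThan intro!: sum.cong)
      moreover have "(B *\<^sub>v v) $ j = e * v $ j" using j v(1) unfolding v(3) by simp
      ultimately show ?thesis by simp
    qed
    then have "Im (\<Sum>j<n. cnj 0 * v $ j) = Im e * (\<Sum>j<n. (cmod (v $ j))\<^sup>2)"
      by (rule Im_quadratic_form[OF S])
    moreover have "(\<Sum>j<n. (cmod (v $ j))\<^sup>2) \<noteq> 0"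
    proof
      assume "(\<Sum>j<n. (cmod (v $ j))\<^sup>2) = 0"
      then have "\<forall>j<n. v $ j = 0" by (simp add: sum_nonneg_eq_0_iff)
      then have "v = 0\<^sub>v n" using v(1) by (intro eq_vecI) auto
      then show False using v(2) by simp
    qed
    ultimately show ?thesis by simp
  qed
  define ls where "ls = map Re as"
  have "map_poly complex_of_real (char_poly A) = char_poly B"
    unfolding B_def by (rule of_real_hom.char_poly_hom[OF A, symmetric])
  also have "\<dots> = (\<Prod>l\<leftarrow>ls. map_poly complex_of_real [:- l, 1:])"
  proof -
    have "map (\<lambda>l. [:- l, 1:]) as = map (\<lambda>l. map_poly complex_of_real [:- l, 1:]) ls"
      unfolding ls_def map_map
      by (intro map_cong refl) (use im in \<open>auto simp: complex_eq_iff map_poly_pCons\<close>)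
    then show ?thesis unfolding as(1) by simp
  qed
  also have "\<dots> = map_poly complex_of_real (\<Prod>l\<leftarrow>ls. [:- l, 1:])"
  proof (induction ls)
    case (Cons l ls)
    have "map_poly complex_of_real (p * q) = map_poly complex_of_real p * map_poly complex_of_real q" for p q
      by (rule map_poly_of_real_mult)
    then show ?case using Cons by (simp del: mult_pCons_left)
  qed simp
  finally have "char_poly A = (\<Prod>l\<leftarrow>ls. [:- l, 1:])" by (rule map_poly_of_real_inj)
  moreover have "length ls = n" using as(2) by (simp add: ls_def)
  ultimately show thesis using that by blast
qed

lemma pderiv_prod_linear:
  fixes ls :: "complex list"
  assumes "z \<notin> set ls"
  shows "poly (pderiv (\<Prod>l\<leftarrow>ls. [:- l, 1:])) z = poly (\<Prod>l\<leftarrow>ls. [:- l, 1:]) z * (\<Sum>l\<leftarrow>ls. 1 / (z - l))"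
  using assms
proof (induction ls)
  case (Cons l ls)
  then show ?case by (simp add: pderiv_mult pderiv_pCons field_simps del: mult_pCons_left)
qed simp

text \<open>
  The derivative of the characteristic polynomial is the sum of the diagonal cofactors, and by
  Cramer's rule these are det(z - A) times the diagonal entries of the inverse of z - A. So the trace of
  the resolvent is minus the logarithmic derivative, which the factorisation turns into a sum over the
  eigenvalues.
\<close>

lemma trace_resolvent_eigenvalues:
  fixes a :: "nat \<Rightarrow> nat \<Rightarrow> real" and n :: nat
  assumes S: "symmetric_entries a" and z: "Im z > 0"
  defines "A \<equiv> mat n n (\<lambda>(r, c). a r c)"
  assumes ls: "char_poly A = (\<Prod>l\<leftarrow>ls. [:- l, 1:])"
  shows "trace_upto n (resolvent a z n) = (\<Sum>l\<leftarrow>ls. 1 / (of_real l - z))"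
proof -
  have A: "A \<in> carrier_mat n n" by (simp add: A_def)
  define B where "B = map_mat complex_of_real A"
  have B: "B \<in> carrier_mat n n" using A by (simp add: B_def)
  define p where "p = char_poly B"
  define T where "T = - (char_matrix B z)"
  have T: "T \<in> carrier_mat n n" using B by (simp add: T_def char_matrix_def)
  have pz: "poly p z = det T" unfolding p_def T_def by (rule char_poly_matrix[OF B])
  have Te: "T $$ (i, j) = (if i = j then z else 0) - of_real (a i j)" if "i < n" "j < n" for i j
    using that B by (simp add: T_def char_matrix_def B_def A_def)
  define R where "R = mat n n (\<lambda>(i, j). - resolvent a z n i j)"
  have R: "R \<in> carrier_mat n n" by (simp add: R_def)
  have TR: "T * R = 1\<^sub>m n"
  proof (rule eq_matI)
    fix i j assume ij: "i < dim_row (1\<^sub>m n :: complex mat)" "j < dim_col (1\<^sub>m n :: complex mat)"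
    then have ij': "i < n" "j < n" by auto
    have "(T * R) $$ (i, j) = (\<Sum>l<n. ((if i = l then z else 0) - of_real (a i l)) * (- resolvent a z n l j))"
      using ij' T R by (auto simp: scalar_prod_def R_def Te atLeast0LessThan intro!: sum.cong)
    also have "\<dots> = (\<Sum>l<n. of_real (a i l) * resolvent a z n l j) - (\<Sum>l<n. (if l = i then z * resolvent a z n i j else 0))"
      unfolding sum_subtractf[symmetric] by (intro sum.cong refl) (auto simp: algebra_simps)
    also have "\<dots> = (\<Sum>l<n. of_real (a i l) * resolvent a z n l j) - z * resolvent a z n i j" using ij' by simp
    also have "\<dots> = (if i = j then 1 else 0)" by (rule resolvent_equation[OF S z ij'])
    finally show "(T * R) $$ (i, j) = 1\<^sub>m n $$ (i, j)" using ij' by simp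
  qed (use T R in auto)
  have adj: "adj_mat T = det T \<cdot>\<^sub>m R"
  proof -
    have "adj_mat T = adj_mat T * (T * R)" using adj_mat(1)[OF T] by (simp add: TR)
    also have "\<dots> = (adj_mat T * T) * R" using adj_mat(1)[OF T] T R by (simp add: assoc_mult_mat)
    also have "\<dots> = det T \<cdot>\<^sub>m R" using R by (simp add: adj_mat(3)[OF T] mult_smult_assoc_mat[of _ n n])
    finally show ?thesis .
  qed
  have minor: "poly (char_poly (mat_delete B i i)) z = det T * (- resolvent a z n i i)" if i: "i < n" for i
  proof -
    have D: "mat_delete B i i \<in> carrier_mat (n - 1) (n - 1)" using B by (simp add: mat_delete_def)
    have "poly (char_poly (mat_delete B i i)) z = det (- (char_matrix (mat_delete B i i) z))"
      by (rule char_poly_matrix[OF D])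
    also have "- (char_matrix (mat_delete B i i) z) = mat_delete T i i"
      by (rule eq_matI) (use B i in \<open>auto simp: T_def char_matrix_def mat_delete_def\<close>)
    also have "det (mat_delete T i i) = cofactor T i i" by (simp add: cofactor_def)
    also have "\<dots> = adj_mat T $$ (i, i)" using T i by (simp add: adj_mat_def)
    also have "\<dots> = det T * (- resolvent a z n i i)" unfolding adj using i by (simp add: R_def)
    finally show ?thesis .
  qed
  have "poly (pderiv p) z = det T * (- trace_upto n (resolvent a z n))"
    unfolding p_def pderiv_char_poly[OF B] poly_sum trace_upto_def
    by (simp add: minor sum_negf sum_distrib_left)
  moreover have detT: "det T \<noteq> 0"
  proof
    assume "det T = 0"
    then have "det (T * R) = 0" using det_mult[OF T R] by simp
    then show False unfolding TR by simp
  qed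
  moreover have p: "p = (\<Prod>l\<leftarrow>map complex_of_real ls. [:- l, 1:])"
  proof -
    have "p = map_poly complex_of_real (char_poly A)"
      unfolding p_def B_def by (rule of_real_hom.char_poly_hom[OF A])
    also have "\<dots> = (\<Prod>l\<leftarrow>map complex_of_real ls. [:- l, 1:])"
      unfolding ls
    proof (induction ls)
      case (Cons l ls)
      have "map_poly complex_of_real (p * q) = map_poly complex_of_real p * map_poly complex_of_real q" for p q
        by (rule map_poly_of_real_mult)
      then show ?case using Cons by (simp add: map_poly_pCons del: mult_pCons_left)
    qed simp
    finally show ?thesis .
  qed
  have "z \<notin> set (map complex_of_real ls)" using z by auto
  from pderiv_prod_linear[OF this, folded p]
  have "poly (pderiv p) z = det T * (\<Sum>l\<leftarrow>map complex_of_real ls. 1 / (z - l))" by (simp add: pz)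
  ultimately have "- trace_upto n (resolvent a z n) = (\<Sum>l\<leftarrow>map complex_of_real ls. 1 / (z - l))"
    by (simp only: mult_cancel_left) simp
  then have "trace_upto n (resolvent a z n) = - (\<Sum>l\<leftarrow>map complex_of_real ls. 1 / (z - l))" by (metis minus_minus)
  also have "\<dots> = (\<Sum>l\<leftarrow>ls. 1 / (of_real l - z))"
  proof (induction ls)
    case (Cons l ls)
    have "- (1 / (z - of_real l)) = 1 / (of_real l - z)" by (metis minus_diff_eq minus_divide_right)
    then show ?case using Cons by simp
  qed simp
  finally show ?thesis .
qed

lemma proots_linear_product: "proots (\<Prod>l\<leftarrow>ls. [:- l, 1:] :: real poly) = mset ls"
proof (induction ls)
  case (Cons l ls)
  have "(\<Prod>l\<leftarrow>ls. [:- l, 1:] :: real poly) \<noteq> 0" by (auto simp: prod_list_zero_iff)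
  then show ?case using Cons by (simp add: proots_mult del: mult_pCons_left)
qed simp

section \<open>The Stieltjes transform of the semicircle law\<close>

text \<open>
  The root of modulus greater than 1 of w^2 - z w + 1. The two roots have product 1, and they cannot
  both lie on the unit circle, since z would then be real.
\<close>

definition semicircle_root :: "complex \<Rightarrow> complex" where
  "semicircle_root z = (SOME w. w + 1 / w = z \<and> cmod w > 1 \<and> Im w > 0)"

lemma semicircle_root_exists:
  assumes z: "Im z > 0"
  shows "\<exists>w. w + 1 / w = z \<and> cmod w > 1 \<and> Im w > 0"
proof -
  define d where "d = csqrt (z\<^sup>2 - 4)"
  have d2: "d\<^sup>2 = z\<^sup>2 - 4" by (simp add: d_def)
  define a b where "a = (z + d) / 2" and "b = (z - d) / 2"
  have ab: "a * b = 1"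
  proof -
    have "a * b = (z\<^sup>2 - d\<^sup>2) / 4" by (simp add: a_def b_def power2_eq_square algebra_simps)
    then show ?thesis by (simp add: d2)
  qed
  have sum: "a + b = z" by (simp add: a_def b_def field_simps)
  have "a \<noteq> 0" "b \<noteq> 0" using ab by auto
  have inv: "1 / a = b" "1 / b = a"
    using \<open>a \<noteq> 0\<close> \<open>b \<noteq> 0\<close> ab
    by (metis nonzero_mult_div_cancel_left, metis nonzero_mult_div_cancel_right)
  have im: "Im w > 0" if "w + 1 / w = z" "cmod w > 1" for w
  proof -
    define k where "k = 1 - 1 / (cmod w)\<^sup>2"
    have "1 / (cmod w)\<^sup>2 < 1" by (rule inverse_square_less_1[OF that(2)])
    then have k: "k > 0" by (simp add: k_def)
    have "Im (1 / w) = - (Im w * (1 / (cmod w)\<^sup>2))" by (simp add: Im_divide cmod_power2)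
    moreover have "Im z = Im w + Im (1 / w)" unfolding that(1)[symmetric] by (rule plus_complex.sel)
    ultimately have "Im z = Im w * k" unfolding k_def right_diff_distrib by linarith
    then show ?thesis using z k by (simp add: zero_less_mult_iff)
  qed
  have ab1: "cmod a * cmod b = 1" using ab by (metis norm_mult norm_one)
  have a1: "cmod a \<noteq> 1"
  proof
    assume a1: "cmod a = 1"
    then have "b = cnj a" using inv(1) by (simp add: divide_conv_cnj)
    then have "z = a + cnj a" using sum by simp
    then show False using z by simp
  qed
  have "cmod a > 1 \<or> cmod b > 1"
  proof (rule ccontr)
    assume n: "\<not> (cmod a > 1 \<or> cmod b > 1)"
    then have "cmod a * cmod b \<le> cmod a * 1" by (intro mult_left_mono) auto
    then show False using n ab1 a1 by simp
  qed
  then show ?thesis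
  proof
    assume "cmod a > 1" then show ?thesis using im[of a] inv sum by metis
  next
    assume "cmod b > 1" then show ?thesis using im[of b] inv sum by (metis add.commute)
  qed
qed

lemma semicircle_root:
  assumes "Im z > 0"
  shows "semicircle_root z + 1 / semicircle_root z = z" "cmod (semicircle_root z) > 1" "Im (semicircle_root z) > 0"
  using someI_ex[OF semicircle_root_exists[OF assms]] by (auto simp: semicircle_root_def)

definition semicircle_transform :: "complex \<Rightarrow> complex" where
  "semicircle_transform z = - 1 / semicircle_root z"

lemma semicircle_transform:
  assumes "Im z > 0"
  shows "(semicircle_transform z)\<^sup>2 + z * semicircle_transform z + 1 = 0"
    and "cmod (semicircle_transform z) < 1"
    and "Im (semicircle_transform z) > 0"
proof -
  let ?w = "semicircle_root z"
  note w = semicircle_root[OF assms]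
  have w0: "?w \<noteq> 0" using w(3) by auto
  have "(- 1 / ?w)\<^sup>2 + (?w + 1 / ?w) * (- 1 / ?w) + 1 = 0"
    using w0 by (simp add: field_simps power2_eq_square)
  then show "(semicircle_transform z)\<^sup>2 + z * semicircle_transform z + 1 = 0"
    unfolding w(1) semicircle_transform_def .
  have "0 < cmod ?w" using w(2) by linarith
  then have "1 / cmod ?w < 1" using w(2) by (simp only: divide_less_eq_1_pos)
  then show "cmod (semicircle_transform z) < 1" by (simp add: semicircle_transform_def norm_divide)
  have "Im (semicircle_transform z) = Im ?w / (cmod ?w)\<^sup>2"
    by (simp add: semicircle_transform_def Im_divide cmod_power2)
  then show "Im (semicircle_transform z) > 0" using w0 w(3) by simp
qed

text \<open>
  Subtract the quadratic equations of s and t, each multiplied by the other unknown: the result is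
  (s - t) (1 - s t) = s t (z - z').
\<close>

lemma semicircle_transform_lipschitz:
  assumes "Im z > 0" "Im z' > 0"
  shows "cmod (semicircle_transform z - semicircle_transform z') * (1 - cmod (semicircle_transform z)) \<le> cmod (z - z')"
proof -
  let ?s = "semicircle_transform z" and ?t = "semicircle_transform z'"
  note s = semicircle_transform[OF assms(1)] and t = semicircle_transform[OF assms(2)]
  have "?s * ?t * (z - z') + (?s - ?t) * (?s * ?t - 1) = ?t * (?s\<^sup>2 + z * ?s + 1) - ?s * (?t\<^sup>2 + z' * ?t + 1)"
    by (simp add: power2_eq_square algebra_simps)
  then have "(?s - ?t) * (1 - ?s * ?t) = ?s * ?t * (z - z')"
    unfolding s(1) t(1) by (simp add: algebra_simps)
  then have eq: "cmod (?s - ?t) * cmod (1 - ?s * ?t) = cmod (?s * ?t) * cmod (z - z')"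
    by (metis norm_mult)
  have st: "cmod (?s * ?t) \<le> cmod ?s * 1" unfolding norm_mult using t(2) by (intro mult_left_mono) auto
  have "1 - cmod ?s \<le> cmod (1 - ?s * ?t)"
    using norm_triangle_ineq2[of 1 "?s * ?t"] st by simp
  then have "cmod (?s - ?t) * (1 - cmod ?s) \<le> cmod (?s * ?t) * cmod (z - z')"
    unfolding eq[symmetric] by (intro mult_left_mono) auto
  also have "\<dots> \<le> 1 * cmod (z - z')" using st s(2) by (intro mult_right_mono) auto
  finally show ?thesis by simp
qed

lemma semicircle_transform_continuous: "continuous_on {z. Im z > 0} semicircle_transform"
proof (rule continuous_on_eq_continuous_at[THEN iffD2])
  show "open {z. Im z > 0}" by (rule open_halfspace_Im_gt)
  show "\<forall>z\<in>{z. Im z > 0}. isCont semicircle_transform z"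
  proof
    fix z assume "z \<in> {z. Im z > 0}"
    then have z: "Im z > 0" by simp
    define k where "k = 1 - cmod (semicircle_transform z)"
    have k: "k > 0" using semicircle_transform(2)[OF z] by (simp add: k_def)
    have "((\<lambda>z'. cmod (semicircle_transform z' - semicircle_transform z)) \<longlongrightarrow> 0) (at z)"
    proof (rule tendsto_sandwich)
      show "\<forall>\<^sub>F z' in at z. 0 \<le> cmod (semicircle_transform z' - semicircle_transform z)" by simp
      have "\<forall>\<^sub>F z' in at z. Im z' > 0"
        using z open_halfspace_Im_gt[of 0] by (simp add: eventually_at_topological) blast
      then show "\<forall>\<^sub>F z' in at z. cmod (semicircle_transform z' - semicircle_transform z) \<le> cmod (z - z') / k"
      proof eventually_elim
        case (elim z')
        then show ?case using semicircle_transform_lipschitz[OF z elim] k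
          by (simp add: k_def[symmetric] pos_le_divide_eq norm_minus_commute)
      qed
      show "((\<lambda>z'. cmod (z - z') / k) \<longlongrightarrow> 0) (at z)"
        using k by (auto intro!: tendsto_eq_intros)
    qed simp
    then have "((\<lambda>z'. semicircle_transform z' - semicircle_transform z) \<longlongrightarrow> 0) (at z)"
      by (rule tendsto_norm_zero_cancel)
    then show "isCont semicircle_transform z" unfolding isCont_def by (rule LIM_zero_cancel)
  qed
qed

lemma square_less_4:
  fixes x :: real
  assumes "\<bar>x\<bar> < 2"
  shows "x\<^sup>2 < 4"
proof -
  have "0 < (2 - x) * (2 + x)" using assms by (intro mult_pos_pos) auto
  then show ?thesis by (simp add: power2_eq_square algebra_simps)
qed

text \<open>
  The number y = 2 s + z satisfies y^2 = z^2 - 4 and lies in the upper half plane, so near the real axis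
  it is close to i sqrt(4 - x^2). Multiplying y - i r by y + i r, whose modulus is at least r, avoids any
  discussion of branches.
\<close>

lemma semicircle_boundary_value:
  assumes "\<bar>x\<bar> < 2"
  shows "((\<lambda>\<eta>. Im (semicircle_transform (Complex x \<eta>))) \<longlongrightarrow> sqrt (4 - x\<^sup>2) / 2) (at_right 0)"
proof -
  define r where "r = sqrt (4 - x\<^sup>2)"
  have x2: "x\<^sup>2 < 4" by (rule square_less_4[OF assms])
  have r: "r > 0" "r\<^sup>2 = 4 - x\<^sup>2" using x2 by (auto simp: r_def)
  have key: "cmod (2 * semicircle_transform (Complex x \<eta>) + Complex x \<eta> - \<i> * r) \<le> cmod ((Complex x \<eta>)\<^sup>2 - of_real (x\<^sup>2)) / r"
    if "\<eta> > 0" for \<eta>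
  proof -
    let ?z = "Complex x \<eta>"
    let ?s = "semicircle_transform ?z"
    have z: "Im ?z > 0" using that by simp
    note s = semicircle_transform[OF z]
    let ?y = "2 * ?s + ?z"
    have y2: "?y\<^sup>2 = ?z\<^sup>2 - 4"
    proof -
      have "?y\<^sup>2 = 4 * (?s\<^sup>2 + ?z * ?s + 1) + ?z\<^sup>2 - 4" by (simp add: power2_eq_square algebra_simps)
      then show ?thesis unfolding s(1) by simp
    qed
    have "(?y - \<i> * r) * (?y + \<i> * r) = ?y\<^sup>2 + of_real (r\<^sup>2)"
      by (simp add: power2_eq_square algebra_simps)
    also have "\<dots> = ?z\<^sup>2 - of_real (x\<^sup>2)" unfolding y2 r(2) by simp
    finally have prod: "cmod (?y - \<i> * r) * cmod (?y + \<i> * r) = cmod (?z\<^sup>2 - of_real (x\<^sup>2))"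
      by (metis norm_mult)
    have "r \<le> Im (?y + \<i> * r)" using s(3) that by simp
    also have "\<dots> \<le> cmod (?y + \<i> * r)" using abs_Im_le_cmod abs_le_D1 by blast
    finally have "cmod (?y - \<i> * r) * r \<le> cmod (?z\<^sup>2 - of_real (x\<^sup>2))"
      unfolding prod[symmetric] by (intro mult_left_mono) auto
    then show ?thesis using r by (simp add: pos_le_divide_eq)
  qed
  have "((\<lambda>\<eta>. cmod (2 * semicircle_transform (Complex x \<eta>) + Complex x \<eta> - \<i> * r)) \<longlongrightarrow> 0) (at_right 0)"
  proof (rule tendsto_sandwich)
    show "\<forall>\<^sub>F \<eta> in at_right 0. 0 \<le> cmod (2 * semicircle_transform (Complex x \<eta>) + Complex x \<eta> - \<i> * r)" by simp
    show "\<forall>\<^sub>F \<eta> in at_right 0. cmod (2 * semicircle_transform (Complex x \<eta>) + Complex x \<eta> - \<i> * r)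
        \<le> cmod ((Complex x \<eta>)\<^sup>2 - of_real (x\<^sup>2)) / r"
      by (rule eventually_mono[OF eventually_at_right_less]) (rule key)
    have "((\<lambda>\<eta>. cmod ((of_real x + \<i> * of_real \<eta>)\<^sup>2 - of_real (x\<^sup>2)) / r) \<longlongrightarrow> cmod ((of_real x + \<i> * of_real 0)\<^sup>2 - of_real (x\<^sup>2)) / r) (at_right 0)"
      by (intro tendsto_intros) (use r in auto)
    then show "((\<lambda>\<eta>. cmod ((Complex x \<eta>)\<^sup>2 - of_real (x\<^sup>2)) / r) \<longlongrightarrow> 0) (at_right 0)"
      by (simp add: Complex_eq)
  qed simp
  then have "((\<lambda>\<eta>. 2 * semicircle_transform (Complex x \<eta>) + Complex x \<eta> - \<i> * r) \<longlongrightarrow> 0) (at_right 0)"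
    by (rule tendsto_norm_zero_cancel)
  then have "((\<lambda>\<eta>. Im (2 * semicircle_transform (Complex x \<eta>) + Complex x \<eta> - \<i> * r)) \<longlongrightarrow> Im 0) (at_right 0)"
    by (rule tendsto_Im)
  then have "((\<lambda>\<eta>. (2 * Im (semicircle_transform (Complex x \<eta>)) + \<eta> - r + (r - \<eta>)) / 2) \<longlongrightarrow> (0 + (r - 0)) / 2) (at_right 0)"
    by (intro tendsto_intros) auto
  then show ?thesis by (simp add: r_def)
qed

section \<open>The distribution function of the semicircle law\<close>

definition semicircle_primitive :: "real \<Rightarrow> real" where
  "semicircle_primitive x = (x * sqrt (4 - x\<^sup>2) / 2 + 2 * arcsin (x / 2)) / (2 * pi)"

lemma semicircle_primitive_deriv:
  assumes "\<bar>x\<bar> < 2"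
  shows "(semicircle_primitive has_real_derivative semicircle_density x) (at x)"
proof -
  have x2: "x\<^sup>2 < 4" by (rule square_less_4[OF assms])
  have r: "sqrt (4 - x\<^sup>2) > 0" using x2 by simp
  have sq: "sqrt (1 - (x / 2)\<^sup>2) = sqrt (4 - x\<^sup>2) / 2"
  proof -
    have "1 - (x / 2)\<^sup>2 = (4 - x\<^sup>2) / 4" by (simp add: power_divide)
    then show ?thesis by (simp only: real_sqrt_divide) simp
  qed
  have d: "semicircle_density x = sqrt (4 - x\<^sup>2) / (2 * pi)"
    using assms by (simp add: semicircle_density_def)
  have rr: "sqrt (4 - x\<^sup>2) * sqrt (4 - x\<^sup>2) = 4 - x\<^sup>2" using x2 by simp
  have s: "((\<lambda>x. sqrt (4 - x\<^sup>2)) has_real_derivative inverse (sqrt (4 - x\<^sup>2)) / 2 * (- (2 * x))) (at x)"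
    by (rule DERIV_chain2[OF DERIV_real_sqrt]) (use x2 in \<open>auto intro!: derivative_eq_intros\<close>)
  have a: "((\<lambda>x. arcsin (x / 2)) has_real_derivative inverse (sqrt (1 - (x / 2)\<^sup>2)) * (1 / 2)) (at x)"
    by (rule DERIV_chain2[OF DERIV_arcsin]) (use assms in \<open>auto intro!: derivative_eq_intros\<close>)
  have "(semicircle_primitive has_real_derivative
      ((1 * sqrt (4 - x\<^sup>2) + inverse (sqrt (4 - x\<^sup>2)) / 2 * (- (2 * x)) * x) / 2
        + 2 * (inverse (sqrt (1 - (x / 2)\<^sup>2)) * (1 / 2))) / (2 * pi)) (at x)"
    unfolding semicircle_primitive_def[abs_def]
    by (intro DERIV_cdivide DERIV_add DERIV_cmult DERIV_mult DERIV_ident s a)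
  moreover have "(1 * sqrt (4 - x\<^sup>2) + inverse (sqrt (4 - x\<^sup>2)) / 2 * (- (2 * x)) * x) / 2
        + 2 * (inverse (sqrt (1 - (x / 2)\<^sup>2)) * (1 / 2)) = sqrt (4 - x\<^sup>2)"
  proof -
    define R where "R = sqrt (4 - x\<^sup>2)"
    have R: "R > 0" "R * R = 4 - x * x" using r rr by (simp_all add: R_def power2_eq_square)
    have "(1 * R + inverse R / 2 * (- (2 * x)) * x) / 2 + 2 * (inverse (R / 2) * (1 / 2))
        = (R * R - x * x + 4) / (2 * R)"
      using R(1) by (simp add: field_simps)
    also have "R * R - x * x + 4 = 2 * (R * R)" unfolding R(2) by simp
    also have "2 * (R * R) / (2 * R) = R" using R(1) by simp
    finally show ?thesis unfolding sq R_def .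
  qed
  ultimately show ?thesis unfolding d by (simp only:)
qed

lemma semicircle_density_alt: "semicircle_density x = sqrt (max 0 (4 - x\<^sup>2)) / (2 * pi)"
proof (cases "\<bar>x\<bar> \<le> 2")
  case True
  then have "x\<^sup>2 \<le> 2\<^sup>2" by (metis abs_le_square_iff abs_numeral)
  then show ?thesis using True by (simp add: semicircle_density_def max_def)
next
  case False
  then have "2\<^sup>2 < \<bar>x\<bar>\<^sup>2" by (intro power_strict_mono) auto
  then show ?thesis using False by (simp add: semicircle_density_def max_def)
qed

lemma semicircle_density_continuous: "continuous_on S semicircle_density"
  unfolding semicircle_density_alt[abs_def] by (intro continuous_intros) auto

lemma semicircle_primitive_continuous: "continuous_on {-2..2} semicircle_primitive"
  unfolding semicircle_primitive_def[abs_def]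
  by (intro continuous_intros) auto

lemma semicircle_primitive_ends: "semicircle_primitive (-2) = - 1 / 2" "semicircle_primitive 2 = 1 / 2"
  by (simp_all add: semicircle_primitive_def)

lemma semicircle_density_integral:
  assumes "-2 \<le> a" "a \<le> b" "b \<le> 2"
  shows "(semicircle_density has_integral (semicircle_primitive b - semicircle_primitive a)) {a..b}"
proof (rule fundamental_theorem_of_calculus_interior[OF assms(2)])
  show "continuous_on {a..b} semicircle_primitive"
    by (rule continuous_on_subset[OF semicircle_primitive_continuous]) (use assms in auto)
  show "(semicircle_primitive has_vector_derivative semicircle_density x) (at x)" if "x \<in> {a<..<b}" for x
    unfolding has_real_derivative_iff_has_vector_derivative[symmetric]
    by (rule semicircle_primitive_deriv) (use that assms in auto)
qed

lemma semicircle_cdf_eq: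
  "semicircle_cdf x = (if x \<le> -2 then 0 else if x \<le> 2 then semicircle_primitive x + 1 / 2 else 1)"
proof -
  have mid: "(LINT u:{-2..t}|lborel. semicircle_density u) = semicircle_primitive t + 1 / 2"
    if "-2 \<le> t" "t \<le> 2" for t
  proof -
    have "set_integrable lborel {-2..t} semicircle_density"
      by (rule borel_integrable_atLeastAtMost'[OF semicircle_density_continuous])
    then have "(LINT u:{-2..t}|lborel. semicircle_density u) = integral {-2..t} semicircle_density"
      by (rule set_borel_integral_eq_integral(2))
    also have "\<dots> = semicircle_primitive t - semicircle_primitive (-2)"
      by (rule integral_unique[OF semicircle_density_integral]) (use that in auto)
    finally show ?thesis by (simp add: semicircle_primitive_ends)
  qed
  have out: "semicircle_density u = 0" if "\<not> \<bar>u\<bar> \<le> 2" for u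
    using that by (simp add: semicircle_density_def)
  consider "x \<le> -2" | "-2 < x" "x \<le> 2" | "2 < x" by linarith
  then show ?thesis
  proof cases
    case 1
    have eq: "indicator {..x} u *\<^sub>R semicircle_density u = (0::real)" for u
      using out[of u] 1 by (cases "u = -2") (auto simp: indicator_def semicircle_density_def)
    have "semicircle_cdf x = 0" by (simp only: semicircle_cdf_def set_lebesgue_integral_def eq) simp
    then show ?thesis using 1 by simp
  next
    case 2
    have eq: "indicator {..x} u *\<^sub>R semicircle_density u = indicator {-2..x} u *\<^sub>R semicircle_density u" for u
      using out[of u] by (auto simp: indicator_def)
    have "semicircle_cdf x = (LINT u:{-2..x}|lborel. semicircle_density u)"
      by (simp only: semicircle_cdf_def set_lebesgue_integral_def eq)
    then show ?thesis using 2 mid[of x] by simp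
  next
    case 3
    have eq: "indicator {..x} u *\<^sub>R semicircle_density u = indicator {-2..2} u *\<^sub>R semicircle_density u" for u
      using out[of u] 3 by (auto simp: indicator_def)
    have "semicircle_cdf x = (LINT u:{-2..2}|lborel. semicircle_density u)"
      by (simp only: semicircle_cdf_def set_lebesgue_integral_def eq)
    then show ?thesis using 3 mid[of 2] by (simp add: semicircle_primitive_ends)
  qed
qed

lemma semicircle_density_nonneg: "semicircle_density x \<ge> 0"
  unfolding semicircle_density_alt by simp

lemma semicircle_primitive_mono:
  assumes "-2 \<le> a" "a \<le> b" "b \<le> 2"
  shows "semicircle_primitive a \<le> semicircle_primitive b"
  using has_integral_nonneg[OF semicircle_density_integral[OF assms] semicircle_density_nonneg] by simp

lemma semicircle_cdf_mono: "x \<le> y \<Longrightarrow> semicircle_cdf x \<le> semicircle_cdf y"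
  using semicircle_primitive_mono[of x y] semicircle_primitive_mono[of "-2" y] semicircle_primitive_mono[of x 2]
  by (auto simp: semicircle_cdf_eq semicircle_primitive_ends)

lemma semicircle_cdf_bounds: "0 \<le> semicircle_cdf x" "semicircle_cdf x \<le> 1"
  using semicircle_primitive_mono[of "-2" x] semicircle_primitive_mono[of x 2]
  by (auto simp: semicircle_cdf_eq semicircle_primitive_ends)

lemma semicircle_cdf_primitive: "-2 \<le> x \<Longrightarrow> x \<le> 2 \<Longrightarrow> semicircle_cdf x = semicircle_primitive x + 1 / 2"
  by (auto simp: semicircle_cdf_eq semicircle_primitive_ends)

lemma semicircle_cdf_continuous: "continuous_on {-2..2} semicircle_cdf"
proof -
  have "continuous_on {-2..2} (\<lambda>x. semicircle_primitive x + 1 / 2)"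
    by (intro continuous_intros semicircle_primitive_continuous)
  then show ?thesis by (rule continuous_on_eq) (simp add: semicircle_cdf_primitive)
qed

section \<open>From Stieltjes transforms to distribution functions\<close>

definition ecdf :: "real list \<Rightarrow> real \<Rightarrow> real" where
  "ecdf ls t = real (length (filter (\<lambda>l. l \<le> t) ls)) / real (length ls)"

definition stieltjes :: "real list \<Rightarrow> complex \<Rightarrow> complex" where
  "stieltjes ls z = (\<Sum>l\<leftarrow>ls. 1 / (of_real l - z)) / of_nat (length ls)"

text \<open>
  The mass that the Cauchy law with centre l and width \<eta> gives to the interval from a to b.
\<close>

definition cauchy_mass :: "real \<Rightarrow> real \<Rightarrow> real \<Rightarrow> real \<Rightarrow> real" where
  "cauchy_mass a b \<eta> l = (arctan ((b - l) / \<eta>) - arctan ((a - l) / \<eta>)) / pi"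

lemma ecdf_mono: "s \<le> t \<Longrightarrow> ecdf ls s \<le> ecdf ls t"
proof -
  assume "s \<le> t"
  then have "length (filter (\<lambda>l. l \<le> s) ls) \<le> length (filter (\<lambda>l. l \<le> t) ls)"
    by (induction ls) auto
  then show ?thesis unfolding ecdf_def by (intro divide_right_mono) auto
qed

lemma ecdf_bounds: "0 \<le> ecdf ls t" "ecdf ls t \<le> 1"
proof -
  show "0 \<le> ecdf ls t" by (simp add: ecdf_def)
  have "length (filter (\<lambda>l. l \<le> t) ls) \<le> length ls" by simp
  then show "ecdf ls t \<le> 1" unfolding ecdf_def by (metis divide_le_eq_1 of_nat_0_le_iff of_nat_le_iff order_le_less)
qed

lemma Im_stieltjes_bound:
  assumes "\<eta> > 0" "ls \<noteq> []"
  shows "\<bar>Im (stieltjes ls (Complex x \<eta>))\<bar> \<le> 1 / \<eta>"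
proof -
  have "cmod (\<Sum>l\<leftarrow>ls. 1 / (of_real l - Complex x \<eta>)) \<le> real (length ls) / \<eta>"
  proof (induction ls)
    case (Cons l ls)
    have "\<eta> \<le> cmod (of_real l - Complex x \<eta>)"
      using abs_Im_le_cmod[of "of_real l - Complex x \<eta>"] assms(1) by simp
    then have "cmod (1 / (of_real l - Complex x \<eta>)) \<le> 1 / \<eta>"
      using assms(1) unfolding norm_divide by (intro frac_le) auto
    then have "cmod (1 / (of_real l - Complex x \<eta>) + (\<Sum>l\<leftarrow>ls. 1 / (of_real l - Complex x \<eta>)))
        \<le> 1 / \<eta> + real (length ls) / \<eta>"
      using Cons by (intro norm_triangle_le) linarith
    then show ?case by (simp add: add_divide_distrib)
  qed simp
  then have "cmod (stieltjes ls (Complex x \<eta>)) \<le> (real (length ls) / \<eta>) / real (length ls)"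
    unfolding stieltjes_def norm_divide by (simp only: norm_of_nat) (intro divide_right_mono, auto)
  also have "\<dots> = 1 / \<eta>" using assms by simp
  finally show ?thesis using abs_Im_le_cmod order_trans by blast
qed

lemma Im_stieltjes_integral:
  assumes "\<eta> > 0" "a \<le> b"
  shows "((\<lambda>x. Im (stieltjes ls (Complex x \<eta>)) / pi) has_integral
    (\<Sum>l\<leftarrow>ls. cauchy_mass a b \<eta> l) / real (length ls)) {a..b}"
proof -
  have one: "((\<lambda>x. Im (1 / (of_real l - Complex x \<eta>)) / pi) has_integral cauchy_mass a b \<eta> l) {a..b}" for l
  proof -
    have "((\<lambda>x. Im (1 / (of_real l - Complex x \<eta>)) / pi) has_integral
       (arctan ((b - l) / \<eta>) / pi - arctan ((a - l) / \<eta>) / pi)) {a..b}"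
    proof (rule fundamental_theorem_of_calculus[OF assms(2)])
      fix x
      have p: "(l - x)\<^sup>2 + \<eta>\<^sup>2 > 0" using assms(1) by (simp add: add_nonneg_pos)
      have eq: "Im (1 / (of_real l - Complex x \<eta>)) = inverse (1 + ((x - l) / \<eta>)\<^sup>2) * (1 / \<eta>)"
      proof -
        have "Im (1 / (of_real l - Complex x \<eta>)) = \<eta> / ((l - x)\<^sup>2 + \<eta>\<^sup>2)"
          by (simp add: Im_divide)
        also have "\<dots> = inverse (1 + ((x - l) / \<eta>)\<^sup>2) * (1 / \<eta>)"
        proof -
          have "1 + ((x - l) / \<eta>)\<^sup>2 = ((l - x)\<^sup>2 + \<eta>\<^sup>2) / \<eta>\<^sup>2"
            using assms(1) by (simp add: power_divide add_divide_distrib power2_commute)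
          then show ?thesis using assms(1) by (simp add: power2_eq_square)
        qed
        finally show ?thesis .
      qed
      have "((\<lambda>x. arctan ((x - l) / \<eta>)) has_real_derivative inverse (1 + ((x - l) / \<eta>)\<^sup>2) * (1 / \<eta>)) (at x within {a..b})"
        by (rule DERIV_chain2[OF DERIV_arctan]) (use assms in \<open>auto intro!: derivative_eq_intros\<close>)
      then have "((\<lambda>x. arctan ((x - l) / \<eta>) / pi) has_real_derivative inverse (1 + ((x - l) / \<eta>)\<^sup>2) * (1 / \<eta>) / pi) (at x within {a..b})"
        by (rule DERIV_cdivide)
      then show "((\<lambda>x. arctan ((x - l) / \<eta>) / pi) has_vector_derivative Im (1 / (of_real l - Complex x \<eta>)) / pi) (at x within {a..b})"
        unfolding eq has_real_derivative_iff_has_vector_derivative[symmetric] .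
    qed
    then show ?thesis by (simp add: cauchy_mass_def diff_divide_distrib)
  qed
  have "((\<lambda>x. (\<Sum>l\<leftarrow>ls. Im (1 / (of_real l - Complex x \<eta>)) / pi)) has_integral (\<Sum>l\<leftarrow>ls. cauchy_mass a b \<eta> l)) {a..b}"
  proof (induction ls)
    case (Cons l ls)
    then show ?case using has_integral_add[OF one[of l] Cons] by simp
  qed simp
  then have "((\<lambda>x. (\<Sum>l\<leftarrow>ls. Im (1 / (of_real l - Complex x \<eta>)) / pi) / real (length ls)) has_integral (\<Sum>l\<leftarrow>ls. cauchy_mass a b \<eta> l) / real (length ls)) {a..b}"
    by (rule has_integral_divide)
  moreover have "(\<Sum>l\<leftarrow>ls. Im (1 / (of_real l - z)) / pi) / real (length ls) = Im (stieltjes ls z) / pi" for z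
  proof -
    have "(\<Sum>l\<leftarrow>ls. Im (1 / (of_real l - z)) / pi) = Im (\<Sum>l\<leftarrow>ls. 1 / (of_real l - z)) / pi"
      by (induction ls) (simp_all only: list.map sum_list.Nil sum_list.Cons plus_complex.sel add_divide_distrib, simp)
    then show ?thesis by (simp add: stieltjes_def)
  qed
  ultimately show ?thesis by simp
qed

text \<open>
  An eigenvalue outside the interval from a to b is at distance at least \<delta> from the smaller interval.
\<close>

lemma cauchy_mass_le:
  assumes "\<eta> > 0" "\<delta> > 0"
  shows "cauchy_mass (a + \<delta>) (b - \<delta>) \<eta> l \<le> (if a < l \<and> l \<le> b then 1 else 0) + (1 / 2 - arctan (\<delta> / \<eta>) / pi)"
proof -
  have up: "arctan t / pi \<le> 1 / 2" and lo: "- 1 / 2 \<le> arctan t / pi" for t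
    using arctan_bounded[of t] pi_gt_zero by (auto simp: field_simps)
  have cm: "cauchy_mass (a + \<delta>) (b - \<delta>) \<eta> l = arctan ((b - \<delta> - l) / \<eta>) / pi - arctan ((a + \<delta> - l) / \<eta>) / pi"
    by (simp add: cauchy_mass_def diff_divide_distrib)
  consider "a < l" "l \<le> b" | "l \<le> a" | "b < l" by linarith
  then show ?thesis
  proof cases
    case 1
    then have "(if a < l \<and> l \<le> b then 1 else 0) = (1::real)" by simp
    then show ?thesis unfolding cm
      using up[of "(b - \<delta> - l) / \<eta>"] lo[of "(a + \<delta> - l) / \<eta>"] up[of "\<delta> / \<eta>"] by linarith
  next
    case 2
    then have "\<delta> / \<eta> \<le> (a + \<delta> - l) / \<eta>" using assms by (intro divide_right_mono) auto
    then have "arctan (\<delta> / \<eta>) / pi \<le> arctan ((a + \<delta> - l) / \<eta>) / pi" by (intro divide_right_mono) (auto simp: arctan_le_iff)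
    moreover have "(if a < l \<and> l \<le> b then 1 else 0) = (0::real)" using 2 by simp
    ultimately show ?thesis unfolding cm using up[of "(b - \<delta> - l) / \<eta>"] by linarith
  next
    case 3
    then have "(b - \<delta> - l) / \<eta> \<le> - (\<delta> / \<eta>)" using assms by (simp add: divide_simps)
    then have "arctan ((b - \<delta> - l) / \<eta>) / pi \<le> arctan (- (\<delta> / \<eta>)) / pi" by (intro divide_right_mono) (auto simp: arctan_le_iff)
    moreover have "(if a < l \<and> l \<le> b then 1 else 0) = (0::real)" using 3 by simp
    moreover have "arctan (- (\<delta> / \<eta>)) / pi = - (arctan (\<delta> / \<eta>) / pi)" by (simp add: arctan_minus)
    ultimately show ?thesis unfolding cm using lo[of "(a + \<delta> - l) / \<eta>"] by linarith
  qed
qed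

lemma mean_cauchy_mass_le:
  assumes "\<eta> > 0" "\<delta> > 0" "ls \<noteq> []" "a \<le> b"
  shows "(\<Sum>l\<leftarrow>ls. cauchy_mass (a + \<delta>) (b - \<delta>) \<eta> l) / real (length ls)
    \<le> ecdf ls b - ecdf ls a + (1 / 2 - arctan (\<delta> / \<eta>) / pi)"
proof -
  let ?k = "1 / 2 - arctan (\<delta> / \<eta>) / pi"
  have "(\<Sum>l\<leftarrow>ls. cauchy_mass (a + \<delta>) (b - \<delta>) \<eta> l)
     \<le> real (length (filter (\<lambda>l. l \<le> b) ls)) - real (length (filter (\<lambda>l. l \<le> a) ls)) + real (length ls) * ?k"
  proof (induction ls)
    case (Cons l ls)
    then show ?case using cauchy_mass_le[OF assms(1,2), of a b l] assms(4)
      by (auto simp: distrib_right simp del: divide_le_eq_numeral1)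
  qed simp
  then have "(\<Sum>l\<leftarrow>ls. cauchy_mass (a + \<delta>) (b - \<delta>) \<eta> l) / real (length ls)
     \<le> (real (length (filter (\<lambda>l. l \<le> b) ls)) - real (length (filter (\<lambda>l. l \<le> a) ls)) + real (length ls) * ?k) / real (length ls)"
    by (rule divide_right_mono) simp
  also have "\<dots> = ecdf ls b - ecdf ls a + ?k"
    using assms(3) by (simp add: ecdf_def add_divide_distrib diff_divide_distrib)
  finally show ?thesis .
qed

text \<open>
  Dominated convergence: the transform is bounded by 1 in the whole upper half plane.
\<close>

lemma semicircle_smoothed_integral:
  assumes "-2 < a" "a \<le> b" "b < 2"
  shows "((\<lambda>k. integral {a..b} (\<lambda>x. Im (semicircle_transform (Complex x (1 / real (Suc k)))) / pi))
    \<longlonglongrightarrow> semicircle_cdf b - semicircle_cdf a)"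
    and "(\<lambda>x. Im (semicircle_transform (Complex x (1 / real (Suc k)))) / pi) integrable_on {a..b}"
proof -
  have int: "(\<lambda>x. Im (semicircle_transform (Complex x (1 / real (Suc k)))) / pi) integrable_on {a..b}" for k
  proof (rule integrable_continuous_interval)
    have "continuous_on {a..b} (\<lambda>x. semicircle_transform (Complex x (1 / real (Suc k))))"
      by (rule continuous_on_compose2[OF semicircle_transform_continuous])
        (auto simp: Complex_eq intro!: continuous_intros)
    then show "continuous_on {a..b} (\<lambda>x. Im (semicircle_transform (Complex x (1 / real (Suc k)))) / pi)"
      by (intro continuous_intros) auto
  qed
  then show "(\<lambda>x. Im (semicircle_transform (Complex x (1 / real (Suc k)))) / pi) integrable_on {a..b}" .
  have "(\<lambda>k. integral {a..b} (\<lambda>x. Im (semicircle_transform (Complex x (1 / real (Suc k)))) / pi))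
    \<longlonglongrightarrow> integral {a..b} semicircle_density"
  proof (rule dominated_convergence(2)[OF int, where h = "\<lambda>_. 1 / pi"])
    show "(\<lambda>_. 1 / pi) integrable_on {a..b}" by (rule integrable_const_ivl)
    fix k x assume "x \<in> {a..b}"
    have "cmod (semicircle_transform (Complex x (1 / real (Suc k)))) < 1"
      by (rule semicircle_transform(2)) simp
    then have "\<bar>Im (semicircle_transform (Complex x (1 / real (Suc k))))\<bar> \<le> 1"
      using abs_Im_le_cmod[of "semicircle_transform (Complex x (1 / real (Suc k)))"] by linarith
    then show "norm (Im (semicircle_transform (Complex x (1 / real (Suc k)))) / pi) \<le> 1 / pi"
      by (simp add: divide_right_mono)
  next
    fix x assume "x \<in> {a..b}"
    then have x: "\<bar>x\<bar> < 2" using assms by auto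
    have "filterlim (\<lambda>k. 1 / real (Suc k)) (at_right 0) sequentially"
      by (rule tendsto_imp_filterlim_at_right[OF LIMSEQ_Suc[OF lim_1_over_n]]) auto
    from filterlim_compose[OF semicircle_boundary_value[OF x] this]
    have "(\<lambda>k. Im (semicircle_transform (Complex x (1 / real (Suc k)))) / pi) \<longlonglongrightarrow> sqrt (4 - x\<^sup>2) / 2 / pi"
      by (intro tendsto_divide tendsto_const) auto
    moreover have "sqrt (4 - x\<^sup>2) / 2 / pi = semicircle_density x"
      using x by (simp add: semicircle_density_def)
    ultimately show "(\<lambda>k. Im (semicircle_transform (Complex x (1 / real (Suc k)))) / pi) \<longlonglongrightarrow> semicircle_density x" by simp
  qed
  also have "integral {a..b} semicircle_density = semicircle_primitive b - semicircle_primitive a"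
    by (rule integral_unique[OF semicircle_density_integral]) (use assms in auto)
  also have "\<dots> = semicircle_cdf b - semicircle_cdf a" using assms by (simp add: semicircle_cdf_primitive)
  finally show "((\<lambda>k. integral {a..b} (\<lambda>x. Im (semicircle_transform (Complex x (1 / real (Suc k)))) / pi))
    \<longlonglongrightarrow> semicircle_cdf b - semicircle_cdf a)" .
qed

lemma isCont_semicircle_cdf:
  assumes "-2 < x" "x < 2"
  shows "isCont semicircle_cdf x"
proof (rule continuous_on_interior[OF semicircle_cdf_continuous])
  show "x \<in> interior {-2..2}" using assms by simp
qed

text \<open>
  Smoothing moves mass by little, so the mass of a slightly smaller interval under the smoothed law is a
  lower bound. Applied to the two intervals on either side of a point, it bounds the distribution function
  from both sides, because all laws have total mass 1.
\<close>

lemma ecdf_increment_lower_bound: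
  assumes ne: "\<And>m. ls m \<noteq> []"
    and conv: "\<And>z. Im z > 0 \<Longrightarrow> (\<lambda>m. stieltjes (ls m) z) \<longlonglongrightarrow> semicircle_transform z"
    and ab: "-2 < a" "a < b" "b < 2" and eps: "\<epsilon> > 0"
  shows "\<forall>\<^sub>F m in sequentially. ecdf (ls m) b - ecdf (ls m) a > semicircle_cdf b - semicircle_cdf a - \<epsilon>"
proof -
  have "((\<lambda>t. semicircle_cdf (b - t) - semicircle_cdf (a + t)) \<longlongrightarrow> semicircle_cdf b - semicircle_cdf a) (at_right 0)"
    by (intro tendsto_diff isCont_tendsto_compose[OF isCont_semicircle_cdf])
      (use ab in \<open>auto intro!: tendsto_eq_intros\<close>)
  then have "\<forall>\<^sub>F t in at_right 0. semicircle_cdf (b - t) - semicircle_cdf (a + t) > semicircle_cdf b - semicircle_cdf a - \<epsilon> / 4"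
    by (rule order_tendstoD) (use eps in simp)
  moreover have "\<forall>\<^sub>F t in at_right 0. t \<in> {0<..<(b - a) / 2}"
    by (rule eventually_at_right_real) (use ab in simp)
  ultimately have "\<forall>\<^sub>F t in at_right 0. t > 0 \<and> t < (b - a) / 2 \<and>
      semicircle_cdf (b - t) - semicircle_cdf (a + t) > semicircle_cdf b - semicircle_cdf a - \<epsilon> / 4"
    by eventually_elim simp
  then obtain \<delta> where d: "\<delta> > 0" "\<delta> < (b - a) / 2"
      "semicircle_cdf (b - \<delta>) - semicircle_cdf (a + \<delta>) > semicircle_cdf b - semicircle_cdf a - \<epsilon> / 4"
    using eventually_happens'[OF trivial_limit_at_right_real] by blast
  let ?a = "a + \<delta>" and ?b = "b - \<delta>"
  have ab': "-2 < ?a" "?a \<le> ?b" "?b < 2" using ab d by auto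
  define \<eta> where "\<eta> k = 1 / real (Suc k)" for k
  have eta: "\<eta> k > 0" for k by (simp add: \<eta>_def)
  let ?I = "\<lambda>k. integral {?a..?b} (\<lambda>x. Im (semicircle_transform (Complex x (\<eta> k))) / pi)"
  have "?I \<longlonglongrightarrow> semicircle_cdf ?b - semicircle_cdf ?a"
    unfolding \<eta>_def by (rule semicircle_smoothed_integral(1)[OF ab'])
  then have 1: "\<forall>\<^sub>F k in sequentially. ?I k > semicircle_cdf ?b - semicircle_cdf ?a - \<epsilon> / 4"
    by (rule order_tendstoD) (use eps in simp)
  have "(\<lambda>k. 1 / 2 - arctan (\<delta> / \<eta> k) / pi) \<longlonglongrightarrow> 1 / 2 - (pi / 2) / pi"
  proof (intro tendsto_diff tendsto_divide tendsto_const)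
    have "filterlim (\<lambda>k. \<delta> * real (Suc k)) at_top sequentially"
      by (rule filterlim_tendsto_pos_mult_at_top[OF tendsto_const d(1)])
        (rule filterlim_compose[OF filterlim_real_sequentially filterlim_Suc])
    then show "(\<lambda>k. arctan (\<delta> / \<eta> k)) \<longlonglongrightarrow> pi / 2"
      by (intro filterlim_compose[OF tendsto_arctan_at_top]) (simp add: \<eta>_def)
  qed simp_all
  then have 2: "\<forall>\<^sub>F k in sequentially. 1 / 2 - arctan (\<delta> / \<eta> k) / pi < \<epsilon> / 4"
    by (rule order_tendstoD) (use eps in simp)
  from eventually_happens'[OF _ eventually_conj[OF 1 2]] obtain k
    where k: "?I k > semicircle_cdf ?b - semicircle_cdf ?a - \<epsilon> / 4" "1 / 2 - arctan (\<delta> / \<eta> k) / pi < \<epsilon> / 4"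
    by auto
  let ?J = "\<lambda>m. integral {?a..?b} (\<lambda>x. Im (stieltjes (ls m) (Complex x (\<eta> k))) / pi)"
  have "?J \<longlonglongrightarrow> ?I k"
  proof (rule dominated_convergence(2)[where h = "\<lambda>_. 1 / \<eta> k / pi"])
    show "(\<lambda>x. Im (stieltjes (ls m) (Complex x (\<eta> k))) / pi) integrable_on {?a..?b}" for m
      using Im_stieltjes_integral[OF eta ab'(2)] by (rule has_integral_integrable)
    show "(\<lambda>_. 1 / \<eta> k / pi) integrable_on {?a..?b}" by (rule integrable_const_ivl)
    show "norm (Im (stieltjes (ls m) (Complex x (\<eta> k))) / pi) \<le> 1 / \<eta> k / pi" for m x
    proof -
      have "norm (Im (stieltjes (ls m) (Complex x (\<eta> k))) / pi) = \<bar>Im (stieltjes (ls m) (Complex x (\<eta> k)))\<bar> / pi"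
        by simp
      also have "\<dots> \<le> 1 / \<eta> k / pi" by (intro divide_right_mono Im_stieltjes_bound eta ne) simp
      finally show ?thesis .
    qed
    show "(\<lambda>m. Im (stieltjes (ls m) (Complex x (\<eta> k))) / pi) \<longlonglongrightarrow> Im (semicircle_transform (Complex x (\<eta> k))) / pi" for x
      by (intro tendsto_divide tendsto_Im conv tendsto_const) (use eta in auto)
  qed
  then have "\<forall>\<^sub>F m in sequentially. ?J m > ?I k - \<epsilon> / 4"
    by (rule order_tendstoD) (use eps in simp)
  then show ?thesis
  proof eventually_elim
    case (elim m)
    have "?J m = (\<Sum>l\<leftarrow>ls m. cauchy_mass ?a ?b (\<eta> k) l) / real (length (ls m))"
      by (rule integral_unique[OF Im_stieltjes_integral[OF eta ab'(2)]])
    also have "\<dots> \<le> ecdf (ls m) b - ecdf (ls m) a + (1 / 2 - arctan (\<delta> / \<eta> k) / pi)"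
      by (rule mean_cauchy_mass_le[OF eta d(1) ne]) (use ab in simp)
    finally show ?case using elim k d(3) by linarith
  qed
qed

lemma semicircle_cdf_near_ends:
  assumes "\<epsilon> > 0" and x: "-2 < x" "x < 2"
  obtains a b where "-2 < a" "a < x" "x < b" "b < 2" "semicircle_cdf a < \<epsilon>" "semicircle_cdf b > 1 - \<epsilon>"
proof -
  have "isCont (\<lambda>t. semicircle_cdf (max (-2) (min 2 t))) t" for t
  proof -
    have "continuous_on UNIV (\<lambda>t. semicircle_cdf (max (-2) (min 2 t)))"
      by (rule continuous_on_compose2[OF semicircle_cdf_continuous]) (auto intro!: continuous_intros)
    then show ?thesis by (simp add: continuous_on_eq_continuous_at)
  qed
  note cont = this
  have c2: "semicircle_cdf (-2) = 0" "semicircle_cdf 2 = 1"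
    by (simp_all add: semicircle_cdf_eq semicircle_primitive_ends)
    have "((\<lambda>t. semicircle_cdf (max (-2) (min 2 t))) \<longlongrightarrow> semicircle_cdf (max (-2) (min 2 (-2)))) (at_right (-2))"
      using cont[of "-2"] unfolding isCont_def by (rule tendsto_within_subset) auto
    then have "\<forall>\<^sub>F t in at_right (-2). semicircle_cdf (max (-2) (min 2 t)) < \<epsilon>"
      by (rule order_tendstoD) (use assms c2 in simp)
    moreover have "\<forall>\<^sub>F t in at_right (-2). t \<in> {-2<..<x}" by (rule eventually_at_right_real[OF x(1)])
    ultimately have "\<forall>\<^sub>F t in at_right (-2). -2 < t \<and> t < x \<and> semicircle_cdf t < \<epsilon>"
      by eventually_elim (use x in \<open>auto simp: min_def max_def split: if_splits\<close>)
    then obtain a where a: "-2 < a" "a < x" "semicircle_cdf a < \<epsilon>"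
      using eventually_happens'[OF trivial_limit_at_right_real] by blast
    have "((\<lambda>t. semicircle_cdf (max (-2) (min 2 t))) \<longlongrightarrow> semicircle_cdf (max (-2) (min 2 2))) (at_left 2)"
      using cont[of 2] unfolding isCont_def by (rule tendsto_within_subset) auto
    then have "\<forall>\<^sub>F t in at_left 2. semicircle_cdf (max (-2) (min 2 t)) > 1 - \<epsilon>"
      by (rule order_tendstoD) (use assms c2 in simp)
    moreover have "\<forall>\<^sub>F t in at_left 2. t \<in> {x<..<2}" by (rule eventually_at_left_real[OF x(2)])
    ultimately have "\<forall>\<^sub>F t in at_left 2. x < t \<and> t < 2 \<and> semicircle_cdf t > 1 - \<epsilon>"
      by eventually_elim (use x in \<open>auto simp: min_def max_def split: if_splits\<close>)
    then obtain b where b: "x < b" "b < 2" "semicircle_cdf b > 1 - \<epsilon>"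
      using eventually_happens'[OF trivial_limit_at_left_real] by blast
    show thesis by (rule that[OF a(1,2) b(1,2) a(3) b(3)])
qed

lemma ecdf_pointwise:
  assumes ne: "\<And>m. ls m \<noteq> []"
    and conv: "\<And>z. Im z > 0 \<Longrightarrow> (\<lambda>m. stieltjes (ls m) z) \<longlonglongrightarrow> semicircle_transform z"
    and x: "-2 < x" "x < 2" and eps: "\<epsilon> > 0"
  shows "\<forall>\<^sub>F m in sequentially. \<bar>ecdf (ls m) x - semicircle_cdf x\<bar> < \<epsilon>"
proof -
  have e2: "\<epsilon> / 2 > 0" using eps by simp
  obtain a b where ab: "-2 < a" "a < x" "x < b" "b < 2" "semicircle_cdf a < \<epsilon> / 2" "semicircle_cdf b > 1 - \<epsilon> / 2"
    by (rule semicircle_cdf_near_ends[OF e2 x])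
  have "\<forall>\<^sub>F m in sequentially. ecdf (ls m) x - ecdf (ls m) a > semicircle_cdf x - semicircle_cdf a - \<epsilon> / 2"
    by (rule ecdf_increment_lower_bound[OF ne conv]) (use ab x eps in auto)
  moreover have "\<forall>\<^sub>F m in sequentially. ecdf (ls m) b - ecdf (ls m) x > semicircle_cdf b - semicircle_cdf x - \<epsilon> / 2"
    by (rule ecdf_increment_lower_bound[OF ne conv]) (use ab x eps in auto)
  ultimately show ?thesis
  proof eventually_elim
    case (elim m)
    then show ?case using ab ecdf_bounds(1)[of "ls m" a] ecdf_bounds(2)[of "ls m" b] by linarith
  qed
qed

lemma levy_dist_le:
  assumes "\<epsilon> > 0" "\<And>x. F (x - \<epsilon>) - \<epsilon> \<le> G x" "\<And>x. G x \<le> F (x + \<epsilon>) + \<epsilon>"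
  shows "0 \<le> levy_dist F G" "levy_dist F G \<le> \<epsilon>"
proof -
  let ?S = "{\<epsilon>. \<epsilon> > 0 \<and> (\<forall>x. F (x - \<epsilon>) - \<epsilon> \<le> G x \<and> G x \<le> F (x + \<epsilon>) + \<epsilon>)}"
  have e: "\<epsilon> \<in> ?S" using assms by simp
  show "0 \<le> levy_dist F G" unfolding levy_dist_def
    by (rule cInf_greatest) (use e in auto)
  show "levy_dist F G \<le> \<epsilon>" unfolding levy_dist_def
    by (rule cInf_lower[OF e]) (auto intro!: bdd_belowI[of _ 0])
qed

text \<open>
  Pointwise convergence on a finite grid of mesh less than \<epsilon> is enough, because a shift of the
  argument by \<epsilon> reaches the next grid point, and outside the grid the limit is within \<epsilon> of 0 or 1.
\<close>

theorem levy_convergence: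
  assumes ne: "\<And>m. ls m \<noteq> []"
    and conv: "\<And>z. Im z > 0 \<Longrightarrow> (\<lambda>m. stieltjes (ls m) z) \<longlonglongrightarrow> semicircle_transform z"
  shows "(\<lambda>m. levy_dist (ecdf (ls m)) semicircle_cdf) \<longlonglongrightarrow> 0"
proof (rule LIMSEQ_I)
  fix r :: real assume r: "r > 0"
  define \<epsilon> where "\<epsilon> = min (r / 2) (1 / 2)"
  have eps: "\<epsilon> > 0" "\<epsilon> < r" using r by (auto simp: \<epsilon>_def)
  have e2: "\<epsilon> / 2 > 0" and z: "-2 < (0::real)" "(0::real) < 2" using eps by simp_all
  obtain a b where ab: "-2 < a" "a < 0" "0 < b" "b < 2" "semicircle_cdf a < \<epsilon> / 2" "semicircle_cdf b > 1 - \<epsilon> / 2"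
    by (rule semicircle_cdf_near_ends[OF e2 z])
  obtain N :: nat where N: "(b - a) / \<epsilon> < real N" using reals_Archimedean2 by blast
  have Npos: "real N > 0" using N ab eps by (meson diff_gt_0_iff_gt divide_pos_pos less_trans)
  define p where "p k = a + (b - a) * (real k / real N)" for k
  have step: "p (Suc k) - p k < \<epsilon>" for k
  proof -
    have "p (Suc k) - p k = (b - a) / real N" using Npos by (simp add: p_def field_simps)
    also have "\<dots> < \<epsilon>" using N eps Npos by (simp add: divide_less_eq mult.commute)
    finally show ?thesis .
  qed
  have p0: "p 0 = a" "p N = b" using Npos by (auto simp: p_def)
  have prange: "-2 < p k \<and> p k < 2" if "k \<le> N" for k
  proof -
    have t: "0 \<le> real k / real N" "real k / real N \<le> 1" using that Npos by auto
    have "0 \<le> (b - a) * (real k / real N)" using t(1) ab by (intro mult_nonneg_nonneg) auto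
    moreover have "(b - a) * (real k / real N) \<le> (b - a) * 1" using t(2) ab by (intro mult_left_mono) auto
    moreover define s where "s = (b - a) * (real k / real N)"
    ultimately have "0 \<le> s" "s \<le> b - a" by simp_all
    then show ?thesis using ab unfolding p_def s_def[symmetric] by (intro conjI) linarith+
  qed
  have "\<forall>\<^sub>F m in sequentially. \<forall>k\<in>{..N}. \<bar>ecdf (ls m) (p k) - semicircle_cdf (p k)\<bar> < \<epsilon> / 2"
    by (intro eventually_ball_finite ballI ecdf_pointwise[OF ne conv]) (use prange eps in auto)
  then obtain m0 where m0: "\<And>m k. m \<ge> m0 \<Longrightarrow> k \<le> N \<Longrightarrow> \<bar>ecdf (ls m) (p k) - semicircle_cdf (p k)\<bar> < \<epsilon> / 2"
    unfolding eventually_sequentially by auto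
  show "\<exists>m0. \<forall>m\<ge>m0. norm (levy_dist (ecdf (ls m)) semicircle_cdf - 0) < r"
  proof (intro exI[of _ m0] allI impI)
    fix m assume m: "m \<ge> m0"
    let ?F = "ecdf (ls m)"
    have close: "\<bar>?F (p k) - semicircle_cdf (p k)\<bar> < \<epsilon> / 2" if "k \<le> N" for k by (rule m0[OF m that])
    have main: "?F (x - \<epsilon>) - \<epsilon> \<le> semicircle_cdf x \<and> semicircle_cdf x \<le> ?F (x + \<epsilon>) + \<epsilon>" for x
    proof -
      consider "x < a" | "b \<le> x" | "a \<le> x" "x < b" by linarith
      then show ?thesis
      proof cases
        case 1
        have "?F (x - \<epsilon>) \<le> ?F a" using 1 eps by (intro ecdf_mono) auto
        moreover have "semicircle_cdf x \<le> semicircle_cdf a" using 1 by (intro semicircle_cdf_mono) auto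
        ultimately show ?thesis
          using close[of 0] ab semicircle_cdf_bounds[of x] ecdf_bounds[of "ls m" "x + \<epsilon>"] eps unfolding p0 by (intro conjI) linarith+
      next
        case 2
        have "?F b \<le> ?F (x + \<epsilon>)" using 2 eps by (intro ecdf_mono) auto
        moreover have "semicircle_cdf b \<le> semicircle_cdf x" using 2 by (intro semicircle_cdf_mono) auto
        ultimately show ?thesis
          using close[of N] ab semicircle_cdf_bounds[of x] ecdf_bounds[of "ls m" "x - \<epsilon>"] eps unfolding p0 by (intro conjI) linarith+
      next
        case 3
        obtain k where k: "k < N" "p k \<le> x" "x < p (Suc k)"
        proof -
          define k where "k = (LEAST k. x < p k)"
          have ex: "x < p N" using 3 p0 by simp
          have kx: "x < p k" unfolding k_def by (rule LeastI[of "\<lambda>k. x < p k", OF ex])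
          have kN: "k \<le> N" unfolding k_def by (rule Least_le[of "\<lambda>k. x < p k", OF ex])
          have k0: "k \<noteq> 0" using kx 3 p0 by (metis not_less)
          then obtain j where j: "k = Suc j" by (cases k) auto
          have "\<not> x < p j" using not_less_Least[of j "\<lambda>k. x < p k"] j by (simp add: k_def)
          then show thesis using that[of j] kx kN j by simp
        qed
        have "?F (x - \<epsilon>) \<le> ?F (p k)" using step[of k] k by (intro ecdf_mono) linarith
        moreover have "?F (p (Suc k)) \<le> ?F (x + \<epsilon>)" using step[of k] k by (intro ecdf_mono) linarith
        moreover have "semicircle_cdf (p k) \<le> semicircle_cdf x" using k by (intro semicircle_cdf_mono)
        moreover have "semicircle_cdf x \<le> semicircle_cdf (p (Suc k))" using k by (intro semicircle_cdf_mono) simp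
        ultimately show ?thesis using close[of k] close[of "Suc k"] k(1) eps by (intro conjI) linarith+
      qed
    qed
    have "0 \<le> levy_dist ?F semicircle_cdf" "levy_dist ?F semicircle_cdf \<le> \<epsilon>"
      using levy_dist_le[OF eps(1), of ?F semicircle_cdf] main by auto
    then show "norm (levy_dist ?F semicircle_cdf - 0) < r" using eps by simp
  qed
qed

section \<open>Geometric sequences of sizes and truncation levels\<close>

lemma (in prob_space) AE_tendsto_0_of_summable:
  fixes r :: "nat \<Rightarrow> 'a \<Rightarrow> real"
  assumes int: "\<And>m. integrable M (r m)" and nonneg: "\<And>m \<omega>. 0 \<le> r m \<omega>"
    and sm: "summable (\<lambda>m. \<integral>\<omega>. r m \<omega> \<partial>M)"
  shows "AE \<omega> in M. (\<lambda>m. r m \<omega>) \<longlonglongrightarrow> 0"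
proof -
  have [measurable]: "r m \<in> borel_measurable M" for m using int by simp
  have "(\<integral>\<^sup>+\<omega>. (\<Sum>m. ennreal (r m \<omega>)) \<partial>M) = (\<Sum>m. \<integral>\<^sup>+\<omega>. ennreal (r m \<omega>) \<partial>M)"
    by (rule nn_integral_suminf) simp
  also have "\<dots> = (\<Sum>m. ennreal (\<integral>\<omega>. r m \<omega> \<partial>M))"
    by (intro suminf_cong nn_integral_eq_integral int) (simp add: nonneg)
  also have "\<dots> = ennreal (\<Sum>m. \<integral>\<omega>. r m \<omega> \<partial>M)"
    by (rule suminf_ennreal2[OF _ sm]) (simp add: nonneg)
  finally have "(\<integral>\<^sup>+\<omega>. (\<Sum>m. ennreal (r m \<omega>)) \<partial>M) \<noteq> \<infinity>" by simp
  then have "AE \<omega> in M. (\<Sum>m. ennreal (r m \<omega>)) \<noteq> \<infinity>"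
    by (intro nn_integral_PInf_AE) auto
  then show ?thesis
  proof eventually_elim
    case (elim \<omega>)
    then have "summable (\<lambda>m. r m \<omega>)" by (intro summable_suminf_not_top nonneg) simp
    then show ?case by (rule summable_LIMSEQ_zero)
  qed
qed

definition geo_ratio :: "nat \<Rightarrow> real" where "geo_ratio p = 1 + 1 / real (Suc p)"

text \<open>
  The exponent 6 m leaves room: the truncation level grows at most like the m-th power of the ratio, its
  square at most like the power 2 m, and the square root of the size is of order 3 m.
\<close>

definition geo_seq :: "nat \<Rightarrow> nat \<Rightarrow> nat" where "geo_seq p m = nat \<lfloor>geo_ratio p ^ (6 * m)\<rfloor>"

lemma geo_ratio_gt_1: "geo_ratio p > 1" by (simp add: geo_ratio_def)

lemma geo_seq_bounds:
  "1 \<le> geo_seq p m" "real (geo_seq p m) \<le> geo_ratio p ^ (6 * m)"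
  "geo_ratio p ^ (6 * m) < real (geo_seq p m) + 1" "geo_ratio p ^ (6 * m) \<le> 2 * real (geo_seq p m)"
proof -
  have 1: "geo_ratio p ^ (6 * m) \<ge> 1" by (rule one_le_power) (use geo_ratio_gt_1[of p] in simp)
  then show s1: "1 \<le> geo_seq p m" unfolding geo_seq_def by linarith
  show "real (geo_seq p m) \<le> geo_ratio p ^ (6 * m)" "geo_ratio p ^ (6 * m) < real (geo_seq p m) + 1"
    unfolding geo_seq_def using 1 by linarith+
  then show "geo_ratio p ^ (6 * m) \<le> 2 * real (geo_seq p m)" using s1 by linarith
qed

definition level_block :: "nat \<Rightarrow> nat" where "level_block p = (SOME L. geo_ratio p ^ L \<ge> 2)"

text \<open>
  A power of 2 that is constant on blocks of m, so that Cauchy condensation applies directly.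
\<close>

definition trunc_level :: "nat \<Rightarrow> nat \<Rightarrow> real" where "trunc_level p m = 2 ^ (m div level_block p)"

lemma level_block: "geo_ratio p ^ level_block p \<ge> 2" "level_block p > 0"
proof -
  obtain L where "2 < geo_ratio p ^ L" using real_arch_pow[OF geo_ratio_gt_1] by blast
  then have "geo_ratio p ^ L \<ge> 2" by simp
  then show b: "geo_ratio p ^ level_block p \<ge> 2" unfolding level_block_def by (rule someI)
  show "level_block p > 0" using b by (cases "level_block p") auto
qed

lemma trunc_level_ge_1: "trunc_level p m \<ge> 1" by (simp add: trunc_level_def)

lemma trunc_level_le: "trunc_level p m \<le> geo_ratio p ^ m"
proof -
  have "trunc_level p m \<le> (geo_ratio p ^ level_block p) ^ (m div level_block p)"
    unfolding trunc_level_def by (intro power_mono level_block) simp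
  also have "\<dots> = geo_ratio p ^ (level_block p * (m div level_block p))" by (simp add: power_mult)
  also have "\<dots> \<le> geo_ratio p ^ m" by (intro power_increasing) (use geo_ratio_gt_1[of p] in auto)
  finally show ?thesis .
qed

lemma inverse_geo_ratio_summable: "summable (\<lambda>m. c * (1 / geo_ratio p) ^ m)"
  by (intro summable_mult summable_geometric) (use geo_ratio_gt_1[of p] in simp)

lemma trunc_level_geo_seq_summable: "summable (\<lambda>m. (trunc_level p m)\<^sup>2 / sqrt (real (geo_seq p m)))"
proof (rule summable_comparison_test'[OF inverse_geo_ratio_summable[of 2 p]])
  fix m
  let ?r = "geo_ratio p"
  have r: "?r > 0" using geo_ratio_gt_1[of p] by simp
  have "(?r ^ (3 * m) / 2)\<^sup>2 = ?r ^ (6 * m) / 4" by (simp add: power_divide flip: power_mult)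
  also have "\<dots> \<le> real (geo_seq p m)" using geo_seq_bounds(4)[of p m] by simp
  finally have "?r ^ (3 * m) / 2 \<le> sqrt (real (geo_seq p m))" by (rule real_le_rsqrt)
  then have "(trunc_level p m)\<^sup>2 / sqrt (real (geo_seq p m)) \<le> (?r ^ m)\<^sup>2 / (?r ^ (3 * m) / 2)"
    using r trunc_level_ge_1[of p m] by (intro frac_le power_mono trunc_level_le) auto
  also have "\<dots> = 2 * (1 / ?r) ^ m"
  proof -
    have "?r ^ (3 * m) = (?r ^ m)\<^sup>2 * ?r ^ m" by (simp flip: power_mult power_add)
    then show ?thesis using r by (simp add: power_one_over)
  qed
  finally show "norm ((trunc_level p m)\<^sup>2 / sqrt (real (geo_seq p m))) \<le> 2 * (1 / ?r) ^ m" by simp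
qed

lemma inverse_geo_seq_summable: "summable (\<lambda>m. 1 / real (geo_seq p m))"
proof (rule summable_comparison_test'[OF inverse_geo_ratio_summable[of 2 p]])
  fix m
  let ?r = "geo_ratio p"
  have r: "?r > 0" "?r \<ge> 1" using geo_ratio_gt_1[of p] by simp_all
  have "?r ^ m \<le> ?r ^ (6 * m)" by (intro power_increasing r) simp
  also have "\<dots> \<le> 2 * real (geo_seq p m)" by (rule geo_seq_bounds)
  finally have "1 / real (geo_seq p m) \<le> 1 / (?r ^ m / 2)" using r geo_seq_bounds(1)[of p m] by (intro divide_left_mono mult_pos_pos) auto
  then show "norm (1 / real (geo_seq p m)) \<le> 2 * (1 / ?r) ^ m" by (simp add: power_one_over)
qed

lemma geo_seq_at_top: "filterlim (geo_seq p) at_top sequentially"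
proof -
  have "(\<lambda>m. 1 / real (geo_seq p m)) \<longlonglongrightarrow> 0" by (rule summable_LIMSEQ_zero[OF inverse_geo_seq_summable])
  then have "filterlim (\<lambda>m. inverse (1 / real (geo_seq p m))) at_top sequentially"
    by (intro filterlim_inverse_at_top) (use geo_seq_bounds(1) in \<open>auto simp: Suc_le_eq\<close>)
  then show ?thesis by (simp add: filterlim_sequentially_iff_filterlim_real)
qed

lemma sum_div_blocks:
  fixes f :: "nat \<Rightarrow> real"
  assumes "L > 0"
  shows "(\<Sum>m<N * L. f (m div L)) = real L * (\<Sum>k<N. f k)"
proof -
  have "(\<Sum>m<N * L. f (m div L)) = (\<Sum>k<N. sum (\<lambda>m. f (m div L)) {k * L..<k * L + L})"
    by (rule sum.nat_group[symmetric])
  also have "\<dots> = (\<Sum>k<N. \<Sum>m\<in>{k * L..<k * L + L}. f k)"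
  proof (intro sum.cong refl)
    fix k m assume "m \<in> {k * L..<k * L + L}"
    then have "m div L = k" by (intro div_nat_eqI) (auto simp: algebra_simps)
    then show "f (m div L) = f k" by simp
  qed
  finally show ?thesis by (simp add: sum_distrib_left)
qed

lemma summable_div_blocks:
  fixes f :: "nat \<Rightarrow> real"
  assumes "L > 0" "\<And>k. f k \<ge> 0" "summable f"
  shows "summable (\<lambda>m. f (m div L))"
proof (rule bounded_imp_summable)
  fix n
  have "m < Suc n * L" if "m \<le> n" for m
  proof -
    have "m < Suc n * 1" using that by simp
    also have "\<dots> \<le> Suc n * L" using assms by (intro mult_left_mono) auto
    finally show ?thesis .
  qed
  then have "(\<Sum>m\<le>n. f (m div L)) \<le> (\<Sum>m<Suc n * L. f (m div L))"
    using assms by (intro sum_mono2) auto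
  also have "\<dots> = real L * (\<Sum>k<Suc n. f k)" by (rule sum_div_blocks[OF assms(1)])
  also have "\<dots> \<le> real L * suminf f"
    by (intro mult_left_mono sum_le_suminf assms) auto
  finally show "(\<Sum>m\<le>n. f (m div L)) \<le> real L * suminf f" .
qed (use assms in simp)

text \<open>
  Condensation turns the series of 1 / (n h(n)) into the series of 1 / h(2^k), and each of its terms is
  repeated a fixed number of times.
\<close>

lemma truncation_tail_summable:
  fixes h :: "real \<Rightarrow> real"
  assumes h1: "\<And>x. 0 \<le> x \<Longrightarrow> 1 \<le> h x" and mono: "mono_on {0..} h"
    and sm: "summable (\<lambda>n. 1 / (real (Suc n) * h (real (Suc n))))"
  shows "summable (\<lambda>m. 1 / h (trunc_level p m))"
proof -
  define f where "f n = 1 / (real n * h (real n))" for n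
  have "summable f"
    using sm unfolding f_def by (subst (asm) summable_Suc_iff)
  moreover have "f n \<ge> f m" if "0 < m" "n \<le> m" "0 < n" for n m
  proof -
    have "h (real n) \<le> h (real m)" by (rule mono_onD[OF mono]) (use that in auto)
    moreover have "h (real n) \<ge> 1" by (rule h1) simp
    ultimately show ?thesis unfolding f_def using that by (intro divide_left_mono mult_mono mult_pos_pos) auto
  qed
  moreover have "f n \<ge> 0" for n unfolding f_def using h1[of "real n"] by simp
  ultimately have "summable (\<lambda>k. 2 ^ k * f (2 ^ k))"
    using condensation_test[of f] by simp
  then have "summable (\<lambda>k. 1 / h (2 ^ k))" by (simp add: f_def)
  then show ?thesis
    unfolding trunc_level_def using h1 by (intro summable_div_blocks level_block) (auto simp: order_trans[OF zero_le_one])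
qed

lemma geo_seq_bracket:
  assumes "n \<ge> 1"
  obtains m where "geo_seq p m \<le> n" "n < geo_seq p (Suc m)"
proof -
  have "\<forall>\<^sub>F m in sequentially. n < geo_seq p m"
    using filterlim_at_top[THEN iffD1, OF geo_seq_at_top[of p], rule_format, of "Suc n"]
    by (simp add: Suc_le_eq)
  then obtain m where m: "n < geo_seq p m" by (auto simp: eventually_sequentially)
  define k where "k = (LEAST m. n < geo_seq p m)"
  have k: "n < geo_seq p k" unfolding k_def by (rule LeastI[of "\<lambda>m. n < geo_seq p m", OF m])
  have "geo_seq p 0 = 1" by (simp add: geo_seq_def)
  then have "k \<noteq> 0" using k assms by (metis not_less)
  then obtain j where j: "k = Suc j" by (cases k) auto
  have "\<not> n < geo_seq p j" using not_less_Least[of j "\<lambda>m. n < geo_seq p m"] j by (simp add: k_def)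
  then show thesis using that[of j] k j by simp
qed

lemma geo_seq_ratio: "\<forall>\<^sub>F m in sequentially. real (geo_seq p (Suc m)) \<le> geo_ratio p ^ 7 * real (geo_seq p m)"
proof -
  let ?r = "geo_ratio p"
  have r: "?r > 1" by (rule geo_ratio_gt_1)
  have "\<forall>\<^sub>F m in sequentially. 1 / (?r - 1) < real (geo_seq p m)"
    using filterlim_compose[OF filterlim_real_sequentially geo_seq_at_top[of p]]
    unfolding filterlim_at_top_dense by blast
  then show ?thesis
  proof eventually_elim
    case (elim m)
    have "real (geo_seq p (Suc m)) \<le> ?r ^ 6 * ?r ^ (6 * m)"
      using geo_seq_bounds(2)[of p "Suc m"] by (simp add: power_add)
    also have "\<dots> \<le> ?r ^ 6 * (real (geo_seq p m) + 1)"
      using r geo_seq_bounds(3)[of p m] by (intro mult_left_mono) auto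
    also have "\<dots> \<le> ?r ^ 6 * (?r * real (geo_seq p m))"
    proof (intro mult_left_mono)
      have "1 < real (geo_seq p m) * (?r - 1)" using elim r by (simp add: divide_less_eq)
      then show "real (geo_seq p m) + 1 \<le> ?r * real (geo_seq p m)" by (simp add: algebra_simps)
    qed (use r in simp)
    finally show ?case by (simp add: power_numeral_reduce mult_ac)
  qed
qed

lemma geo_seq_mono: "m \<le> m' \<Longrightarrow> geo_seq p m \<le> geo_seq p m'"
  unfolding geo_seq_def
  by (intro nat_mono floor_mono power_increasing) (use geo_ratio_gt_1[of p] in auto)

section \<open>Almost sure convergence\<close>

context martingale_array
begin

definition mean_gap :: "nat \<Rightarrow> (int \<Rightarrow> int \<Rightarrow> real) \<Rightarrow> nat \<Rightarrow> 'a \<Rightarrow> real" where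
  "mean_gap a \<sigma> n \<omega> = (\<Sum>i<n. \<Sum>j<i. var_gap a \<sigma> i j \<omega>) / (real n)\<^sup>2"

definition mean_var_error :: "(int \<Rightarrow> int \<Rightarrow> real) \<Rightarrow> nat \<Rightarrow> real" where
  "mean_var_error \<sigma> n = (\<Sum>i<n. \<Sum>j<i. \<bar>(\<sigma> (int i + 1) (int j + 1))\<^sup>2 - 1\<bar>) / (real n)\<^sup>2"

definition trace_X :: "nat \<Rightarrow> complex \<Rightarrow> 'a \<Rightarrow> complex" where
  "trace_X n z \<omega> = trace_upto n (resolvent (entry_matrix n \<omega>) z n) / of_nat n"

text \<open>
  For each lag a the error terms tend to 0 almost surely, being summable in mean. What remains is a
  constant times the averaged gap at lag a; since the constant does not depend on a, the hypothesis
  makes it arbitrarily small.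
\<close>

lemma subsequence_convergence:
  assumes z: "Im z > 0"
    and var: "\<And>i j. (\<integral>\<omega>. (X i j \<omega>)\<^sup>2 \<partial>M) = (\<sigma> i j)\<^sup>2"
    and h_sum: "summable (\<lambda>n. 1 / (real (Suc n) * h (real (Suc n))))"
    and gap: "AE \<omega> in M. \<forall>\<epsilon>>0. \<exists>a\<ge>1. \<forall>\<^sub>F n in sequentially. mean_gap a \<sigma> n \<omega> < \<epsilon>"
    and err: "mean_var_error \<sigma> \<longlonglongrightarrow> 0"
  shows "AE \<omega> in M. (\<lambda>m. trace_X (geo_seq p m) z \<omega>) \<longlonglongrightarrow> semicircle_transform z"
proof -
  define w where "w = semicircle_root z"
  note wz = semicircle_root[OF z, folded w_def]
  define N where "N = geo_seq p"
  define \<tau> where "\<tau> = trunc_level p"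
  have N1: "N m \<ge> 1" for m unfolding N_def by (rule geo_seq_bounds)
  have N0: "real (N m) > 0" for m using N1[of m] by simp
  have t1: "\<tau> m \<ge> 1" for m unfolding \<tau>_def by (rule trunc_level_ge_1)
  have N_top: "filterlim N at_top sequentially" unfolding N_def by (rule geo_seq_at_top)
  have h_tail: "summable (\<lambda>m. 1 / h (\<tau> m))"
    unfolding \<tau>_def by (rule truncation_tail_summable[OF h_ge_1 h_mono h_sum])
  define dev where "dev m \<omega> = cmod (trace_upto (N m) (resolvent (trunc_matrix (\<tau> m) (N m) \<omega>) z (N m)) / of_nat (N m) + 1 / w)" for m \<omega>
  obtain c where c: "c \<ge> 0" and cD: "\<And>a. a \<ge> 1 \<Longrightarrow> \<exists>D\<ge>0. \<forall>\<tau>\<ge>1. \<forall>n\<ge>1. \<exists>r. integrable M r \<and> (\<forall>\<omega>. 0 \<le> r \<omega>) \<and>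
      (\<integral>\<omega>. r \<omega> \<partial>M) \<le> D * (\<tau>\<^sup>2 / sqrt (real n) + 1 / h \<tau>) \<and>
    (AE \<omega> in M. cmod (trace_upto n (resolvent (trunc_matrix \<tau> n \<omega>) z n) / of_nat n + 1 / w) \<le> r \<omega>
      + c * (mean_gap a \<sigma> n \<omega> + mean_var_error \<sigma> n))"
    using truncated_resolvent_fluctuation[OF wz(3,2) var, unfolded wz(1)]
    unfolding mean_gap_def mean_var_error_def by blast
  have dev_a: "AE \<omega> in M. \<forall>\<epsilon>>0. (\<forall>\<^sub>F n in sequentially. mean_gap a \<sigma> n \<omega> < \<epsilon>) \<longrightarrow>
      (\<forall>\<^sub>F m in sequentially. dev m \<omega> < (1 + 2 * c) * \<epsilon>)" if a: "a \<ge> 1" for a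
  proof -
    obtain D where D: "D \<ge> 0" "\<And>\<tau> n. \<tau> \<ge> 1 \<Longrightarrow> n \<ge> 1 \<Longrightarrow> \<exists>r. integrable M r \<and> (\<forall>\<omega>. 0 \<le> r \<omega>) \<and>
      (\<integral>\<omega>. r \<omega> \<partial>M) \<le> D * (\<tau>\<^sup>2 / sqrt (real n) + 1 / h \<tau>) \<and>
      (AE \<omega> in M. cmod (trace_upto n (resolvent (trunc_matrix \<tau> n \<omega>) z n) / of_nat n + 1 / w) \<le> r \<omega>
        + c * (mean_gap a \<sigma> n \<omega> + mean_var_error \<sigma> n))"
      using cD[OF a] by blast
    have "\<forall>m. \<exists>r. integrable M r \<and> (\<forall>\<omega>. 0 \<le> r \<omega>) \<and>
      (\<integral>\<omega>. r \<omega> \<partial>M) \<le> D * ((\<tau> m)\<^sup>2 / sqrt (real (N m)) + 1 / h (\<tau> m)) \<and>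
      (AE \<omega> in M. dev m \<omega> \<le> r \<omega> + c * (mean_gap a \<sigma> (N m) \<omega> + mean_var_error \<sigma> (N m)))"
      unfolding dev_def by (intro allI D(2) t1 N1)
    from choice[OF this] obtain r where R: "\<forall>m. integrable M (r m) \<and> (\<forall>\<omega>. 0 \<le> r m \<omega>) \<and>
      (\<integral>\<omega>. r m \<omega> \<partial>M) \<le> D * ((\<tau> m)\<^sup>2 / sqrt (real (N m)) + 1 / h (\<tau> m)) \<and>
      (AE \<omega> in M. dev m \<omega> \<le> r m \<omega> + c * (mean_gap a \<sigma> (N m) \<omega> + mean_var_error \<sigma> (N m)))" ..
    then have r: "\<And>m. integrable M (r m)" "\<And>m \<omega>. 0 \<le> r m \<omega>"
      "\<And>m. (\<integral>\<omega>. r m \<omega> \<partial>M) \<le> D * ((\<tau> m)\<^sup>2 / sqrt (real (N m)) + 1 / h (\<tau> m))"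
      "\<And>m. AE \<omega> in M. dev m \<omega> \<le> r m \<omega> + c * (mean_gap a \<sigma> (N m) \<omega> + mean_var_error \<sigma> (N m))"
      by simp_all
    have "summable (\<lambda>m. D * ((\<tau> m)\<^sup>2 / sqrt (real (N m)) + 1 / h (\<tau> m)))"
      using trunc_level_geo_seq_summable[of p] h_tail unfolding N_def \<tau>_def by (intro summable_mult summable_add)
    then have "summable (\<lambda>m. \<integral>\<omega>. r m \<omega> \<partial>M)"
      by (rule summable_comparison_test'[where N = 0]) (use r in auto)
    then have "AE \<omega> in M. (\<lambda>m. r m \<omega>) \<longlonglongrightarrow> 0" by (rule AE_tendsto_0_of_summable[OF r(1,2)])
    moreover have "AE \<omega> in M. \<forall>m. dev m \<omega> \<le> r m \<omega> + c * (mean_gap a \<sigma> (N m) \<omega> + mean_var_error \<sigma> (N m))"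
      using r(4) by (simp add: AE_all_countable)
    ultimately show ?thesis
    proof eventually_elim
      case (elim \<omega>)
      show ?case
      proof (intro allI impI)
        fix \<epsilon> :: real assume eps: "\<epsilon> > 0" and g: "\<forall>\<^sub>F n in sequentially. mean_gap a \<sigma> n \<omega> < \<epsilon>"
        have "\<forall>\<^sub>F m in sequentially. mean_gap a \<sigma> (N m) \<omega> < \<epsilon>"
          using N_top g by (rule filterlim_iff[THEN iffD1, rule_format])
        moreover have "\<forall>\<^sub>F m in sequentially. mean_var_error \<sigma> (N m) < \<epsilon>"
          using order_tendstoD(2)[OF err eps] N_top by (rule filterlim_iff[THEN iffD1, rule_format, rotated])
        moreover have "\<forall>\<^sub>F m in sequentially. r m \<omega> < \<epsilon>"
          using elim(1) eps by (rule order_tendstoD(2))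
        ultimately show "\<forall>\<^sub>F m in sequentially. dev m \<omega> < (1 + 2 * c) * \<epsilon>"
        proof eventually_elim
          case (elim m)
          have "dev m \<omega> \<le> r m \<omega> + c * (mean_gap a \<sigma> (N m) \<omega> + mean_var_error \<sigma> (N m))"
            using \<open>\<forall>m. dev m \<omega> \<le> _ m\<close> by simp
          also have "\<dots> \<le> r m \<omega> + c * (\<epsilon> + \<epsilon>)" using elim c by (intro add_left_mono mult_left_mono) auto
          also have "\<dots> < \<epsilon> + c * (\<epsilon> + \<epsilon>)" using elim by simp
          finally show ?case by (simp add: algebra_simps)
        qed
      qed
    qed
  qed
  define d where "d m \<omega> = (\<Sum>j<N m. \<Sum>k<N m. (entry_matrix (N m) \<omega> j k - trunc_matrix (\<tau> m) (N m) \<omega> j k)\<^sup>2) / real (N m)" for m \<omega>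
  have d_int: "integrable M (d m)" and d_le: "(\<integral>\<omega>. d m \<omega> \<partial>M) \<le> C / real (N m) + 4 * C / h (\<tau> m)" for m
    unfolding d_def using truncation_frobenius[OF t1 N1, of m m] by auto
  have d0: "0 \<le> d m \<omega>" for m \<omega> unfolding d_def by (intro divide_nonneg_nonneg sum_nonneg) auto
  have d_lim: "AE \<omega> in M. (\<lambda>m. d m \<omega>) \<longlonglongrightarrow> 0"
  proof (rule AE_tendsto_0_of_summable[OF d_int d0])
    have "summable (\<lambda>m. C * (1 / real (N m)) + 4 * C * (1 / h (\<tau> m)))"
      using inverse_geo_seq_summable[of p] h_tail unfolding N_def by (intro summable_add summable_mult)
    then show "summable (\<lambda>m. \<integral>\<omega>. d m \<omega> \<partial>M)"
      by (rule summable_comparison_test'[where N = 0]) (use d_le d0 in auto)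
  qed
  have "AE \<omega> in M. \<forall>a\<ge>1. \<forall>\<epsilon>>0. (\<forall>\<^sub>F n in sequentially. mean_gap a \<sigma> n \<omega> < \<epsilon>) \<longrightarrow>
      (\<forall>\<^sub>F m in sequentially. dev m \<omega> < (1 + 2 * c) * \<epsilon>)"
    using dev_a by (simp add: AE_all_countable)
  with gap d_lim show ?thesis
  proof eventually_elim
    case (elim \<omega>)
    have "(\<lambda>m. dev m \<omega>) \<longlonglongrightarrow> 0"
    proof (rule tendstoI)
      fix e :: real assume "e > 0"
      then have e: "e / (1 + 2 * c) > 0" using c by simp
      then obtain a where "a \<ge> 1" "\<forall>\<^sub>F n in sequentially. mean_gap a \<sigma> n \<omega> < e / (1 + 2 * c)"
        using elim(1) by blast
      then have "\<forall>\<^sub>F m in sequentially. dev m \<omega> < (1 + 2 * c) * (e / (1 + 2 * c))" using elim(3) e by blast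
      then show "\<forall>\<^sub>F m in sequentially. dist (dev m \<omega>) 0 < e"
        by eventually_elim (use c in \<open>simp add: dev_def\<close>)
    qed
    then have "(\<lambda>m. trace_upto (N m) (resolvent (trunc_matrix (\<tau> m) (N m) \<omega>) z (N m)) / of_nat (N m) + 1 / w) \<longlonglongrightarrow> 0"
      unfolding dev_def by (rule tendsto_norm_zero_cancel)
    moreover have "(\<lambda>m. trace_X (N m) z \<omega> - trace_upto (N m) (resolvent (trunc_matrix (\<tau> m) (N m) \<omega>) z (N m)) / of_nat (N m)) \<longlonglongrightarrow> 0"
    proof (rule Lim_null_comparison)
      show "\<forall>\<^sub>F m in sequentially. norm (trace_X (N m) z \<omega> - trace_upto (N m) (resolvent (trunc_matrix (\<tau> m) (N m) \<omega>) z (N m)) / of_nat (N m))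
          \<le> sqrt (d m \<omega>) / (Im z)\<^sup>2"
      proof (rule always_eventually, rule allI)
        fix m
        let ?F = "\<Sum>j<N m. \<Sum>k<N m. (entry_matrix (N m) \<omega> j k - trunc_matrix (\<tau> m) (N m) \<omega> j k)\<^sup>2"
        have "norm (trace_X (N m) z \<omega> - trace_upto (N m) (resolvent (trunc_matrix (\<tau> m) (N m) \<omega>) z (N m)) / of_nat (N m))
           = cmod (trace_upto (N m) (resolvent (entry_matrix (N m) \<omega>) z (N m)) - trace_upto (N m) (resolvent (trunc_matrix (\<tau> m) (N m) \<omega>) z (N m))) / real (N m)"
          by (simp add: trace_X_def norm_divide flip: diff_divide_distrib)
        also have "\<dots> \<le> (sqrt ?F * sqrt (real (N m)) / (Im z)\<^sup>2) / real (N m)"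
          by (intro divide_right_mono trace_resolvent_perturb entry_matrix_symmetric trunc_matrix_symmetric z) simp
        also have "\<dots> = sqrt (d m \<omega>) / (Im z)\<^sup>2"
        proof -
          have "sqrt (real (N m)) / real (N m) = 1 / sqrt (real (N m))"
            using N0[of m] by (simp add: real_div_sqrt divide_simps)
          then have eq: "sqrt ?F * (sqrt (real (N m)) / real (N m)) = sqrt (d m \<omega>)"
            by (simp add: d_def real_sqrt_divide)
          have "(sqrt ?F * sqrt (real (N m)) / (Im z)\<^sup>2) / real (N m)
              = sqrt ?F * (sqrt (real (N m)) / real (N m)) / (Im z)\<^sup>2" by simp
          then show ?thesis by (simp only: eq)
        qed
        finally show "norm (trace_X (N m) z \<omega> - trace_upto (N m) (resolvent (trunc_matrix (\<tau> m) (N m) \<omega>) z (N m)) / of_nat (N m))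
          \<le> sqrt (d m \<omega>) / (Im z)\<^sup>2" .
      qed
      have "(\<lambda>m. sqrt (d m \<omega>) / (Im z)\<^sup>2) \<longlonglongrightarrow> sqrt 0 / (Im z)\<^sup>2"
        using elim(2) z by (intro tendsto_intros) auto
      then show "(\<lambda>m. sqrt (d m \<omega>) / (Im z)\<^sup>2) \<longlonglongrightarrow> 0" by simp
    qed
    ultimately have "(\<lambda>m. (trace_upto (N m) (resolvent (trunc_matrix (\<tau> m) (N m) \<omega>) z (N m)) / of_nat (N m) + 1 / w)
      + (trace_X (N m) z \<omega> - trace_upto (N m) (resolvent (trunc_matrix (\<tau> m) (N m) \<omega>) z (N m)) / of_nat (N m)) + - 1 / w) \<longlonglongrightarrow> 0 + 0 + - 1 / w"
      by (intro tendsto_add tendsto_const)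
    then show ?case by (simp add: N_def semicircle_transform_def w_def)
  qed
qed

text \<open>
  Enlarging the minor from N to n rows changes the trace by at most (n - N) / Im z, and the different
  normalisation amounts to a rescaling of z by sqrt(n/N).
\<close>

lemma trace_X_interpolation:
  assumes z: "Im z > 0" and N: "1 \<le> N" "N \<le> n" and q: "real n \<le> q * real N"
  shows "cmod (trace_X n z \<omega> - trace_X N z \<omega>) \<le> (q - 1) * (3 / Im z + cmod z / (Im z)\<^sup>2)"
proof -
  let ?\<eta> = "Im z"
  have N0: "real N > 0" and n0: "real n > 0" using N by auto
  define k where "k = sqrt (real n / real N)"
  have k1: "k \<ge> 1" using N by (simp add: k_def)
  have q1: "q \<ge> 1" using q N N0 by (metis mult_1 mult_le_cancel_right_pos of_nat_mono order_trans)
  have kk: "k * k = real n / real N" by (simp add: k_def)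
  have kq: "k \<le> q"
  proof -
    have "k * 1 \<le> k * k" using k1 by (intro mult_left_mono) auto
    also have "\<dots> \<le> q" unfolding kk using q N0 by (simp add: divide_le_eq)
    finally show ?thesis by simp
  qed
  define T where "T = trace_upto N (resolvent (entry_matrix N \<omega>) z N)"
  define T' where "T' = trace_upto N (resolvent (entry_matrix n \<omega>) z N)"
  define T'' where "T'' = trace_upto n (resolvent (entry_matrix n \<omega>) z n)"
  have T'k: "T' = of_real k * trace_upto N (resolvent (entry_matrix N \<omega>) (of_real k * z) N)"
  proof -
    have X: "entry_matrix n \<omega> = (\<lambda>i j. (1 / k) * entry_matrix N \<omega> i j)"
      using N0 n0 by (intro ext) (simp add: entry_matrix_def k_def real_sqrt_divide)
    have "resolvent (entry_matrix n \<omega>) (of_real (1 / k) * (of_real k * z)) N i j = resolvent (entry_matrix N \<omega>) (of_real k * z) N i j / of_real (1 / k)" for i j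
      unfolding X by (rule resolvent_scale) (use k1 in simp)
    moreover have "of_real (1 / k) * (of_real k * z) = z" using k1 by simp
    ultimately have "resolvent (entry_matrix n \<omega>) z N i j = of_real k * resolvent (entry_matrix N \<omega>) (of_real k * z) N i j" for i j
      by (simp add: mult.commute)
    then show ?thesis by (simp add: T'_def trace_upto_def sum_distrib_left)
  qed
  have T_le: "cmod T \<le> real N / ?\<eta>" and T'_le: "cmod T' \<le> real N / ?\<eta>"
    unfolding T_def T'_def by (intro trace_upto_resolvent_le entry_matrix_symmetric z order_refl)+
  have 1: "cmod (T'' - T') \<le> (real n - real N) / ?\<eta>"
    using trace_upto_resolvent_steps_le[OF entry_matrix_symmetric z, of N "n - N" n \<omega>] N by (simp add: T'_def T''_def of_nat_diff)
  have 2: "cmod (T' - T) \<le> (k - 1) * (cmod z / ?\<eta>\<^sup>2 + 1 / ?\<eta>) * real N"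
  proof -
    let ?U = "trace_upto N (resolvent (entry_matrix N \<omega>) (of_real k * z) N)"
    have kz: "Im (of_real k * z) > 0" using z k1 by simp
    have "T' - T = of_real k * (?U - T) + of_real (k - 1) * T" by (simp add: T'k algebra_simps)
    then have a: "cmod (T' - T) \<le> k * cmod (?U - T) + (k - 1) * cmod T"
      using k1 norm_triangle_ineq[of "of_real k * (?U - T)" "of_real (k - 1) * T"]
      by (simp add: norm_mult del: of_real_diff)
    have kzz: "cmod (of_real k * z - z) = (k - 1) * cmod z"
    proof -
      have "of_real k * z - z = of_real (k - 1) * z" by (simp add: algebra_simps)
      then have "cmod (of_real k * z - z) = \<bar>k - 1\<bar> * cmod z" by (simp only: norm_mult norm_of_real)
      then show ?thesis using k1 by simp
    qed
    have b: "cmod (?U - T) \<le> (k - 1) * cmod z * real N / (Im (of_real k * z) * ?\<eta>)"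
      unfolding T_def by (rule trace_resolvent_lipschitz_z[OF entry_matrix_symmetric kz z, of N N \<omega>, unfolded kzz])
    have "k * cmod (?U - T) \<le> k * ((k - 1) * cmod z * real N / (Im (of_real k * z) * ?\<eta>))"
      using k1 by (intro mult_left_mono b) simp
    also have "\<dots> = (k - 1) * (cmod z / ?\<eta>\<^sup>2) * real N"
      using k1 z by (simp add: power2_eq_square)
    finally have c: "k * cmod (?U - T) \<le> (k - 1) * (cmod z / ?\<eta>\<^sup>2) * real N" .
    have d: "(k - 1) * cmod T \<le> (k - 1) * (real N / ?\<eta>)" using k1 by (intro mult_left_mono T_le) simp
    have "cmod (T' - T) \<le> (k - 1) * (cmod z / ?\<eta>\<^sup>2) * real N + (k - 1) * (real N / ?\<eta>)"
      using a c d by linarith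
    also have "\<dots> = (k - 1) * (cmod z / ?\<eta>\<^sup>2 + 1 / ?\<eta>) * real N" by (simp add: algebra_simps)
    finally show ?thesis .
  qed
  have "trace_X n z \<omega> - trace_X N z \<omega> = (T'' - T') / of_nat n + T' * (1 / of_nat n - 1 / of_nat N) + (T' - T) / of_nat N"
    using N0 n0 by (simp add: trace_X_def T_def[symmetric] T''_def[symmetric] diff_divide_distrib right_diff_distrib)
  moreover have "cmod (x + y + u) \<le> cmod x + cmod y + cmod u" for x y u
    by (intro norm_triangle_le add_right_mono norm_triangle_ineq)
  ultimately have tri: "cmod (trace_X n z \<omega> - trace_X N z \<omega>)
      \<le> cmod ((T'' - T') / of_nat n) + cmod (T' * (1 / of_nat n - 1 / of_nat N)) + cmod ((T' - T) / of_nat N)"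
    by (simp only:)
  have a: "cmod ((T'' - T') / of_nat n) \<le> (q - 1) / ?\<eta>"
  proof -
    have "cmod ((T'' - T') / of_nat n) \<le> ((real n - real N) / ?\<eta>) / real n"
      unfolding norm_divide norm_of_nat by (intro divide_right_mono 1) simp
    also have "\<dots> \<le> ((real n - real N) / ?\<eta>) / real N"
      using N z N0 by (intro divide_left_mono) auto
    also have "\<dots> \<le> (q - 1) / ?\<eta>" using q N0 z by (simp add: field_simps)
    finally show ?thesis .
  qed
  have b: "cmod (T' * (1 / of_nat n - 1 / of_nat N)) \<le> (q - 1) / ?\<eta>"
  proof -
    have "1 / complex_of_nat n - 1 / of_nat N = of_real (1 / real n - 1 / real N)" by simp
    then have eq: "cmod (1 / of_nat n - 1 / of_nat N :: complex) = 1 / real N - 1 / real n"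
      using N N0 n0 by (simp only: norm_of_real) (simp add: frac_le)
    have "cmod (T' * (1 / of_nat n - 1 / of_nat N)) \<le> (real N / ?\<eta>) * (1 / real N - 1 / real n)"
      unfolding norm_mult eq by (rule mult_right_mono[OF T'_le]) (use N N0 in \<open>simp add: frac_le\<close>)
    also have "\<dots> = (1 - real N / real n) / ?\<eta>"
      using N0 by (simp add: right_diff_distrib diff_divide_distrib)
    also have "\<dots> \<le> (q - 1) / ?\<eta>"
    proof (rule divide_right_mono)
      have "1 - real N / real n = (real n - real N) / real n" using n0 by (simp add: diff_divide_distrib)
      also have "\<dots> \<le> (real n - real N) / real N" using N N0 by (intro divide_left_mono) auto
      also have "\<dots> \<le> q - 1" using q N0 by (simp add: field_simps)
      finally show "1 - real N / real n \<le> q - 1" .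
    qed (use z in simp)
    finally show ?thesis .
  qed
  have c: "cmod ((T' - T) / of_nat N) \<le> (q - 1) * (cmod z / ?\<eta>\<^sup>2 + 1 / ?\<eta>)"
  proof -
    have "cmod ((T' - T) / of_nat N) \<le> ((k - 1) * (cmod z / ?\<eta>\<^sup>2 + 1 / ?\<eta>) * real N) / real N"
      unfolding norm_divide norm_of_nat by (intro divide_right_mono 2) simp
    also have "\<dots> = (k - 1) * (cmod z / ?\<eta>\<^sup>2 + 1 / ?\<eta>)" using N0 by simp
    also have "\<dots> \<le> (q - 1) * (cmod z / ?\<eta>\<^sup>2 + 1 / ?\<eta>)"
      using kq z by (intro mult_right_mono) auto
    finally show ?thesis .
  qed
  have "(q - 1) / ?\<eta> + (q - 1) / ?\<eta> + (q - 1) * (cmod z / ?\<eta>\<^sup>2 + 1 / ?\<eta>)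
      = (q - 1) * (3 / ?\<eta> + cmod z / ?\<eta>\<^sup>2)"
    by (simp add: algebra_simps add_divide_distrib diff_divide_distrib)
  with tri a b c show ?thesis by linarith
qed

end

lemma countable_complex_rationals: "countable {z. Re z \<in> \<rat> \<and> Im z \<in> \<rat>}"
proof -
  have "{z. Re z \<in> \<rat> \<and> Im z \<in> \<rat>} \<subseteq> (\<lambda>(x, y). Complex x y) ` (\<rat> \<times> \<rat>)"
  proof
    fix z assume "z \<in> {z. Re z \<in> \<rat> \<and> Im z \<in> \<rat>}"
    then have "(Re z, Im z) \<in> \<rat> \<times> \<rat>" by simp
    then show "z \<in> (\<lambda>(x, y). Complex x y) ` (\<rat> \<times> \<rat>)" by (rule rev_image_eqI) simp
  qed
  then show ?thesis by (rule countable_subset) (intro countable_image countable_SIGMA countable_rat)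
qed

lemma lower_triangle_sum_le:
  fixes f :: "int \<Rightarrow> int \<Rightarrow> real"
  assumes "\<And>i j. f i j \<ge> 0"
  shows "(\<Sum>i<n. \<Sum>j<i. f (int i + 1) (int j + 1)) \<le> (\<Sum>i\<in>{1..int n}. \<Sum>j\<in>{1..i}. f i j)"
proof -
  have inj: "inj_on (\<lambda>k. int k + 1) I" for I by (auto simp: inj_on_def)
  have img: "(\<lambda>k. int k + 1) ` {..<m} = {1..int m}" for m
  proof
    show "{1..int m} \<subseteq> (\<lambda>k. int k + 1) ` {..<m}"
    proof
      fix x assume "x \<in> {1..int m}"
      then have "x = int (nat (x - 1)) + 1" "nat (x - 1) < m" by auto
      then show "x \<in> (\<lambda>k. int k + 1) ` {..<m}" by blast
    qed
  qed auto
  have "(\<Sum>i<n. \<Sum>j<i. f (int i + 1) (int j + 1)) \<le> (\<Sum>i<n. \<Sum>j\<in>{1..int i + 1}. f (int i + 1) j)"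
  proof (rule sum_mono)
    fix i
    have "(\<Sum>j<i. f (int i + 1) (int j + 1)) = (\<Sum>j\<in>{1..int i}. f (int i + 1) j)"
      unfolding img[symmetric] by (simp add: sum.reindex[OF inj])
    also have "\<dots> \<le> (\<Sum>j\<in>{1..int i + 1}. f (int i + 1) j)"
      by (intro sum_mono2 assms) auto
    finally show "(\<Sum>j<i. f (int i + 1) (int j + 1)) \<le> (\<Sum>j\<in>{1..int i + 1}. f (int i + 1) j)" .
  qed
  also have "\<dots> = (\<Sum>i\<in>{1..int n}. \<Sum>j\<in>{1..i}. f i j)"
    unfolding img[symmetric, of n] by (simp add: sum.reindex[OF inj])
  finally show ?thesis .
qed

context martingale_array
begin

lemma trace_X_convergence:
  assumes z: "Im z > 0"
    and var: "\<And>i j. (\<integral>\<omega>. (X i j \<omega>)\<^sup>2 \<partial>M) = (\<sigma> i j)\<^sup>2"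
    and h_sum: "summable (\<lambda>n. 1 / (real (Suc n) * h (real (Suc n))))"
    and gap: "AE \<omega> in M. \<forall>\<epsilon>>0. \<exists>a\<ge>1. \<forall>\<^sub>F n in sequentially. mean_gap a \<sigma> n \<omega> < \<epsilon>"
    and err: "mean_var_error \<sigma> \<longlonglongrightarrow> 0"
  shows "AE \<omega> in M. (\<lambda>n. trace_X n z \<omega>) \<longlonglongrightarrow> semicircle_transform z"
proof -
  have "AE \<omega> in M. \<forall>p. (\<lambda>m. trace_X (geo_seq p m) z \<omega>) \<longlonglongrightarrow> semicircle_transform z"
    using subsequence_convergence[OF z var h_sum gap err] by (simp add: AE_all_countable)
  then show ?thesis
  proof eventually_elim
    case (elim \<omega>)
    define K where "K = 3 / Im z + cmod z / (Im z)\<^sup>2"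
    have K: "K \<ge> 0" using z by (simp add: K_def)
    show ?case
    proof (rule tendstoI)
      fix e :: real assume e: "e > 0"
      have "(\<lambda>p. (geo_ratio p ^ 7 - 1) * K) \<longlonglongrightarrow> ((1 + 0) ^ 7 - 1) * K"
        unfolding geo_ratio_def by (intro tendsto_intros LIMSEQ_Suc[OF lim_1_over_n])
      then have "(\<lambda>p. (geo_ratio p ^ 7 - 1) * K) \<longlonglongrightarrow> 0" by simp
      then have "\<forall>\<^sub>F p in sequentially. (geo_ratio p ^ 7 - 1) * K < e / 2"
        by (rule order_tendstoD) (use e in simp)
      then obtain p where p: "(geo_ratio p ^ 7 - 1) * K < e / 2" by (auto simp: eventually_sequentially)
      have "\<forall>\<^sub>F m in sequentially. dist (trace_X (geo_seq p m) z \<omega>) (semicircle_transform z) < e / 2"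
        using elim e by (intro tendstoD) auto
      from eventually_conj[OF this geo_seq_ratio[of p]]
      obtain m0 where m0: "\<And>m. m \<ge> m0 \<Longrightarrow> dist (trace_X (geo_seq p m) z \<omega>) (semicircle_transform z) < e / 2"
        "\<And>m. m \<ge> m0 \<Longrightarrow> real (geo_seq p (Suc m)) \<le> geo_ratio p ^ 7 * real (geo_seq p m)"
        unfolding eventually_sequentially by auto
      show "\<forall>\<^sub>F n in sequentially. dist (trace_X n z \<omega>) (semicircle_transform z) < e"
        unfolding eventually_sequentially
      proof (intro exI[of _ "geo_seq p m0"] allI impI)
        fix n assume n: "geo_seq p m0 \<le> n"
        have n1: "n \<ge> 1" using n geo_seq_bounds(1)[of p m0] by simp
        obtain m where m: "geo_seq p m \<le> n" "n < geo_seq p (Suc m)" by (rule geo_seq_bracket[OF n1])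
        have mm: "m \<ge> m0"
        proof (rule ccontr)
          assume "\<not> m \<ge> m0"
          then have "geo_seq p (Suc m) \<le> geo_seq p m0" by (intro geo_seq_mono) simp
          then show False using m n by simp
        qed
        have "real n \<le> geo_ratio p ^ 7 * real (geo_seq p m)" using m0(2)[OF mm] m(2) by linarith
        then have "cmod (trace_X n z \<omega> - trace_X (geo_seq p m) z \<omega>) \<le> (geo_ratio p ^ 7 - 1) * K"
          unfolding K_def by (intro trace_X_interpolation z geo_seq_bounds m)
        then have "dist (trace_X n z \<omega>) (trace_X (geo_seq p m) z \<omega>) < e / 2" using p by (simp add: dist_norm)
        then show "dist (trace_X n z \<omega>) (semicircle_transform z) < e"
          using m0(1)[OF mm] dist_triangle[of "trace_X n z \<omega>" "semicircle_transform z" "trace_X (geo_seq p m) z \<omega>"]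
          by linarith
      qed
    qed
  qed
qed

lemma trace_X_lipschitz:
  assumes "Im z > 0" "Im z' \<ge> Im z" "n \<ge> 1"
  shows "cmod (trace_X n z \<omega> - trace_X n z' \<omega>) \<le> cmod (z - z') / (Im z)\<^sup>2"
proof -
  have n0: "real n > 0" using assms by simp
  have "cmod (trace_X n z \<omega> - trace_X n z' \<omega>) = cmod (trace_upto n (resolvent (entry_matrix n \<omega>) z n) - trace_upto n (resolvent (entry_matrix n \<omega>) z' n)) / real n"
    by (simp add: trace_X_def norm_divide flip: diff_divide_distrib)
  also have "\<dots> \<le> (cmod (z - z') * real n / (Im z * Im z')) / real n"
    using assms by (intro divide_right_mono trace_resolvent_lipschitz_z entry_matrix_symmetric) auto
  also have "\<dots> = cmod (z - z') / (Im z * Im z')" using n0 by simp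
  also have "\<dots> \<le> cmod (z - z') / (Im z)\<^sup>2"
    unfolding power2_eq_square using assms by (intro divide_left_mono mult_left_mono mult_pos_pos) auto
  finally show ?thesis .
qed

text \<open>
  The exceptional null set depends on z. Rational points suffice, because both sides are Lipschitz
  near z, uniformly in n.
\<close>

lemma trace_X_convergence_everywhere:
  assumes conv: "\<And>z. Im z > 0 \<Longrightarrow> Re z \<in> \<rat> \<Longrightarrow> Im z \<in> \<rat> \<Longrightarrow> (\<lambda>n. trace_X n z \<omega>) \<longlonglongrightarrow> semicircle_transform z"
    and z: "Im z > 0"
  shows "(\<lambda>n. trace_X n z \<omega>) \<longlonglongrightarrow> semicircle_transform z"
proof (rule tendstoI)
  fix e :: real assume e: "e > 0"
  define k where "k = 1 - cmod (semicircle_transform z)"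
  have k: "k > 0" using semicircle_transform(2)[OF z] by (simp add: k_def)
  define c where "c = 1 / (Im z)\<^sup>2 + 1 / k"
  have c: "c > 0" using z k by (simp add: c_def add_pos_pos)
  define \<delta> where "\<delta> = e / (4 * c)"
  have d: "\<delta> > 0" using e c by (simp add: \<delta>_def)
  obtain x where x: "x \<in> \<rat>" "Re z < x" "x < Re z + \<delta>" using Rats_dense_in_real[of "Re z" "Re z + \<delta>"] d by auto
  obtain y where y: "y \<in> \<rat>" "Im z < y" "y < Im z + \<delta>" using Rats_dense_in_real[of "Im z" "Im z + \<delta>"] d by auto
  let ?z = "Complex x y"
  have z': "Im ?z > 0" "Im ?z \<ge> Im z" using y z by auto
  have dz: "cmod (z - ?z) < 2 * \<delta>"
    using cmod_le[of "z - ?z"] x y by simp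
  have s: "cmod (semicircle_transform z - semicircle_transform ?z) \<le> cmod (z - ?z) / k"
    using semicircle_transform_lipschitz[OF z z'(1)] k by (simp add: k_def[symmetric] pos_le_divide_eq)
  have "\<forall>\<^sub>F n in sequentially. dist (trace_X n ?z \<omega>) (semicircle_transform ?z) < e / 2"
    using conv[OF z'(1)] x y e by (intro tendstoD) auto
  moreover have "\<forall>\<^sub>F n in sequentially. n \<ge> 1" by (rule eventually_ge_at_top)
  ultimately show "\<forall>\<^sub>F n in sequentially. dist (trace_X n z \<omega>) (semicircle_transform z) < e"
  proof eventually_elim
    case (elim n)
    have "cmod (trace_X n z \<omega> - semicircle_transform z) \<le>
      cmod (trace_X n z \<omega> - trace_X n ?z \<omega>) + (cmod (trace_X n ?z \<omega> - semicircle_transform ?z)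
        + cmod (semicircle_transform z - semicircle_transform ?z))"
      by norm
    also have "\<dots> \<le> cmod (z - ?z) / (Im z)\<^sup>2 + (cmod (trace_X n ?z \<omega> - semicircle_transform ?z) + cmod (z - ?z) / k)"
      by (intro add_mono trace_X_lipschitz z z' s order_refl elim)
    also have "\<dots> = cmod (z - ?z) * c + cmod (trace_X n ?z \<omega> - semicircle_transform ?z)"
      by (simp add: c_def distrib_left)
    also have "\<dots> < 2 * \<delta> * c + e / 2"
      using elim(1) dz c by (intro add_strict_mono mult_strict_right_mono) (auto simp: dist_norm)
    also have "\<dots> = e" using c by (simp add: \<delta>_def)
    finally show ?case by (simp add: dist_norm)
  qed
qed

lemma spectral_cdf_eq_ecdf:
  obtains ls where "length ls = n" "spectral_cdf (normalized_matrix X n \<omega>) = ecdf ls"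
    "\<And>z. Im z > 0 \<Longrightarrow> stieltjes ls z = trace_X n z \<omega>"
proof -
  define A where "A = mat n n (\<lambda>(r, c). entry_matrix n \<omega> r c)"
  have A: "normalized_matrix X n \<omega> = A"
    by (rule eq_matI)
      (auto simp: normalized_matrix_def sym_matrix_def A_def entry_matrix_def Let_def max_def min_def)
  obtain ls where ls: "length ls = n" "char_poly A = (\<Prod>l\<leftarrow>ls. [:- l, 1:])"
    using symmetric_char_poly_splits[OF entry_matrix_symmetric, of n n \<omega>] unfolding A_def by blast
  show thesis
  proof (rule that[OF ls(1)])
    show "spectral_cdf (normalized_matrix X n \<omega>) = ecdf ls"
    proof
      fix t
      have "filter_mset (\<lambda>l. l \<le> t) (mset ls) = mset (filter (\<lambda>l. l \<le> t) ls)" by simp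
      then show "spectral_cdf (normalized_matrix X n \<omega>) t = ecdf ls t"
        unfolding spectral_cdf_def ecdf_def A ls(2) proots_linear_product
        by (simp only: size_mset ls(1)) (simp add: A_def)
    qed
    show "stieltjes ls z = trace_X n z \<omega>" if "Im z > 0" for z
      unfolding stieltjes_def trace_X_def ls(1)
      using trace_resolvent_eigenvalues[OF entry_matrix_symmetric that ls(2)[unfolded A_def]] by simp
  qed
qed

lemma spectral_cdf_convergence:
  assumes "\<And>z. Im z > 0 \<Longrightarrow> (\<lambda>n. trace_X n z \<omega>) \<longlonglongrightarrow> semicircle_transform z"
  shows "(\<lambda>n. levy_dist (spectral_cdf (normalized_matrix X n \<omega>)) semicircle_cdf) \<longlonglongrightarrow> 0"
proof -
  have "\<forall>n. \<exists>ls. length ls = n \<and> spectral_cdf (normalized_matrix X n \<omega>) = ecdf ls \<and>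
      (\<forall>z. Im z > 0 \<longrightarrow> stieltjes ls z = trace_X n z \<omega>)"
    by (meson spectral_cdf_eq_ecdf)
  from choice[OF this] obtain ls where ls: "\<And>n. length (ls n) = n"
    "\<And>n. spectral_cdf (normalized_matrix X n \<omega>) = ecdf (ls n)"
    "\<And>n z. Im z > 0 \<Longrightarrow> stieltjes (ls n) z = trace_X n z \<omega>" by blast
  have "(\<lambda>m. levy_dist (ecdf (ls (Suc m))) semicircle_cdf) \<longlonglongrightarrow> 0"
  proof (rule levy_convergence)
    show "ls (Suc m) \<noteq> []" for m using ls(1)[of "Suc m"] by auto
    show "(\<lambda>m. stieltjes (ls (Suc m)) z) \<longlonglongrightarrow> semicircle_transform z" if "Im z > 0" for z
      unfolding ls(3)[OF that] by (rule LIMSEQ_Suc[OF assms[OF that]])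
  qed
  then show ?thesis unfolding ls(2) by (rule LIMSEQ_imp_Suc)
qed

end

theorem corollary10:
  fixes M :: "'a measure"
    and X :: "int \<Rightarrow> int \<Rightarrow> 'a \<Rightarrow> real"
    and \<sigma> :: "int \<Rightarrow> int \<Rightarrow> real"
    and h :: "real \<Rightarrow> real"
    and C :: real
  assumes "prob_space M"
    and "\<And>i j. X i j \<in> borel_measurable M"
    and "\<And>i j. integrable M (\<lambda>\<omega>. (X i j \<omega>)\<^sup>2)"
    and "\<And>i j. (LINT \<omega>|M. X i j \<omega>) = 0"
    and "\<And>i j. (LINT \<omega>|M. (X i j \<omega>)\<^sup>2) = (\<sigma> i j)\<^sup>2"
    and "\<And>i j. 1 \<le> j \<Longrightarrow> j \<le> i \<Longrightarrow>
           AE \<omega> in M. real_cond_exp M (past_algebra M X 1 i j) (X i j) \<omega> = 0"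
    and "\<And>x. 0 \<le> x \<Longrightarrow> 1 \<le> h x"
    and "mono_on {0..} h"
    and "antimono_on {0<..} (\<lambda>x. h x / x)"
    and "summable (\<lambda>n. 1 / (real (Suc n) * h (real (Suc n))))"
    and "0 < C"
    and "(SUP (i, j). \<integral>\<^sup>+\<omega>. ennreal ((X i j \<omega>)\<^sup>2 * h \<bar>X i j \<omega>\<bar>) \<partial>M) \<le> ennreal C"
    and "AE \<omega> in M.
           (\<lambda>a. limsup (\<lambda>n. ereal (1 / (real n)\<^sup>2 *
              (\<Sum>i\<in>{1..int n}. \<Sum>j\<in>{1..i}.
                 \<bar>real_cond_exp M (past_algebra M X a i j)
                    (\<lambda>\<omega>'. (X i j \<omega>')\<^sup>2 - (\<sigma> i j)\<^sup>2) \<omega>\<bar>)))) \<longlonglongrightarrow> 0"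
    and "(\<lambda>n. 1 / (real n)\<^sup>2 *
              (\<Sum>i\<in>{1..int n}. \<Sum>j\<in>{1..i}. \<bar>(\<sigma> i j)\<^sup>2 - 1\<bar>)) \<longlonglongrightarrow> 0"
  shows "AE \<omega> in M.
           (\<lambda>n. levy_dist (spectral_cdf (normalized_matrix X n \<omega>)) semicircle_cdf)
             \<longlonglongrightarrow> 0"
proof -
  have moment: "(\<integral>\<^sup>+\<omega>. ennreal ((X i j \<omega>)\<^sup>2 * h \<bar>X i j \<omega>\<bar>) \<partial>M) \<le> ennreal C" for i j
    using assms(12) by (rule order_trans[rotated]) (rule SUP_upper2[of "(i, j)"], auto)
  interpret prob_space M by (rule assms(1))
  interpret martingale_array M X h C
    by unfold_locales (use assms(2,3,6-8,11) moment in auto)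
  let ?S = "\<lambda>a n \<omega>. 1 / (real n)\<^sup>2 * (\<Sum>i\<in>{1..int n}. \<Sum>j\<in>{1..i}.
      \<bar>real_cond_exp M (past_algebra M X a i j) (\<lambda>\<omega>'. (X i j \<omega>')\<^sup>2 - (\<sigma> i j)\<^sup>2) \<omega>\<bar>)"
  have mean_le: "mean_gap a \<sigma> n \<omega> \<le> ?S a n \<omega>" for a n \<omega>
  proof -
    have "(\<Sum>i<n. \<Sum>j<i. var_gap a \<sigma> i j \<omega>) \<le> (\<Sum>i\<in>{1..int n}. \<Sum>j\<in>{1..i}.
      \<bar>real_cond_exp M (past_algebra M X a i j) (\<lambda>\<omega>'. (X i j \<omega>')\<^sup>2 - (\<sigma> i j)\<^sup>2) \<omega>\<bar>)"
      unfolding var_gap_def by (rule lower_triangle_sum_le) simp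
    from divide_right_mono[OF this, of "(real n)\<^sup>2"] show ?thesis by (simp add: mean_gap_def)
  qed
  have gap: "AE \<omega> in M. \<forall>\<epsilon>>0. \<exists>a\<ge>1. \<forall>\<^sub>F n in sequentially. mean_gap a \<sigma> n \<omega> < \<epsilon>"
    using assms(13)
  proof eventually_elim
    case (elim \<omega>)
    show ?case
    proof (intro allI impI)
      fix \<epsilon> :: real assume "\<epsilon> > 0"
      then have "\<forall>\<^sub>F a in sequentially. limsup (\<lambda>n. ereal (?S a n \<omega>)) < ereal \<epsilon>"
        using order_tendstoD(2)[OF elim, of "ereal \<epsilon>"] by simp
      from eventually_conj[OF this eventually_ge_at_top[of 1]]
      obtain a where a: "limsup (\<lambda>n. ereal (?S a n \<omega>)) < ereal \<epsilon>" "a \<ge> 1"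
        unfolding eventually_sequentially by blast
      have "\<forall>\<^sub>F n in sequentially. ereal (?S a n \<omega>) < ereal \<epsilon>" by (rule Limsup_lessD[OF a(1)])
      then have "\<forall>\<^sub>F n in sequentially. mean_gap a \<sigma> n \<omega> < \<epsilon>"
      proof eventually_elim
        case (elim n)
        then have "?S a n \<omega> < \<epsilon>" by (simp only: less_ereal.simps)
        with mean_le[of a n \<omega>] show ?case by (rule le_less_trans)
      qed
      with a(2) show "\<exists>a\<ge>1. \<forall>\<^sub>F n in sequentially. mean_gap a \<sigma> n \<omega> < \<epsilon>" by blast
    qed
  qed
  have err: "mean_var_error \<sigma> \<longlonglongrightarrow> 0"
  proof (rule tendsto_sandwich[OF _ _ tendsto_const assms(14)])
    show "\<forall>\<^sub>F n in sequentially. 0 \<le> mean_var_error \<sigma> n"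
      unfolding mean_var_error_def by (intro always_eventually allI divide_nonneg_nonneg sum_nonneg) auto
    show "\<forall>\<^sub>F n in sequentially. mean_var_error \<sigma> n \<le> 1 / (real n)\<^sup>2 *
              (\<Sum>i\<in>{1..int n}. \<Sum>j\<in>{1..i}. \<bar>(\<sigma> i j)\<^sup>2 - 1\<bar>)"
    proof (intro always_eventually allI)
      fix n
      have "(\<Sum>i<n. \<Sum>j<i. \<bar>(\<sigma> (int i + 1) (int j + 1))\<^sup>2 - 1\<bar>) \<le> (\<Sum>i\<in>{1..int n}. \<Sum>j\<in>{1..i}. \<bar>(\<sigma> i j)\<^sup>2 - 1\<bar>)"
        by (rule lower_triangle_sum_le) simp
      from divide_right_mono[OF this, of "(real n)\<^sup>2"]
      show "mean_var_error \<sigma> n \<le> 1 / (real n)\<^sup>2 * (\<Sum>i\<in>{1..int n}. \<Sum>j\<in>{1..i}. \<bar>(\<sigma> i j)\<^sup>2 - 1\<bar>)"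
        by (simp add: mean_var_error_def)
    qed
  qed
  let ?Q = "{z. Re z \<in> \<rat> \<and> Im z \<in> \<rat>} \<inter> {z. Im z > 0}"
  have "AE \<omega> in M. \<forall>z\<in>?Q. (\<lambda>n. trace_X n z \<omega>) \<longlonglongrightarrow> semicircle_transform z"
  proof (subst AE_ball_countable)
    show "countable ?Q" by (rule countable_subset[OF _ countable_complex_rationals]) auto
    show "\<forall>z\<in>?Q. AE \<omega> in M. (\<lambda>n. trace_X n z \<omega>) \<longlonglongrightarrow> semicircle_transform z"
      by (intro ballI trace_X_convergence[OF _ assms(5,10) gap err]) simp
  qed
  then show ?thesis
  proof eventually_elim
    case (elim \<omega>)
    show ?case
      by (rule spectral_cdf_convergence, rule trace_X_convergence_everywhere) (use elim in auto)
  qed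
qed

end
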